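(* Let $d\ge 1$, $n=2$, and $p\in\mathcal{F}_{\mathbb{R}}$. Then there is a proper real algebraic subset $Z\subset\mathbb{C}\simeq\mathbb{R}^2$ such that for every $c\in\mathbb{C}\setminus Z$, the N-path $N_s(p)$, with the parameter $s$ varied along the piecewise-linear path $[0,c]\cup[c,1)\subset\mathbb{C}$ (the segment from $0$ to $c$ followed by the half-open segment from $c$ to $1$, with the endpoint $1$ excluded), does not meet the ramification locus of $\Phi$.
   Context: Fix $d\ge 1$. Let $\mathcal{F}$ be the set of polynomials in $\mathbb{C}[t,x_1,x_2]$ that are homogeneous of total degree $d$ and take the value $1$ at $(1,0,0)$, and let $\mathcal{F}_{\mathbb{R}}=\mathcal{F}\cap\mathbb{R}[t,x_1,x_2]$. Let $\mathcal{M}$ be the complex vector space of pairs $(D,R)$ of complex symmetric $d\times d$ matrices with $D$ diagonal, and $\Phi\colon\mathcal{M}\to\mathcal{F}$, $\Phi(D,R)=\det(tI_d+x_1D+x_2R)$; one has $\dim_{\mathbb{C}}\mathcal{M}=\dim_{\mathbb{C}}\mathcal{F}$. The ramification locus of $\Phi$ is understood as the set of those $q\in\mathcal{F}$ over which $\Phi$ is ramified, i.e. for which there is $(D,R)\in\Phi^{-1}(q)$ at which the differential of $\Phi$ is not bijective. For a linear form $\ell$ in $x_1,x_2$ and $s\in\mathbb{C}$ define linear operators on $\mathbb{C}[t,x_1,x_2]$ by $T^\ell_s(p)=p+s\,\ell\,\frac{\partial p}{\partial t}$, $G_s(p)=p(t,sx_1,sx_2)$, $F_s=(T^{x_1}_s)^d(T^{x_2}_s)^d$,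 and $N_s=F_{1-s}G_s$. These map $\mathcal{F}$ to itself. The N-path of $p$ is $s\mapsto N_s(p)$; one has $N_1(p)=p$. *)

theory Defs
  imports
    "Jordan_Normal_Form.Determinant"
    "HOL-Analysis.Derivative"
    "HOL-Analysis.Line_Segment"
    "HOL-Computational_Algebra.Polynomial"
begin

text \<open>
  The ring of polynomials in \<open>t\<close>, \<open>x1\<close>, \<open>x2\<close> over the complex numbers is rendered as the iterated
  polynomial ring with \<open>t\<close> as outermost and \<open>x2\<close> as innermost variable.  Hence
  \<open>coeff (coeff (coeff q i) j) k\<close> is the coefficient of \<open>t^i * x1^j * x2^k\<close>, and the library's
  \<open>pderiv\<close> on this type is the partial derivative with respect to \<open>t\<close>.
\<close>

type_synonym poly3 = "complex poly poly poly"

definition const3 :: "complex \<Rightarrow> poly3" where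
  "const3 c = [:[:[:c:]:]:]"

definition var_t :: poly3 where "var_t = [:0, 1:]"
definition var_x1 :: poly3 where "var_x1 = [:[:0, 1:]:]"
definition var_x2 :: poly3 where "var_x2 = [:[:[:0, 1:]:]:]"

definition coeff3 :: "poly3 \<Rightarrow> nat \<Rightarrow> nat \<Rightarrow> nat \<Rightarrow> complex" where
  "coeff3 q i j k = coeff (coeff (coeff q i) j) k"

definition eval3 :: "poly3 \<Rightarrow> complex \<Rightarrow> complex \<Rightarrow> complex \<Rightarrow> complex" where
  "eval3 q a b c = poly (poly (poly q [:[:a:]:]) [:b:]) c"

definition homogeneous3 :: "nat \<Rightarrow> poly3 \<Rightarrow> bool" where
  "homogeneous3 d q \<longleftrightarrow> (\<forall>i j k. coeff3 q i j k \<noteq> 0 \<longrightarrow> i + j + k = d)"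

definition forms :: "nat \<Rightarrow> poly3 set" where
  "forms d = {q. homogeneous3 d q \<and> eval3 q 1 0 0 = 1}"

definition real_forms :: "nat \<Rightarrow> poly3 set" where
  "real_forms d = {q \<in> forms d. \<forall>i j k. coeff3 q i j k \<in> \<real>}"

text \<open>\<open>forms d\<close> is an affine space; the following is its space of translations, i.e. its tangent
  space at every point.\<close>

definition forms_tangent :: "nat \<Rightarrow> poly3 set" where
  "forms_tangent d = {q. homogeneous3 d q \<and> eval3 q 1 0 0 = 0}"

definition matrix_pairs :: "nat \<Rightarrow> (complex mat \<times> complex mat) set" where
  "matrix_pairs d = {(D, R). D \<in> carrier_mat d d \<and> R \<in> carrier_mat d d \<and>
     diagonal_mat D \<and> transpose_mat R = R}"

definition Phi :: "nat \<Rightarrow> complex mat \<times> complex mat \<Rightarrow> poly3" where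
  "Phi d = (\<lambda>(D, R). det (var_t \<cdot>\<^sub>m 1\<^sub>m d + var_x1 \<cdot>\<^sub>m map_mat const3 D + var_x2 \<cdot>\<^sub>m map_mat const3 R))"

text \<open>
  The differential of the polynomial map \<open>Phi d\<close> at \<open>(D, R)\<close> in direction \<open>(E, S)\<close>, i.e. the
  derivative at \<open>e = 0\<close> of \<open>e \<mapsto> Phi d (D + e E, R + e S)\<close>, taken coefficientwise.  All values of
  \<open>Phi d\<close> on \<open>d \<times> d\<close> matrices have degree at most \<open>d\<close> in each variable, so the sum below
  runs over all the coefficients.
\<close>

definition dPhi ::
  "nat \<Rightarrow> complex mat \<times> complex mat \<Rightarrow> complex mat \<times> complex mat \<Rightarrow> poly3" where
  "dPhi d = (\<lambda>(D, R) (E, S).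
     \<Sum>i\<le>d. \<Sum>j\<le>d. \<Sum>k\<le>d.
       const3 (deriv (\<lambda>e. coeff3 (Phi d (D + e \<cdot>\<^sub>m E, R + e \<cdot>\<^sub>m S)) i j k) 0)
         * var_t ^ i * var_x1 ^ j * var_x2 ^ k)"

definition ramification_locus :: "nat \<Rightarrow> poly3 set" where
  "ramification_locus d = {q \<in> forms d. \<exists>X \<in> matrix_pairs d.
     Phi d X = q \<and> \<not> bij_betw (dPhi d X) (matrix_pairs d) (forms_tangent d)}"

definition T_op :: "poly3 \<Rightarrow> complex \<Rightarrow> poly3 \<Rightarrow> poly3" where
  "T_op l s p = p + const3 s * l * pderiv p"

text \<open>The substitution \<open>p(t, s * x1, s * x2)\<close>: the inner \<open>pcompose\<close> replaces \<open>x2\<close>, the outer one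
  replaces \<open>x1\<close>.\<close>

definition G_op :: "complex \<Rightarrow> poly3 \<Rightarrow> poly3" where
  "G_op s p = map_poly (\<lambda>u. pcompose (map_poly (\<lambda>v. pcompose v [:0, s:]) u) [:0, [:s:]:]) p"

definition F_op :: "nat \<Rightarrow> complex \<Rightarrow> poly3 \<Rightarrow> poly3" where
  "F_op d s = (T_op var_x1 s ^^ d) \<circ> (T_op var_x2 s ^^ d)"

definition N_op :: "nat \<Rightarrow> complex \<Rightarrow> poly3 \<Rightarrow> poly3" where
  "N_op d s = F_op d (1 - s) \<circ> G_op s"

text \<open>Real algebraic subsets of the complex plane, identified with the real plane by real and
  imaginary part (which are substituted for the outer and the inner variable, respectively).\<close>

definition real_algebraic_set :: "complex set \<Rightarrow> bool" where
  "real_algebraic_set Z \<longleftrightarrow> (\<exists>P :: real poly poly set. finite P \<and>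
     Z = {z. \<forall>f \<in> P. poly (poly f [:Re z:]) (Im z) = 0})"

end

theory Submission
  imports Defs
begin

text \<open>Let \<open>q\<close> be a form whose curve \<open>q = 0\<close> is smooth and meets the line \<open>x2 = 0\<close> transversally.  Then \<open>\<Phi>\<close>
  is unramified over \<open>q\<close>: for \<open>M = t I + x1 D + x2 R\<close> with \<open>det M = q\<close> and adjugate \<open>A\<close>, the differential is
  \<open>(E, S) \<mapsto> tr ((x1 E + x2 S) A)\<close>.  If it vanishes at \<open>(E, S)\<close>, transversality gives \<open>E = 0\<close>, and then \<open>S\<close>
  is a first-order deformation of the symmetric determinantal representation \<open>M\<close> of \<open>q\<close>.  Such a deformation
  is trivial because, modulo \<open>q\<close>, \<open>A\<close> is the square of a line bundle section and theta characteristics are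
  discrete, which can be expressed by matrix identities.  Both conditions on \<open>q\<close> say
  that an ideal contains all monomials of some degree, so along the algebraic N-path they fail at finitely
  many parameters only, once they hold at \<open>s = 0\<close>.  There the form is \<open>F_1 (t^d)\<close> for every \<open>p\<close>; it satisfies
  first-order differential recursions which put a nonzero constant into the relevant ideals, saturated by
  \<open>t\<close>, \<open>x1\<close>, \<open>x2\<close> and \<open>x1 - x2\<close>.  A finite set of bad parameters is avoided off finitely many real lines
  through \<open>0\<close> or \<open>1\<close>.\<close>

section \<open>Forms in three variables\<close>

text \<open>Membership of all monomials of one degree \<open>N\<close> stands in for an empty zero
  set. This makes the conditions on a form finite linear algebra, and it supplies cofactors: the
  partial derivatives of \<open>det M\<close> are traces of \<open>I\<close>, \<open>D\<close>,
  \<open>R\<close> against the adjugate, so x1^N and x2^N become traces of symmetric matrices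
  against it and can enter matrix identities.

  Two powers are needed because either one trivialises a deformation only up to that power as a
  factor. A single factor cannot be divided out; two coprime ones can, since the remainders to be
  compared have degree \<open>N - 1\<close>, one too small to contain x1^N.

  The form at s = 0 is (1 + x1 d/dt)^d (1 + x2 d/dt)^d t^d, and its recursions come from this
  product. On the line t = 0 it is a multiple of the sum of (d choose b)^2 x1^b x2^(d-b), which
  obeys a second order equation instead; only there does the factor x1 - x2 arise. The path is
  opened at s = 1 because it ends there in \<open>p\<close> itself, about which nothing is
  known.\<close>

lemma poly3_eqI: "(\<And>i j k. coeff3 p i j k = coeff3 q i j k) \<Longrightarrow> p = q"
  by (intro poly_eqI) (simp add: coeff3_def)

lemma coeff3_linear [simp]:
  "coeff3 0 i j k = 0"
  "coeff3 (p + q) i j k = coeff3 p i j k + coeff3 q i j k"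
  "coeff3 (p - q) i j k = coeff3 p i j k - coeff3 q i j k"
  "coeff3 (- p) i j k = - coeff3 p i j k"
  by (simp_all add: coeff3_def)

lemma coeff3_sum: "coeff3 (sum f A) i j k = (\<Sum>a\<in>A. coeff3 (f a) i j k)"
  by (simp add: coeff3_def coeff_sum)

lemma coeff3_mult:
  "coeff3 (p * q) i j k = (\<Sum>a\<le>i. \<Sum>b\<le>j. \<Sum>c\<le>k. coeff3 p a b c * coeff3 q (i - a) (j - b) (k - c))"
  by (simp add: coeff3_def coeff_mult coeff_sum)

lemma const3_hom [simp]:
  "const3 0 = 0" "const3 1 = 1" "const3 (a + b) = const3 a + const3 b"
  "const3 (a - b) = const3 a - const3 b" "const3 (- a) = - const3 a"
  "const3 (a * b) = const3 a * const3 b" "const3 a = const3 b \<longleftrightarrow> a = b"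
  by (simp_all add: const3_def one_pCons)

lemma const3_eq_0_iff [simp]: "const3 a = 0 \<longleftrightarrow> a = 0"
  by (simp add: const3_def)

lemma const3_of_nat [simp]: "const3 (of_nat n) = of_nat n"
  by (induction n) simp_all

lemma coeff3_const3_mult [simp]: "coeff3 (const3 c * p) i j k = c * coeff3 p i j k"
  by (simp add: coeff3_def const3_def)

lemma coeff3_const3_mult_right [simp]: "coeff3 (p * const3 c) i j k = coeff3 p i j k * c"
  by (subst mult.commute) simp

lemma coeff3_of_nat_mult [simp]: "coeff3 (of_nat n * p) i j k = of_nat n * coeff3 p i j k"
  unfolding const3_of_nat [symmetric] coeff3_const3_mult ..

lemma coeff3_var_mult:
  "coeff3 (var_t * p) i j k = (if i = 0 then 0 else coeff3 p (i - 1) j k)"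
  "coeff3 (var_x1 * p) i j k = (if j = 0 then 0 else coeff3 p i (j - 1) k)"
  "coeff3 (var_x2 * p) i j k = (if k = 0 then 0 else coeff3 p i j (k - 1))"
  by (simp_all add: coeff3_def var_t_def var_x1_def var_x2_def coeff_pCons split: nat.split)

definition mono3 :: "nat \<Rightarrow> nat \<Rightarrow> nat \<Rightarrow> poly3" where
  "mono3 i j k = var_t ^ i * var_x1 ^ j * var_x2 ^ k"

lemma coeff3_1: "coeff3 1 i j k = (if i = 0 \<and> j = 0 \<and> k = 0 then 1 else 0)"
  by (auto simp: coeff3_def)

lemma mono3_0 [simp]: "mono3 0 0 0 = 1"
  by (simp add: mono3_def)

lemma coeff3_mono3:
  "coeff3 (mono3 a b c) i j k = (if i = a \<and> j = b \<and> k = c then 1 else 0)"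
proof -
  have x2: "coeff3 (var_x2 ^ c) i j k = (if i = 0 \<and> j = 0 \<and> k = c then 1 else 0)" for i j k c
    by (induction c arbitrary: k) (auto simp: coeff3_1 coeff3_var_mult)
  have x1: "coeff3 (var_x1 ^ b * var_x2 ^ c) i j k = (if i = 0 \<and> j = b \<and> k = c then 1 else 0)" for i j k
    by (induction b arbitrary: j) (auto simp: x2 coeff3_var_mult mult.assoc)
  have "coeff3 (var_t ^ a * (var_x1 ^ b * var_x2 ^ c)) i j k = (if i = a \<and> j = b \<and> k = c then 1 else 0)"
    by (induction a arbitrary: i) (auto simp: x1 coeff3_var_mult mult.assoc)
  then show ?thesis by (simp add: mono3_def mult.assoc)
qed

section \<open>Homogeneous components\<close>

definition hcomp :: "nat \<Rightarrow> poly3 \<Rightarrow> poly3" where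
  "hcomp n p = (\<Sum>(i, j, k) \<in> {(i, j, k). i + j + k = n}. const3 (coeff3 p i j k) * mono3 i j k)"

lemma finite_triples: "finite {(i, j, k). i + j + k = (n::nat)}"
  by (rule finite_subset [of _ "{..n} \<times> {..n} \<times> {..n}"]) auto

lemma coeff3_hcomp: "coeff3 (hcomp n p) i j k = (if i + j + k = n then coeff3 p i j k else 0)"
proof -
  have "coeff3 (hcomp n p) i j k
    = (\<Sum>x \<in> {(i, j, k). i + j + k = n}. if x = (i, j, k) then coeff3 p i j k else 0)"
    unfolding hcomp_def coeff3_sum
    by (rule sum.cong) (auto simp: coeff3_mono3 split: if_splits)
  also have "\<dots> = (if i + j + k = n then coeff3 p i j k else 0)"
    by (subst sum.delta) (auto simp: finite_triples)
  finally show ?thesis .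
qed

lemma homogeneous3_hcomp: "homogeneous3 n (hcomp n p)"
  by (simp add: homogeneous3_def coeff3_hcomp)

lemma homogeneous3_iff_hcomp: "homogeneous3 n p \<longleftrightarrow> hcomp n p = p"
proof
  assume "homogeneous3 n p"
  then show "hcomp n p = p"
    by (intro poly3_eqI) (auto simp: coeff3_hcomp homogeneous3_def)
next
  assume "hcomp n p = p"
  then show "homogeneous3 n p"
    using homogeneous3_hcomp [of n p] by simp
qed

lemma hcomp_linear [simp]:
  "hcomp n 0 = 0" "hcomp n (p + q) = hcomp n p + hcomp n q" "hcomp n (p - q) = hcomp n p - hcomp n q"
  by (auto intro!: poly3_eqI simp: coeff3_hcomp)

lemma homogeneous3_expand:
  "homogeneous3 n p \<Longrightarrow> p = (\<Sum>(i, j, k) \<in> {(i, j, k). i + j + k = n}. const3 (coeff3 p i j k) * mono3 i j k)"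
  unfolding homogeneous3_iff_hcomp hcomp_def by (rule sym)

text \<open>Multiplication by a form shifts the grading. Cofactors of a form in an ideal generated
  by forms can therefore be cut down to homogeneous ones.\<close>

lemma hcomp_mult:
  assumes "homogeneous3 m q"
  shows "hcomp (m + n) (q * p) = q * hcomp n p"
proof (rule poly3_eqI)
  fix i j k
  show "coeff3 (hcomp (m + n) (q * p)) i j k = coeff3 (q * hcomp n p) i j k"
  proof (cases "i + j + k = m + n")
    case True
    have "coeff3 q a b c * coeff3 p (i - a) (j - b) (k - c)
        = coeff3 q a b c * coeff3 (hcomp n p) (i - a) (j - b) (k - c)"
      if "a \<le> i" "b \<le> j" "c \<le> k" for a b c
    proof (cases "coeff3 q a b c = 0")
      case False
      then have "a + b + c = m" using assms homogeneous3_def by blast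
      then have "(i - a) + (j - b) + (k - c) = n" using True that by linarith
      then show ?thesis by (simp add: coeff3_hcomp)
    qed simp
    then show ?thesis using True
      by (simp only: coeff3_hcomp if_True coeff3_mult refl) (intro sum.cong refl, simp)
  next
    case False
    have z: "coeff3 q a b c * coeff3 (hcomp n p) (i - a) (j - b) (k - c) = 0"
      if "a \<le> i" "b \<le> j" "c \<le> k" for a b c
    proof (cases "coeff3 q a b c = 0")
      case False
      then have "a + b + c = m" using assms homogeneous3_def by blast
      then have "(i - a) + (j - b) + (k - c) \<noteq> n" using \<open>i + j + k \<noteq> m + n\<close> that by linarith
      then show ?thesis by (simp add: coeff3_hcomp)
    qed simp
    have "(\<Sum>a\<le>i. \<Sum>b\<le>j. \<Sum>c\<le>k. coeff3 q a b c * coeff3 (hcomp n p) (i - a) (j - b) (k - c)) = 0"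
      by (intro sum.neutral ballI z) auto
    then show ?thesis using False
      by (simp only: coeff3_hcomp [of "m + n"] if_False coeff3_mult [of q "hcomp n p"])
  qed
qed

lemma homogeneous3_0 [simp]: "homogeneous3 n 0"
  by (simp add: homogeneous3_def)

lemma homogeneous3_add [intro]: "homogeneous3 n p \<Longrightarrow> homogeneous3 n q \<Longrightarrow> homogeneous3 n (p + q)"
  by (simp add: homogeneous3_iff_hcomp)

lemma homogeneous3_diff [intro]: "homogeneous3 n p \<Longrightarrow> homogeneous3 n q \<Longrightarrow> homogeneous3 n (p - q)"
  by (simp add: homogeneous3_iff_hcomp)

lemma homogeneous3_uminus [intro]: "homogeneous3 n p \<Longrightarrow> homogeneous3 n (- p)"
  using homogeneous3_diff [of n 0 p] by simp

lemma homogeneous3_sum [intro]: "(\<And>a. a \<in> A \<Longrightarrow> homogeneous3 n (f a)) \<Longrightarrow> homogeneous3 n (sum f A)"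
  by (induction A rule: infinite_finite_induct) auto

lemma homogeneous3_mult: "homogeneous3 m p \<Longrightarrow> homogeneous3 n q \<Longrightarrow> homogeneous3 (m + n) (p * q)"
  using hcomp_mult [of m p n q] by (simp add: homogeneous3_iff_hcomp)

lemma homogeneous3_mult_eq: "homogeneous3 m p \<Longrightarrow> homogeneous3 n q \<Longrightarrow> l = m + n \<Longrightarrow> homogeneous3 l (p * q)"
  using homogeneous3_mult by simp

lemma homogeneous3_const3 [simp]: "homogeneous3 0 (const3 c)"
  using coeff3_const3_mult [of c 1] by (simp add: homogeneous3_def coeff3_1)

lemma homogeneous3_1 [simp]: "homogeneous3 0 1"
  by (simp add: homogeneous3_def coeff3_1)

lemma homogeneous3_mono3: "homogeneous3 (i + j + k) (mono3 i j k)"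
  by (simp add: homogeneous3_def coeff3_mono3)

lemma homogeneous3_var [simp]:
  "homogeneous3 (Suc 0) var_t" "homogeneous3 (Suc 0) var_x1" "homogeneous3 (Suc 0) var_x2"
  using homogeneous3_mono3 [of 1 0 0] homogeneous3_mono3 [of 0 1 0] homogeneous3_mono3 [of 0 0 1]
  by (simp_all add: mono3_def)

lemma homogeneous3_const3_mult [intro]: "homogeneous3 n p \<Longrightarrow> homogeneous3 n (const3 c * p)"
  using homogeneous3_mult [of 0 "const3 c" n p] by simp

lemma homogeneous3_prod:
  "(\<And>a. a \<in> A \<Longrightarrow> homogeneous3 (w a) (f a)) \<Longrightarrow> homogeneous3 (sum w A) (prod f A)"
  by (induction A rule: infinite_finite_induct) (auto intro: homogeneous3_mult)

text \<open>By \<open>hcomp_mult\<close>, homogeneity of the product reads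
  \<open>q * hcomp n p = q * p\<close>, and \<open>q\<close> cancels in a domain. This gives degrees
  to quotients by \<open>det M\<close>, whose products with it are what is known.\<close>

lemma homogeneous3_cancel:
  assumes "homogeneous3 m q" "q \<noteq> 0" "homogeneous3 (m + n) (q * p)"
  shows "homogeneous3 n p"
  using assms hcomp_mult [OF assms(1), of n p] by (simp add: homogeneous3_iff_hcomp)

lemma homogeneous3_degree_le: "homogeneous3 n p \<Longrightarrow> degree p \<le> n"
proof (rule degree_le, safe)
  fix i assume h: "homogeneous3 n p" "i > n"
  then have "coeff3 p i j k = 0" for j k
    by (metis add.assoc homogeneous3_def le_add1 not_le)
  then show "coeff p i = 0" by (intro poly_eqI) (simp add: coeff3_def)
qed

lemma eval3_simps:
  "eval3 (p + q) a b c = eval3 p a b c + eval3 q a b c"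
  "eval3 (p * q) a b c = eval3 p a b c * eval3 q a b c"
  "eval3 (sum f A) a b c = (\<Sum>i\<in>A. eval3 (f i) a b c)"
  "eval3 (prod f A) a b c = (\<Prod>i\<in>A. eval3 (f i) a b c)"
  "eval3 (const3 z) a b c = z"
  "eval3 0 a b c = 0" "eval3 1 a b c = 1"
  "eval3 var_t a b c = a" "eval3 var_x1 a b c = b" "eval3 var_x2 a b c = c"
  by (simp_all add: eval3_def poly_sum poly_prod const3_def var_t_def var_x1_def var_x2_def)

lemma eval3_power: "eval3 (p ^ n) a b c = eval3 p a b c ^ n"
  by (simp add: eval3_def poly_power)

lemma eval3_1_0_0:
  assumes "homogeneous3 d q"
  shows "eval3 q 1 0 0 = coeff3 q d 0 0"
proof -
  have "eval3 q 1 0 0 = (\<Sum>x \<in> {(i, j, k). i + j + k = d}. if x = (d, 0, 0) then coeff3 q d 0 0 else 0)"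
    by (subst homogeneous3_expand [OF assms])
      (auto simp: eval3_simps mono3_def eval3_power power_0_left intro!: sum.cong)
  also have "\<dots> = coeff3 q d 0 0"
    by (subst sum.delta) (auto simp: finite_triples)
  finally show ?thesis .
qed

lemma forms_iff: "q \<in> forms d \<longleftrightarrow> homogeneous3 d q \<and> coeff3 q d 0 0 = 1"
  using eval3_1_0_0 by (auto simp: forms_def)

lemma forms_tangent_iff: "q \<in> forms_tangent d \<longleftrightarrow> homogeneous3 d q \<and> coeff3 q d 0 0 = 0"
  using eval3_1_0_0 by (auto simp: forms_tangent_def)

definition pd_x1 :: "poly3 \<Rightarrow> poly3" where "pd_x1 = map_poly pderiv"
definition pd_x2 :: "poly3 \<Rightarrow> poly3" where "pd_x2 = map_poly (map_poly pderiv)"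

lemma coeff3_pd:
  "coeff3 (pderiv p) i j k = of_nat (Suc i) * coeff3 p (Suc i) j k"
  "coeff3 (pd_x1 p) i j k = of_nat (Suc j) * coeff3 p i (Suc j) k"
  "coeff3 (pd_x2 p) i j k = of_nat (Suc k) * coeff3 p i j (Suc k)"
proof -
  have *: "coeff (of_nat n * (u :: 'a::comm_semiring_1 poly)) m = of_nat n * coeff u m" for n u m
    by (simp add: of_nat_poly)
  show "coeff3 (pderiv p) i j k = of_nat (Suc i) * coeff3 p (Suc i) j k"
    by (simp only: coeff3_def coeff_pderiv *)
  show "coeff3 (pd_x1 p) i j k = of_nat (Suc j) * coeff3 p i (Suc j) k"
    by (simp only: coeff3_def pd_x1_def coeff_map_poly pderiv_0 coeff_pderiv *)
  show "coeff3 (pd_x2 p) i j k = of_nat (Suc k) * coeff3 p i j (Suc k)"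
    by (simp only: coeff3_def pd_x2_def coeff_map_poly pderiv_0 map_poly_0 coeff_pderiv *)
qed

lemma homogeneous3_pd:
  assumes "homogeneous3 (Suc n) p"
  shows "homogeneous3 n (pderiv p)" "homogeneous3 n (pd_x1 p)" "homogeneous3 n (pd_x2 p)"
  using assms by (force simp: homogeneous3_def coeff3_pd simp del: of_nat_Suc)+

section \<open>Ideals, saturation and radical\<close>

definition is_ideal :: "'a::comm_ring_1 set \<Rightarrow> bool" where
  "is_ideal K \<longleftrightarrow> 0 \<in> K \<and> (\<forall>a\<in>K. \<forall>b\<in>K. a + b \<in> K) \<and> (\<forall>a\<in>K. \<forall>r. r * a \<in> K)"

definition ideal_adjoin :: "'a::comm_ring_1 set \<Rightarrow> 'a \<Rightarrow> 'a set" where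
  "ideal_adjoin K v = {a + b * v | a b. a \<in> K}"

text \<open>The union of the colon ideals of \<open>K\<close> by \<open>z ^ n\<close>, that is, the
  preimage of the extension of \<open>K\<close> to the localisation at \<open>z\<close>. Divisors of
  \<open>z\<close> can be cancelled in it.\<close>

definition saturation :: "'a::comm_ring_1 \<Rightarrow> 'a set \<Rightarrow> 'a set" where
  "saturation z K = {w. \<exists>n. z ^ n * w \<in> K}"

definition ideal_radical :: "'a::comm_ring_1 set \<Rightarrow> 'a set" where
  "ideal_radical K = {u. \<exists>n. u ^ n \<in> K}"

lemma is_idealD:
  assumes "is_ideal K"
  shows "0 \<in> K" "a \<in> K \<Longrightarrow> b \<in> K \<Longrightarrow> a + b \<in> K" "a \<in> K \<Longrightarrow> r * a \<in> K"
    "a \<in> K \<Longrightarrow> a * r \<in> K" "a \<in> K \<Longrightarrow> - a \<in> K" "a \<in> K \<Longrightarrow> b \<in> K \<Longrightarrow> a - b \<in> K"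
proof -
  show 0: "0 \<in> K" and add: "a \<in> K \<Longrightarrow> b \<in> K \<Longrightarrow> a + b \<in> K"
    and mult: "a \<in> K \<Longrightarrow> r * a \<in> K" for a b r
    using assms by (auto simp: is_ideal_def)
  show "a \<in> K \<Longrightarrow> a * r \<in> K" using mult [of a r] by (simp add: mult.commute)
  show neg: "a \<in> K \<Longrightarrow> - a \<in> K" for a using mult [of a "- 1"] by simp
  show "a \<in> K \<Longrightarrow> b \<in> K \<Longrightarrow> a - b \<in> K" using add [of a "- b"] neg by simp
qed

lemma is_ideal_sum: "is_ideal K \<Longrightarrow> (\<And>a. a \<in> A \<Longrightarrow> f a \<in> K) \<Longrightarrow> sum f A \<in> K"
  by (induction A rule: infinite_finite_induct) (simp_all add: is_idealD(1,2))

lemma is_ideal_dvd: "is_ideal K \<Longrightarrow> a \<in> K \<Longrightarrow> a dvd b \<Longrightarrow> b \<in> K"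
  using is_idealD(4) by (auto elim!: dvdE)

lemma is_ideal_eqI: "is_ideal K \<Longrightarrow> a \<in> K \<Longrightarrow> a - b \<in> K \<Longrightarrow> b \<in> K"
  using is_idealD(6) [of K a "a - b"] by simp

lemma ideal_adjoin:
  assumes "is_ideal K"
  shows "is_ideal (ideal_adjoin K v)" "K \<subseteq> ideal_adjoin K v" "v \<in> ideal_adjoin K v"
proof -
  show "is_ideal (ideal_adjoin K v)"
    unfolding is_ideal_def
  proof (intro conjI ballI allI)
    show "0 \<in> ideal_adjoin K v"
      unfolding ideal_adjoin_def mem_Collect_eq using is_idealD(1) [OF assms] by (metis add.right_neutral mult_zero_left)
  next
    fix a b assume "a \<in> ideal_adjoin K v" "b \<in> ideal_adjoin K v"
    then obtain a1 a2 b1 b2 where "a = a1 + a2 * v" "b = b1 + b2 * v" "a1 \<in> K" "b1 \<in> K"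
      by (auto simp: ideal_adjoin_def)
    then have "a + b = (a1 + b1) + (a2 + b2) * v" "a1 + b1 \<in> K"
      using is_idealD [OF assms] by (auto simp: algebra_simps)
    then show "a + b \<in> ideal_adjoin K v" unfolding ideal_adjoin_def by blast
  next
    fix a r assume "a \<in> ideal_adjoin K v"
    then obtain a1 a2 where "a = a1 + a2 * v" "a1 \<in> K"
      by (auto simp: ideal_adjoin_def)
    then have "r * a = r * a1 + (r * a2) * v" "r * a1 \<in> K"
      using is_idealD [OF assms] by (auto simp: algebra_simps)
    then show "r * a \<in> ideal_adjoin K v" unfolding ideal_adjoin_def by blast
  qed
  show "K \<subseteq> ideal_adjoin K v"
  proof
    fix a assume "a \<in> K"
    then have "a = a + 0 * v \<and> a \<in> K" by simp
    then show "a \<in> ideal_adjoin K v" unfolding ideal_adjoin_def by blast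
  qed
  have "v = 0 + 1 * v \<and> 0 \<in> K" using is_idealD(1) [OF assms] by simp
  then show "v \<in> ideal_adjoin K v" unfolding ideal_adjoin_def by blast
qed

lemma saturation:
  assumes K: "is_ideal K"
  shows "is_ideal (saturation z K)" "K \<subseteq> saturation z K"
    "u dvd z \<Longrightarrow> u * w \<in> saturation z K \<Longrightarrow> w \<in> saturation z K"
proof -
  show "is_ideal (saturation z K)"
    unfolding is_ideal_def
  proof (intro conjI ballI allI)
    show "0 \<in> saturation z K" using is_idealD(1) [OF K] by (auto simp: saturation_def)
  next
    fix a b assume "a \<in> saturation z K" "b \<in> saturation z K"
    then obtain m n where "z ^ m * a \<in> K" "z ^ n * b \<in> K" by (auto simp: saturation_def)
    then have "z ^ n * (z ^ m * a) + z ^ m * (z ^ n * b) \<in> K" using is_idealD [OF K] by blast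
    then have "z ^ (m + n) * (a + b) \<in> K" by (simp add: power_add algebra_simps)
    then show "a + b \<in> saturation z K" unfolding saturation_def by blast
  next
    fix a r assume "a \<in> saturation z K"
    then obtain m where "z ^ m * a \<in> K" by (auto simp: saturation_def)
    then have "r * (z ^ m * a) \<in> K" using is_idealD [OF K] by blast
    then have "z ^ m * (r * a) \<in> K" by (simp add: ac_simps)
    then show "r * a \<in> saturation z K" unfolding saturation_def by blast
  qed
  show "K \<subseteq> saturation z K"
  proof
    fix a assume "a \<in> K"
    then have "z ^ 0 * a \<in> K" by simp
    then show "a \<in> saturation z K" unfolding saturation_def by blast
  qed
  show "w \<in> saturation z K" if u: "u dvd z" and uw: "u * w \<in> saturation z K" for u w
  proof -
    obtain n where n: "z ^ n * (u * w) \<in> K" using uw unfolding saturation_def by blast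
    obtain v where v: "z = u * v" using u by auto
    have "v * (z ^ n * (u * w)) \<in> K" using is_idealD(3) [OF K n] .
    then have "z ^ Suc n * w \<in> K" using v by (simp add: ac_simps)
    then show ?thesis unfolding saturation_def by blast
  qed
qed

lemma one_in_saturation: "1 \<in> saturation z K \<longleftrightarrow> z \<in> ideal_radical K"
  by (simp add: saturation_def ideal_radical_def)

lemma ideal_radical_dvd:
  assumes "is_ideal K" "u \<in> ideal_radical K" "u dvd v"
  shows "v \<in> ideal_radical K"
proof -
  obtain n where "u ^ n \<in> K" using assms(2) by (auto simp: ideal_radical_def)
  then have "v ^ n \<in> K" using is_ideal_dvd [OF assms(1)] dvd_power_same [OF assms(3)] by blast
  then show ?thesis by (auto simp: ideal_radical_def)
qed

lemma ideal_radical_powerD: "u ^ n \<in> K \<Longrightarrow> u \<in> ideal_radical K"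
  by (auto simp: ideal_radical_def)

text \<open>Geometrically: \<open>u\<close> vanishes on the part of the zero set of \<open>K\<close>
  where \<open>v = 0\<close>, and \<open>u * v\<close> on all of it, so \<open>u\<close> does too.
  Algebraically \<open>(u ^ n) ^ m\<close> is congruent to \<open>(b * v) ^ m\<close> modulo
  \<open>K\<close>, and a further factor \<open>u ^ m\<close> turns the latter into a multiple of
  \<open>(u * v) ^ m\<close>.\<close>

lemma ideal_radical_adjoin:
  assumes K: "is_ideal K" and 1: "u \<in> ideal_radical (ideal_adjoin K v)" and 2: "u * v \<in> ideal_radical K"
  shows "u \<in> ideal_radical K"
proof -
  obtain n where "u ^ n \<in> ideal_adjoin K v" using 1 by (auto simp: ideal_radical_def)
  then obtain a b where ab: "a \<in> K" "u ^ n = a + b * v" by (auto simp: ideal_adjoin_def)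
  obtain m where m: "(u * v) ^ m \<in> K" using 2 by (auto simp: ideal_radical_def)
  have "a dvd (u ^ n) ^ m - (b * v) ^ m"
    using power_diff_sumr2 [of "u ^ n" m "b * v"] ab(2) by simp
  then have "(u ^ n) ^ m - (b * v) ^ m \<in> K" by (rule is_ideal_dvd [OF K ab(1)])
  then have "u ^ m * ((u ^ n) ^ m - (b * v) ^ m) \<in> K" by (rule is_idealD(3) [OF K])
  moreover have "b ^ m * (u * v) ^ m \<in> K" by (rule is_idealD(3) [OF K m])
  ultimately have "u ^ m * ((u ^ n) ^ m - (b * v) ^ m) + b ^ m * (u * v) ^ m \<in> K"
    by (rule is_idealD(2) [OF K])
  then have "u ^ (m + n * m) \<in> K"
    by (simp add: right_diff_distrib power_mult_distrib power_add power_mult mult.left_commute)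
  then show ?thesis by (auto simp: ideal_radical_def)
qed

text \<open>\<open>F\<close>, \<open>Fx\<close>, \<open>Fy\<close> stand for the successive
  t-derivatives of a form and of its two other first partials. Each round produces the next ones
  multiplied by \<open>x\<close>, \<open>y\<close> or \<open>t\<close>, which the saturation
  cancels. When \<open>y \<in> K\<close>, the restriction to a line, \<open>y * Fy\<close> is in the
  ideal anyway and \<open>Fy\<close> is not followed.\<close>

lemma saturation_chain:
  fixes F Fx Fy :: "nat \<Rightarrow> 'a::comm_ring_1"
  assumes K: "is_ideal K" and z: "t dvd z" "x dvd z"
    and start: "F 1 \<in> K" "Fx 0 \<in> K" "y \<in> K \<or> (y dvd z \<and> Fy 0 \<in> K)"
    and rx: "\<And>k. Fx k + x * Fx (Suc k) = c * F (Suc k)"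
    and ry: "\<And>k. Fy k + y * Fy (Suc k) = c * F (Suc k)"
    and euler: "\<And>k. t * F (Suc k) + x * Fx k + y * Fy k = e k * F k"
  shows "F (Suc k) \<in> saturation z K"
proof -
  let ?S = "saturation z K"
  note S = saturation [OF K, where z = z]
  note I = is_idealD [OF S(1)]
  have "F (Suc k) \<in> ?S \<and> Fx k \<in> ?S \<and> (y \<in> ?S \<or> (y dvd z \<and> Fy k \<in> ?S))"
  proof (induction k)
    case 0
    then show ?case using start S(2) by auto
  next
    case (Suc k)
    have "x * Fx (Suc k) = c * F (Suc k) - Fx k" using rx [of k] by (simp add: algebra_simps)
    then have xF: "x * Fx (Suc k) \<in> ?S" using Suc I(3) [of "F (Suc k)"] I(6) by simp
    then have Fx: "Fx (Suc k) \<in> ?S" by (rule S(3) [OF z(2)])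
    have "y * Fy (Suc k) = c * F (Suc k) - Fy k" using ry [of k] by (simp add: algebra_simps)
    then have yF: "y * Fy (Suc k) \<in> ?S"
      using Suc I(3) [of "F (Suc k)" c] I(4) [of y "Fy (Suc k)"] I(6) [of "c * F (Suc k)" "Fy k"] by auto
    have "t * F (Suc (Suc k)) = e (Suc k) * F (Suc k) - x * Fx (Suc k) - y * Fy (Suc k)"
      using euler [of "Suc k"] by (simp add: algebra_simps)
    then have "t * F (Suc (Suc k)) \<in> ?S" using Suc I(3) [of "F (Suc k)"] I(6) xF yF by simp
    then have "F (Suc (Suc k)) \<in> ?S" by (rule S(3) [OF z(1)])
    then show ?case using S(3) [OF _ yF] Fx Suc by blast
  qed
  then show ?thesis by simp
qed

text \<open>Two Euler relations and the equation \<open>pde\<close> are three linear equations for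
  the three derivatives of order \<open>i + j + 2\<close>, modulo those of lower order. Their
  determinant is \<open>x * y * (x - y)\<close> up to sign, which is why these three factors must be
  cancellable.\<close>

lemma saturation_grid:
  fixes H :: "nat \<Rightarrow> nat \<Rightarrow> 'a::comm_ring_1"
  assumes K: "is_ideal K" and z: "x dvd z" "y dvd z" "(x - y) dvd z"
    and start: "H 1 0 \<in> K" "H 0 1 \<in> K"
    and euler: "\<And>i j. x * H (Suc i) j + y * H i (Suc j) - c i j * H i j \<in> K"
    and pde: "\<And>i j. (u i * H (Suc i) j + x * H (Suc (Suc i)) j) - (u j * H i (Suc j) + y * H i (Suc (Suc j))) \<in> K"
  shows "i + j > 0 \<Longrightarrow> H i j \<in> saturation z K"
proof -
  let ?S = "saturation z K"
  note S = saturation [OF K, where z = z]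
  note I = is_idealD [OF S(1)]
  have H: "\<forall>i j. i + j = Suc n \<longrightarrow> H i j \<in> ?S" for n
  proof (induction n)
    case 0
    show ?case
    proof (intro allI impI)
      fix i j :: nat assume "i + j = Suc 0"
      then have "(i = 1 \<and> j = 0) \<or> (i = 0 \<and> j = 1)" by linarith
      then show "H i j \<in> ?S" using start S(2) by auto
    qed
  next
    case (Suc n)
    have step: "H i (Suc (Suc j)) \<in> ?S \<and> H (Suc i) (Suc j) \<in> ?S \<and> H (Suc (Suc i)) j \<in> ?S"
      if "i + j = n" for i j
    proof -
      have l: "H (Suc i) j \<in> ?S" "H i (Suc j) \<in> ?S" using that by (auto intro!: Suc [rule_format])
      have p: "x * H (Suc (Suc i)) j - y * H i (Suc (Suc j)) \<in> ?S"
      proof -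
        have "x * H (Suc (Suc i)) j - y * H i (Suc (Suc j))
          = ((u i * H (Suc i) j + x * H (Suc (Suc i)) j) - (u j * H i (Suc j) + y * H i (Suc (Suc j))))
            - u i * H (Suc i) j + u j * H i (Suc j)" by (simp add: algebra_simps)
        also have "\<dots> \<in> ?S" by (rule I(2) [OF I(6) [OF subsetD [OF S(2) pde] I(3) [OF l(1)]] I(3) [OF l(2)]])
        finally show ?thesis .
      qed
      have e1: "x * H (Suc (Suc i)) j + y * H (Suc i) (Suc j) \<in> ?S"
      proof -
        have "x * H (Suc (Suc i)) j + y * H (Suc i) (Suc j) =
          (x * H (Suc (Suc i)) j + y * H (Suc i) (Suc j) - c (Suc i) j * H (Suc i) j) + c (Suc i) j * H (Suc i) j"
          by simp
        also have "\<dots> \<in> ?S" by (rule I(2) [OF subsetD [OF S(2) euler] I(3) [OF l(1)]])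
        finally show ?thesis .
      qed
      have e2: "x * H (Suc i) (Suc j) + y * H i (Suc (Suc j)) \<in> ?S"
      proof -
        have "x * H (Suc i) (Suc j) + y * H i (Suc (Suc j)) =
          (x * H (Suc i) (Suc j) + y * H i (Suc (Suc j)) - c i (Suc j) * H i (Suc j)) + c i (Suc j) * H i (Suc j)"
          by simp
        also have "\<dots> \<in> ?S" by (rule I(2) [OF subsetD [OF S(2) euler] I(3) [OF l(2)]])
        finally show ?thesis .
      qed
      \<comment> \<open>Elimination of the other two unknowns leaves the factor
        \<open>y * (x - y)\<close>; back substitution then costs only factors
        \<open>x\<close>.\<close>
      have "y * ((x - y) * H i (Suc (Suc j))) = x * (x * H (Suc (Suc i)) j + y * H (Suc i) (Suc j))
        - x * (x * H (Suc (Suc i)) j - y * H i (Suc (Suc j)))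
        - y * (x * H (Suc i) (Suc j) + y * H i (Suc (Suc j)))" by (simp add: algebra_simps)
      also have "\<dots> \<in> ?S" by (rule I(6) [OF I(6) [OF I(3) [OF e1] I(3) [OF p]] I(3) [OF e2]])
      finally have "y * ((x - y) * H i (Suc (Suc j))) \<in> ?S" .
      then have a: "H i (Suc (Suc j)) \<in> ?S" by (rule S(3) [OF z(3) S(3) [OF z(2)]])
      have "x * H (Suc i) (Suc j) = (x * H (Suc i) (Suc j) + y * H i (Suc (Suc j))) - y * H i (Suc (Suc j))" by simp
      also have "\<dots> \<in> ?S" by (rule I(6) [OF e2 I(3) [OF a]])
      finally have "x * H (Suc i) (Suc j) \<in> ?S" .
      then have b: "H (Suc i) (Suc j) \<in> ?S" by (rule S(3) [OF z(1)])
      have "x * H (Suc (Suc i)) j = (x * H (Suc (Suc i)) j + y * H (Suc i) (Suc j)) - y * H (Suc i) (Suc j)" by simp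
      also have "\<dots> \<in> ?S" by (rule I(6) [OF e1 I(3) [OF b]])
      finally have "x * H (Suc (Suc i)) j \<in> ?S" .
      then have "H (Suc (Suc i)) j \<in> ?S" by (rule S(3) [OF z(1)])
      with a b show ?thesis by blast
    qed
    show ?case
    proof (intro allI impI)
      fix i j assume ij: "i + j = Suc (Suc n)"
      consider "j \<ge> 2" | "j = 1" | "j = 0" by linarith
      then show "H i j \<in> ?S"
      proof cases
        case 1
        then obtain j' where "j = Suc (Suc j')" by (metis add_2_eq_Suc le_Suc_ex)
        moreover from this ij have "i + j' = n" by simp
        ultimately show ?thesis using step by blast
      next
        case 2
        then show ?thesis using step [of n 0] ij by simp
      next
        case 3
        then show ?thesis using step [of n 0] ij by simp
      qed
    qed
  qed
  show "H i j \<in> saturation z K" if "i + j > 0"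
    by (rule H [of "i + j - 1", rule_format]) (use that in simp)
qed

section \<open>The form at the start of the N-path\<close>

definition inv_fact :: "nat \<Rightarrow> complex" where
  "inv_fact n = 1 / fact n"

lemma inv_fact_0 [simp]: "inv_fact 0 = 1"
  by (simp add: inv_fact_def)

lemma inv_fact_Suc: "of_nat (Suc n) * inv_fact (Suc n) = inv_fact n"
  by (simp add: inv_fact_def del: of_nat_Suc)

text \<open>\<open>deriv_form d k i j\<close> is the derivative \<open>k\<close> times in \<open>t\<close>, \<open>i\<close> times in \<open>x1\<close> and \<open>j\<close> times in \<open>x2\<close>
  of \<open>F_1 (t^d)\<close>, the start of every N-path.\<close>

definition deriv_form_coeff :: "nat \<Rightarrow> nat \<Rightarrow> nat \<Rightarrow> nat \<Rightarrow> nat \<Rightarrow> nat \<Rightarrow> nat \<Rightarrow> complex" where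
  "deriv_form_coeff d k i j a b c = (if a + b + c + k + i + j = d then fact d ^ 3 * inv_fact a * inv_fact b
      * inv_fact c * inv_fact (d - b - i) * inv_fact (d - c - j) else 0)"

definition deriv_form :: "nat \<Rightarrow> nat \<Rightarrow> nat \<Rightarrow> nat \<Rightarrow> poly3" where
  "deriv_form d k i j = (\<Sum>(a, b, c) \<in> {(a, b, c). a + b + c = d - (k + i + j)}.
      const3 (deriv_form_coeff d k i j a b c) * mono3 a b c)"

text \<open>The guard in \<open>deriv_form_coeff\<close> bounds \<open>b + i\<close> and
  \<open>c + j\<close> by \<open>d\<close>, so its subtractions are not truncated. It also kills the
  constant monomial that the sum contains for \<open>k + i + j > d\<close>, where the degree of the
  sum is truncated to 0.\<close>

lemma coeff3_deriv_form: "coeff3 (deriv_form d k i j) a b c = deriv_form_coeff d k i j a b c"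
proof -
  have "coeff3 (deriv_form d k i j) a b c
    = (\<Sum>x \<in> {(a, b, c). a + b + c = d - (k + i + j)}. if x = (a, b, c) then deriv_form_coeff d k i j a b c else 0)"
    unfolding deriv_form_def coeff3_sum
    by (rule sum.cong) (auto simp: coeff3_mono3 split: if_splits)
  also have "\<dots> = deriv_form_coeff d k i j a b c"
    by (subst sum.delta) (auto simp: finite_triples deriv_form_coeff_def)
  finally show ?thesis .
qed

lemma deriv_form_homogeneous: "k + i + j + n = d \<Longrightarrow> homogeneous3 n (deriv_form d k i j)"
  by (auto simp: homogeneous3_def coeff3_deriv_form deriv_form_coeff_def split: if_splits)

lemma pd_deriv_form:
  "pderiv (deriv_form d k i j) = deriv_form d (Suc k) i j"
  "pd_x1 (deriv_form d k i j) = deriv_form d k (Suc i) j"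
  "pd_x2 (deriv_form d k i j) = deriv_form d k i (Suc j)"
proof -
  show "pderiv (deriv_form d k i j) = deriv_form d (Suc k) i j"
  proof (rule poly3_eqI)
    fix a b c
    show "coeff3 (pderiv (deriv_form d k i j)) a b c = coeff3 (deriv_form d (Suc k) i j) a b c"
      by (auto simp: coeff3_pd coeff3_deriv_form deriv_form_coeff_def inv_fact_Suc [of a, symmetric] simp del: of_nat_Suc)
  qed
  show "pd_x1 (deriv_form d k i j) = deriv_form d k (Suc i) j"
  proof (rule poly3_eqI)
    fix a b c
    have "d - Suc b - i = d - b - Suc i" by simp
    then show "coeff3 (pd_x1 (deriv_form d k i j)) a b c = coeff3 (deriv_form d k (Suc i) j) a b c"
      by (auto simp: coeff3_pd coeff3_deriv_form deriv_form_coeff_def inv_fact_Suc [of b, symmetric] simp del: of_nat_Suc)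
  qed
  show "pd_x2 (deriv_form d k i j) = deriv_form d k i (Suc j)"
  proof (rule poly3_eqI)
    fix a b c
    have "d - Suc c - j = d - c - Suc j" by simp
    then show "coeff3 (pd_x2 (deriv_form d k i j)) a b c = coeff3 (deriv_form d k i (Suc j)) a b c"
      by (auto simp: coeff3_pd coeff3_deriv_form deriv_form_coeff_def inv_fact_Suc [of c, symmetric] simp del: of_nat_Suc)
  qed
qed

text \<open>For f = (1 + x1 d/dt)^d (1 + x2 d/dt)^d t^d, differentiating in x1 costs one of the
  first factors, so (1 + x1 d/dt) f_x1 is \<open>of_nat d\<close> times f_t. The relation is its
  \<open>k\<close>-fold t-derivative; on coefficients it is the identity (d - b) + b = d.\<close>

lemma deriv_form_rel_x1:
  "deriv_form d k 1 0 + var_x1 * deriv_form d (Suc k) 1 0 = of_nat d * deriv_form d (Suc k) 0 0"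
proof (rule poly3_eqI)
  fix a b c
  show "coeff3 (deriv_form d k 1 0 + var_x1 * deriv_form d (Suc k) 1 0) a b c
      = coeff3 (of_nat d * deriv_form d (Suc k) 0 0) a b c"
  proof (cases "a + b + c + k + 1 = d")
    case True
    define m where "m = a + c + k"
    have d: "d = Suc m + b" using True by (simp add: m_def)
    have "coeff3 (deriv_form d k 1 0 + var_x1 * deriv_form d (Suc k) 1 0) a b c
      = fact d ^ 3 * inv_fact a * inv_fact c * inv_fact (d - c) *
        (inv_fact b * inv_fact m + (if b = 0 then 0 else inv_fact (b - 1) * inv_fact (Suc m)))"
      using True by (simp add: coeff3_var_mult coeff3_deriv_form deriv_form_coeff_def m_def algebra_simps)
        (simp add: d m_def algebra_simps)
    also have "inv_fact b * inv_fact m + (if b = 0 then 0 else inv_fact (b - 1) * inv_fact (Suc m))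
      = of_nat (Suc m) * inv_fact b * inv_fact (Suc m) + of_nat b * inv_fact b * inv_fact (Suc m)"
      using inv_fact_Suc [of m] inv_fact_Suc [of "b - 1"] by (cases b) (auto simp: ac_simps simp del: of_nat_Suc)
    also have "\<dots> = of_nat d * inv_fact b * inv_fact (d - b)"
      by (simp add: d algebra_simps)
    finally show ?thesis
      using True by (simp add: coeff3_deriv_form deriv_form_coeff_def ac_simps)
  qed (auto simp: coeff3_var_mult coeff3_deriv_form deriv_form_coeff_def)
qed

lemma deriv_form_rel_x2:
  "deriv_form d k 0 1 + var_x2 * deriv_form d (Suc k) 0 1 = of_nat d * deriv_form d (Suc k) 0 0"
proof (rule poly3_eqI)
  fix a b c
  show "coeff3 (deriv_form d k 0 1 + var_x2 * deriv_form d (Suc k) 0 1) a b c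
      = coeff3 (of_nat d * deriv_form d (Suc k) 0 0) a b c"
  proof (cases "a + b + c + k + 1 = d")
    case True
    define m where "m = a + b + k"
    have d: "d = Suc m + c" using True by (simp add: m_def)
    have "coeff3 (deriv_form d k 0 1 + var_x2 * deriv_form d (Suc k) 0 1) a b c
      = fact d ^ 3 * inv_fact a * inv_fact b * inv_fact (d - b) *
        (inv_fact c * inv_fact m + (if c = 0 then 0 else inv_fact (c - 1) * inv_fact (Suc m)))"
      using True by (simp add: coeff3_var_mult coeff3_deriv_form deriv_form_coeff_def m_def algebra_simps)
        (simp add: d m_def algebra_simps)
    also have "inv_fact c * inv_fact m + (if c = 0 then 0 else inv_fact (c - 1) * inv_fact (Suc m))
      = of_nat (Suc m) * inv_fact c * inv_fact (Suc m) + of_nat c * inv_fact c * inv_fact (Suc m)"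
      using inv_fact_Suc [of m] inv_fact_Suc [of "c - 1"] by (cases c) (auto simp: ac_simps simp del: of_nat_Suc)
    also have "\<dots> = of_nat d * inv_fact c * inv_fact (d - c)"
      by (simp add: d algebra_simps)
    finally show ?thesis
      using True by (simp add: coeff3_deriv_form deriv_form_coeff_def ac_simps)
  qed (auto simp: coeff3_var_mult coeff3_deriv_form deriv_form_coeff_def)
qed

lemma euler3:
  assumes "homogeneous3 n p"
  shows "var_t * pderiv p + var_x1 * pd_x1 p + var_x2 * pd_x2 p = of_nat n * p"
proof (rule poly3_eqI)
  fix i j k
  have "coeff3 (var_t * pderiv p + var_x1 * pd_x1 p + var_x2 * pd_x2 p) i j k
      = of_nat (i + j + k) * coeff3 p i j k"
    by (cases i; cases j; cases k) (simp_all add: coeff3_var_mult coeff3_pd algebra_simps)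
  also have "\<dots> = of_nat n * coeff3 p i j k"
    using assms by (cases "coeff3 p i j k = 0") (auto simp: homogeneous3_def simp del: of_nat_add)
  finally show "coeff3 (var_t * pderiv p + var_x1 * pd_x1 p + var_x2 * pd_x2 p) i j k = coeff3 (of_nat n * p) i j k"
    by (simp only: coeff3_of_nat_mult)
qed

lemma deriv_form_eq_0: "d < k + i + j \<Longrightarrow> deriv_form d k i j = 0"
  by (rule poly3_eqI) (simp add: coeff3_deriv_form deriv_form_coeff_def)

lemma deriv_form_euler:
  "var_t * deriv_form d (Suc k) i j + var_x1 * deriv_form d k (Suc i) j + var_x2 * deriv_form d k i (Suc j)
    = of_nat (d - (k + i + j)) * deriv_form d k i j"
proof (cases "k + i + j \<le> d")
  case True
  show ?thesis
    using euler3 [OF deriv_form_homogeneous [of k i j "d - (k + i + j)" d]] True by (simp add: pd_deriv_form)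
qed (simp add: deriv_form_eq_0)

lemma deriv_form_const:
  assumes "k + i + j = d"
  shows "deriv_form d k i j = const3 (fact d ^ 3 * inv_fact (d - i) * inv_fact (d - j))"
proof (rule poly3_eqI)
  fix a b c
  have "coeff3 (const3 z) a b c = (if a = 0 \<and> b = 0 \<and> c = 0 then z else 0)" for z
    using coeff3_const3_mult [of z 1 a b c] by (auto simp: coeff3_1)
  then show "coeff3 (deriv_form d k i j) a b c
      = coeff3 (const3 (fact d ^ 3 * inv_fact (d - i) * inv_fact (d - j))) a b c"
    using assms by (auto simp: coeff3_deriv_form deriv_form_coeff_def inv_fact_def)
qed

lemma var_t_dvd:
  assumes "\<And>j k. coeff3 p 0 j k = 0"
  shows "var_t dvd p"
proof -
  have "coeff p 0 = 0" by (intro poly_eqI) (use assms in \<open>simp add: coeff3_def\<close>)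
  moreover obtain a r where "p = pCons a r" by (cases p)
  ultimately have "p = var_t * r" by (simp add: var_t_def)
  then show ?thesis by simp
qed

text \<open>At t = 0 the coefficient of x1^b x2^c is proportional to 1 / (b! c!)^2, and d/dx (x
  d/dx) maps x^b / b!^2 to x^(b-1) / (b-1)!^2. Hence this operator has the same effect in x1 as in
  x2. Applying \<open>i\<close> further x1-derivatives and \<open>j\<close> further x2-derivatives
  yields the factors \<open>Suc i\<close> and \<open>Suc j\<close>.\<close>

lemma deriv_form_pde:
  "var_t dvd (of_nat (Suc i) * deriv_form d 0 (Suc i) j + var_x1 * deriv_form d 0 (Suc (Suc i)) j)
     - (of_nat (Suc j) * deriv_form d 0 i (Suc j) + var_x2 * deriv_form d 0 i (Suc (Suc j)))"
proof (rule var_t_dvd)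
  fix b c
  show "coeff3 ((of_nat (Suc i) * deriv_form d 0 (Suc i) j + var_x1 * deriv_form d 0 (Suc (Suc i)) j)
     - (of_nat (Suc j) * deriv_form d 0 i (Suc j) + var_x2 * deriv_form d 0 i (Suc (Suc j)))) 0 b c = 0"
  proof (cases "b + c + i + j + 1 = d")
    case True
    then have d: "d - b - Suc i = c + j" "d - c - j = Suc (b + i)" "d - c - Suc j = b + i" "d - b - i = Suc (c + j)"
      by simp_all
    have b: "of_nat (Suc i) * inv_fact b + (if b = 0 then 0 else inv_fact (b - 1)) = of_nat (Suc (b + i)) * inv_fact b" for b i
      using inv_fact_Suc [of "b - 1"] by (cases b) (auto simp: algebra_simps)
    have "coeff3 (of_nat (Suc i) * deriv_form d 0 (Suc i) j + var_x1 * deriv_form d 0 (Suc (Suc i)) j) 0 b c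
      = fact d ^ 3 * inv_fact c * inv_fact (c + j) * inv_fact (Suc (b + i)) *
        (of_nat (Suc i) * inv_fact b + (if b = 0 then 0 else inv_fact (b - 1)))"
      using True d by (auto simp: coeff3_var_mult coeff3_deriv_form deriv_form_coeff_def algebra_simps simp del: of_nat_Suc fact_Suc)
    also have "\<dots> = fact d ^ 3 * inv_fact c * inv_fact (c + j) * (of_nat (Suc (b + i)) * inv_fact (Suc (b + i))) * inv_fact b"
      unfolding b by (simp only: ac_simps)
    also have "\<dots> = fact d ^ 3 * inv_fact b * inv_fact (b + i) * (of_nat (Suc (c + j)) * inv_fact (Suc (c + j))) * inv_fact c"
      unfolding inv_fact_Suc by (simp only: ac_simps)
    also have "\<dots> = fact d ^ 3 * inv_fact b * inv_fact (b + i) * inv_fact (Suc (c + j)) *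
        (of_nat (Suc j) * inv_fact c + (if c = 0 then 0 else inv_fact (c - 1)))"
      unfolding b by (simp only: ac_simps)
    also have "\<dots> = coeff3 (of_nat (Suc j) * deriv_form d 0 i (Suc j) + var_x2 * deriv_form d 0 i (Suc (Suc j))) 0 b c"
      using True d by (auto simp: coeff3_var_mult coeff3_deriv_form deriv_form_coeff_def algebra_simps simp del: of_nat_Suc fact_Suc)
    finally show ?thesis unfolding coeff3_linear by (simp only: right_minus_eq)
  qed (auto simp: coeff3_var_mult coeff3_deriv_form deriv_form_coeff_def simp del: of_nat_Suc)
qed

section \<open>Radicals of ideals that contain the partial derivatives of the start form\<close>

lemma is_ideal_const3D:
  assumes "is_ideal K" "const3 c * p \<in> K" "c \<noteq> 0"
  shows "p \<in> K"
proof -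
  have "const3 (1 / c) * (const3 c * p) \<in> K" using is_idealD(3) assms by blast
  then show ?thesis using assms(3) by (simp add: mult.assoc [symmetric] const3_hom(6) [symmetric] del: const3_hom(6))
qed

lemma mono3_mem:
  assumes "is_ideal K"
  shows "var_t \<in> K \<Longrightarrow> i > 0 \<Longrightarrow> mono3 i j k \<in> K"
    "var_x1 \<in> K \<Longrightarrow> j > 0 \<Longrightarrow> mono3 i j k \<in> K"
    "var_x2 \<in> K \<Longrightarrow> k > 0 \<Longrightarrow> mono3 i j k \<in> K"
  by (rule is_ideal_dvd [OF assms], assumption, auto simp: mono3_def intro!: dvd_mult dvd_mult2 dvd_power)+

text \<open>Modulo \<open>K\<close> every term of \<open>p\<close> collapses to a multiple of
  \<open>u ^ d\<close>, so \<open>p\<close> becomes its value at a point times \<open>u ^ d\<close>.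
  If that value is nonzero, \<open>u\<close> is nilpotent modulo \<open>K\<close>.\<close>

lemma homogeneous3_cong_power:
  assumes K: "is_ideal K" and p: "homogeneous3 d p" "p \<in> K"
    and u: "\<And>i j k. i + j + k = d \<Longrightarrow> const3 (coeff3 p i j k) * mono3 i j k - const3 (c i j k) * u ^ d \<in> K"
    and c: "(\<Sum>(i, j, k) \<in> {(i, j, k). i + j + k = d}. c i j k) \<noteq> 0"
  shows "u \<in> ideal_radical K"
proof -
  let ?T = "{(i, j, k). i + j + k = d}"
  have const3_sum: "const3 (sum g A) = (\<Sum>a\<in>A. const3 (g a))" for g and A :: "(nat \<times> nat \<times> nat) set"
    by (induction A rule: infinite_finite_induct) simp_all
  have "p - const3 (\<Sum>(i, j, k) \<in> ?T. c i j k) * u ^ d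
      = (\<Sum>(i, j, k) \<in> ?T. const3 (coeff3 p i j k) * mono3 i j k - const3 (c i j k) * u ^ d)"
    by (subst homogeneous3_expand [OF p(1)])
      (simp add: const3_sum sum_distrib_right sum_subtractf case_prod_beta del: const3_hom)
  also have "\<dots> \<in> K"
    by (rule is_ideal_sum [OF K]) (use u in auto)
  finally have "const3 (\<Sum>(i, j, k) \<in> ?T. c i j k) * u ^ d \<in> K"
    using is_ideal_eqI [OF K p(2)] by blast
  then have "u ^ d \<in> K" using is_ideal_const3D [OF K] c by blast
  then show ?thesis by (rule ideal_radical_powerD)
qed

lemma homogeneous3_pure_power:
  assumes K: "is_ideal K" and p: "homogeneous3 d p" "p \<in> K"
  shows "var_x1 \<in> K \<Longrightarrow> var_x2 \<in> K \<Longrightarrow> coeff3 p d 0 0 \<noteq> 0 \<Longrightarrow> var_t \<in> ideal_radical K"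
    and "var_t \<in> K \<Longrightarrow> var_x2 \<in> K \<Longrightarrow> coeff3 p 0 d 0 \<noteq> 0 \<Longrightarrow> var_x1 \<in> ideal_radical K"
    and "var_t \<in> K \<Longrightarrow> var_x1 \<in> K \<Longrightarrow> coeff3 p 0 0 d \<noteq> 0 \<Longrightarrow> var_x2 \<in> ideal_radical K"
proof -
  have main: "u \<in> ideal_radical K"
    if abc: "a + b + c = d" "mono3 a b c = u ^ d" "coeff3 p a b c \<noteq> 0"
      and m: "\<And>i j k. i + j + k = d \<Longrightarrow> (i, j, k) \<noteq> (a, b, c) \<Longrightarrow> mono3 i j k \<in> K" for a b c u
  proof (rule homogeneous3_cong_power [OF K p, where c = "\<lambda>i j k. if (i, j, k) = (a, b, c) then coeff3 p a b c else 0"])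
    fix i j k :: nat assume ijk: "i + j + k = d"
    show "const3 (coeff3 p i j k) * mono3 i j k
        - const3 (if (i, j, k) = (a, b, c) then coeff3 p a b c else 0) * u ^ d \<in> K"
    proof (cases "(i, j, k) = (a, b, c)")
      case True
      then show ?thesis using abc is_idealD(1) [OF K] by simp
    next
      case False
      show ?thesis
        unfolding if_not_P [OF False] using is_idealD(3) [OF K m [OF ijk False]] by simp
    qed
  next
    have "(\<Sum>(i, j, k) \<in> {(i, j, k). i + j + k = d}. if (i, j, k) = (a, b, c) then coeff3 p a b c else 0)
       = (\<Sum>x \<in> {(i, j, k). i + j + k = d}. if x = (a, b, c) then coeff3 p a b c else 0)"
      by (rule sum.cong) (auto split: if_splits)
    also have "\<dots> = coeff3 p a b c"
      by (subst sum.delta) (use abc in \<open>auto simp: finite_triples\<close>)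
    finally show "(\<Sum>(i, j, k) \<in> {(i, j, k). i + j + k = d}. if (i, j, k) = (a, b, c) then coeff3 p a b c else 0) \<noteq> 0"
      using abc by simp
  qed
  show "var_t \<in> ideal_radical K" if "var_x1 \<in> K" "var_x2 \<in> K" "coeff3 p d 0 0 \<noteq> 0"
    by (rule main [of d 0 0]) (use that mono3_mem(2,3) [OF K] in \<open>auto simp: mono3_def\<close>)
  show "var_x1 \<in> ideal_radical K" if "var_t \<in> K" "var_x2 \<in> K" "coeff3 p 0 d 0 \<noteq> 0"
    by (rule main [of 0 d 0]) (use that mono3_mem(1,3) [OF K] in \<open>auto simp: mono3_def\<close>)
  show "var_x2 \<in> ideal_radical K" if "var_t \<in> K" "var_x1 \<in> K" "coeff3 p 0 0 d \<noteq> 0"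
    by (rule main [of 0 0 d]) (use that mono3_mem(1,2) [OF K] in \<open>auto simp: mono3_def\<close>)
qed

text \<open>The point is (0 : 1 : 1), where the value of \<open>p\<close> is the sum of its
  coefficients free of \<open>t\<close>.\<close>

lemma homogeneous3_diagonal_power:
  assumes K: "is_ideal K" and p: "homogeneous3 d p" "p \<in> K"
    and v: "var_t \<in> K" "var_x1 - var_x2 \<in> K"
    and c: "(\<Sum>(i, j, k) \<in> {(i, j, k). i + j + k = d}. if i = 0 then coeff3 p i j k else 0) \<noteq> 0"
  shows "var_x1 \<in> ideal_radical K"
proof (rule homogeneous3_cong_power [OF K p _ c])
  fix i j k :: nat assume ijk: "i + j + k = d"
  show "const3 (coeff3 p i j k) * mono3 i j k - const3 (if i = 0 then coeff3 p i j k else 0) * var_x1 ^ d \<in> K"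
  proof (cases "i = 0")
    case True
    have "(var_x1 - var_x2) dvd var_x1 ^ k - var_x2 ^ k"
      by (subst power_diff_sumr2) simp
    then have "var_x1 ^ k - var_x2 ^ k \<in> K" by (rule is_ideal_dvd [OF K v(2)])
    then have "- const3 (coeff3 p i j k) * var_x1 ^ j * (var_x1 ^ k - var_x2 ^ k) \<in> K"
      by (rule is_idealD(3) [OF K])
    then show ?thesis
      using True by (simp add: mono3_def ijk [symmetric] algebra_simps power_add)
  next
    case False
    then show ?thesis using is_idealD(3) [OF K mono3_mem(1) [OF K v(1)]] by simp
  qed
qed

lemma inv_fact_nonzero [simp]: "inv_fact n \<noteq> 0"
  by (simp add: inv_fact_def)

lemma start_form_coeff:
  "coeff3 (deriv_form d 0 0 0) d 0 0 \<noteq> 0"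
  "coeff3 (deriv_form d 0 0 0) 0 d 0 \<noteq> 0"
  "coeff3 (deriv_form d 0 0 0) 0 0 d \<noteq> 0"
  "(\<Sum>(i, j, k) \<in> {(i, j, k). i + j + k = d}. if i = 0 then coeff3 (deriv_form d 0 0 0) i j k else 0) \<noteq> 0"
proof -
  show *: "coeff3 (deriv_form d 0 0 0) d 0 0 \<noteq> 0"
    "coeff3 (deriv_form d 0 0 0) 0 d 0 \<noteq> 0"
    "coeff3 (deriv_form d 0 0 0) 0 0 d \<noteq> 0"
    by (simp_all add: coeff3_deriv_form deriv_form_coeff_def)
  let ?g = "\<lambda>(i, j, k). if i = 0 then coeff3 (deriv_form d 0 0 0) i j k else 0"
  \<comment> \<open>All coefficients are nonnegative reals, so nothing cancels at (0 : 1 : 1): the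
    coefficient of x1^d alone keeps the sum positive.\<close>
  have re: "coeff3 (deriv_form d 0 0 0) i j k = complex_of_real (if i + j + k = d then
      fact d ^ 3 * (1 / fact i) * (1 / fact j) * (1 / fact k) * (1 / fact (d - j)) * (1 / fact (d - k)) else 0)" for i j k
    by (simp add: coeff3_deriv_form deriv_form_coeff_def inv_fact_def)
  have pos: "Re (?g x) \<ge> 0" for x
    by (cases x) (simp add: re)
  have "Re (?g (0, d, 0)) > 0"
    by (simp only: prod.case re if_True simp_thms Re_complex_of_real) simp
  moreover have "Re (?g (0, d, 0)) \<le> (\<Sum>x \<in> {(i, j, k). i + j + k = d}. Re (?g x))"
    by (rule member_le_sum) (use pos in \<open>auto simp: finite_triples\<close>)
  ultimately have "Re (\<Sum>x \<in> {(i, j, k). i + j + k = d}. ?g x) > 0"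
    unfolding Re_sum by linarith
  then show "(\<Sum>(i, j, k) \<in> {(i, j, k). i + j + k = d}. if i = 0 then coeff3 (deriv_form d 0 0 0) i j k else 0) \<noteq> 0"
    by (metis less_irrefl zero_complex.simps(1))
qed

text \<open>Euler's relation divided by \<open>d\<close>. The hypotheses on products hold both when
  the partial derivative lies in \<open>K\<close> and when the variable does.\<close>

lemma start_form_mem:
  assumes K: "is_ideal K" and d: "d > 0"
    and "deriv_form d 1 0 0 \<in> K" "var_x1 * deriv_form d 0 1 0 \<in> K" "var_x2 * deriv_form d 0 0 1 \<in> K"
  shows "deriv_form d 0 0 0 \<in> K"
proof -
  have "var_t * deriv_form d (Suc 0) 0 0 + var_x1 * deriv_form d 0 (Suc 0) 0
      + var_x2 * deriv_form d 0 0 (Suc 0) \<in> K"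
    using assms(3-) is_idealD(3) [OF K] by (intro is_idealD(2) [OF K]) auto
  then have "of_nat d * deriv_form d 0 0 0 \<in> K"
    using deriv_form_euler [of d 0 0 0] by simp
  then show ?thesis using is_ideal_const3D [OF K, of "of_nat d"] d by simp
qed

lemma one_in_idealI:
  assumes "is_ideal S" "deriv_form d k i j \<in> S" "k + i + j = d"
  shows "1 \<in> S"
  using is_ideal_const3D [OF assms(1), of "fact d ^ 3 * inv_fact (d - i) * inv_fact (d - j)" 1] assms(2)
  by (simp add: deriv_form_const [OF assms(3)] del: const3_hom)

text \<open>On the line x2 = 0, common zeros off \<open>t * x1 = 0\<close> are excluded because the
  chain of t-derivatives ends in a nonzero constant, and the two remaining points because the form
  itself does not vanish there.\<close>

lemma start_form_rad_x2:
  assumes K: "is_ideal K" and d: "d > 0"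
    and mem: "deriv_form d 1 0 0 \<in> K" "deriv_form d 0 1 0 \<in> K" "var_x2 \<in> K"
  shows "var_t \<in> ideal_radical K" "var_x1 \<in> ideal_radical K"
proof -
  let ?z = "var_t * var_x1"
  have "deriv_form d (Suc (d - 1)) 0 0 \<in> saturation ?z K"
    by (rule saturation_chain [OF K, where F = "\<lambda>k. deriv_form d k 0 0" and Fx = "\<lambda>k. deriv_form d k 1 0"
          and Fy = "\<lambda>k. deriv_form d k 0 1" and t = var_t and x = var_x1 and y = var_x2
          and c = "of_nat d" and e = "\<lambda>k. of_nat (d - k)"])
      (use mem deriv_form_rel_x1 deriv_form_rel_x2 deriv_form_euler [of d _ 0 0] in auto)
  then have "1 \<in> saturation ?z K"
    using one_in_idealI [OF saturation(1) [OF K]] d by simp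
  then have z: "?z \<in> ideal_radical K" by (simp add: one_in_saturation)
  have f: "deriv_form d 0 0 0 \<in> K"
    using start_form_mem [OF K d] mem is_idealD(3,4) [OF K] by simp
  have h: "homogeneous3 d (deriv_form d 0 0 0)" by (rule deriv_form_homogeneous) simp
  note A = ideal_adjoin [OF K]
  have "var_x1 \<in> ideal_radical (ideal_adjoin K var_t)"
    using homogeneous3_pure_power(2) [OF A(1) h] A(2,3) f mem start_form_coeff by blast
  then show "var_x1 \<in> ideal_radical K"
    by (rule ideal_radical_adjoin [OF K]) (use z in \<open>simp add: mult.commute\<close>)
  have "var_t \<in> ideal_radical (ideal_adjoin K var_x1)"
    using homogeneous3_pure_power(1) [OF A(1) h] A(2,3) f mem start_form_coeff by blast
  then show "var_t \<in> ideal_radical K"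
    by (rule ideal_radical_adjoin [OF K]) (use z in simp)
qed

lemma start_form_rad_x1:
  assumes K: "is_ideal K" and d: "d > 0"
    and mem: "deriv_form d 1 0 0 \<in> K" "deriv_form d 0 0 1 \<in> K" "var_x1 \<in> K"
  shows "var_t \<in> ideal_radical K" "var_x2 \<in> ideal_radical K"
proof -
  let ?z = "var_t * var_x2"
  have "deriv_form d (Suc (d - 1)) 0 0 \<in> saturation ?z K"
    by (rule saturation_chain [OF K, where F = "\<lambda>k. deriv_form d k 0 0" and Fx = "\<lambda>k. deriv_form d k 0 1"
          and Fy = "\<lambda>k. deriv_form d k 1 0" and t = var_t and x = var_x2 and y = var_x1
          and c = "of_nat d" and e = "\<lambda>k. of_nat (d - k)"])
      (use mem deriv_form_rel_x1 deriv_form_rel_x2 deriv_form_euler [of d _ 0 0] in \<open>auto simp: add_ac\<close>)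
  then have "1 \<in> saturation ?z K"
    using one_in_idealI [OF saturation(1) [OF K]] d by simp
  then have z: "?z \<in> ideal_radical K" by (simp add: one_in_saturation)
  have f: "deriv_form d 0 0 0 \<in> K"
    using start_form_mem [OF K d] mem is_idealD(3,4) [OF K] by simp
  have h: "homogeneous3 d (deriv_form d 0 0 0)" by (rule deriv_form_homogeneous) simp
  note A = ideal_adjoin [OF K]
  have "var_x2 \<in> ideal_radical (ideal_adjoin K var_t)"
    using homogeneous3_pure_power(3) [OF A(1) h] A(2,3) f mem start_form_coeff by blast
  then show "var_x2 \<in> ideal_radical K"
    by (rule ideal_radical_adjoin [OF K]) (use z in \<open>simp add: mult.commute\<close>)
  have "var_t \<in> ideal_radical (ideal_adjoin K var_x2)"
    using homogeneous3_pure_power(1) [OF A(1) h] A(2,3) f mem start_form_coeff by blast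
  then show "var_t \<in> ideal_radical K"
    by (rule ideal_radical_adjoin [OF K]) (use z in simp)
qed

text \<open>On the line t = 0 the grid of derivatives reaches a nonzero constant away from three
  points. The factors x1 - x2, x2 and x1 are then removed at (0 : 1 : 1), (0 : 1 : 0) and (0 : 0 :
  1), where the form does not vanish.\<close>

lemma start_form_rad_t:
  assumes K: "is_ideal K" and d: "d > 0"
    and mem: "deriv_form d 1 0 0 \<in> K" "deriv_form d 0 1 0 \<in> K" "deriv_form d 0 0 1 \<in> K" "var_t \<in> K"
  shows "var_x1 \<in> ideal_radical K" "var_x2 \<in> ideal_radical K"
proof -
  let ?x = var_x1 and ?y = var_x2
  let ?z = "?x * ?y * (?x - ?y)"
  have "deriv_form d 0 d 0 \<in> saturation ?z K"
  proof (rule saturation_grid [OF K, where H = "deriv_form d 0" and x = ?x and y = ?y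
        and c = "\<lambda>i j. of_nat (d - (i + j))" and u = "\<lambda>i. of_nat (Suc i)"])
    fix i j
    have "?x * deriv_form d 0 (Suc i) j + ?y * deriv_form d 0 i (Suc j) - of_nat (d - (i + j)) * deriv_form d 0 i j
      = - deriv_form d (Suc 0) i j * var_t"
      using deriv_form_euler [of d 0 i j] by (simp add: algebra_simps)
    also have "\<dots> \<in> K" by (rule is_idealD(3) [OF K mem(4)])
    finally show "?x * deriv_form d 0 (Suc i) j + ?y * deriv_form d 0 i (Suc j)
        - of_nat (d - (i + j)) * deriv_form d 0 i j \<in> K" .
    show "of_nat (Suc i) * deriv_form d 0 (Suc i) j + ?x * deriv_form d 0 (Suc (Suc i)) j
      - (of_nat (Suc j) * deriv_form d 0 i (Suc j) + ?y * deriv_form d 0 i (Suc (Suc j))) \<in> K"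
      by (rule is_ideal_dvd [OF K mem(4) deriv_form_pde])
  qed (use mem d in \<open>auto intro: dvd_mult dvd_mult2\<close>)
  then have "1 \<in> saturation ?z K"
    using one_in_idealI [OF saturation(1) [OF K]] by simp
  then have z: "?z \<in> ideal_radical K" by (simp add: one_in_saturation)
  have f: "deriv_form d 0 0 0 \<in> K"
    using start_form_mem [OF K d] mem is_idealD(3,4) [OF K] by simp
  have h: "homogeneous3 d (deriv_form d 0 0 0)" by (rule deriv_form_homogeneous) simp
  note A = ideal_adjoin [OF K]
  have "?x \<in> ideal_radical (ideal_adjoin K (?x - ?y))"
    using homogeneous3_diagonal_power [OF A(1) h] A(2,3) f mem start_form_coeff by blast
  then have "?x * ?y \<in> ideal_radical (ideal_adjoin K (?x - ?y))"
    using ideal_radical_dvd [OF A(1)] by (meson dvd_triv_left)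
  then have xy: "?x * ?y \<in> ideal_radical K"
    by (rule ideal_radical_adjoin [OF K]) (rule z)
  have "?x \<in> ideal_radical (ideal_adjoin K ?y)"
    using homogeneous3_pure_power(2) [OF A(1) h] A(2,3) f mem start_form_coeff by blast
  then show "?x \<in> ideal_radical K"
    by (rule ideal_radical_adjoin [OF K]) (rule xy)
  have "?y \<in> ideal_radical (ideal_adjoin K ?x)"
    using homogeneous3_pure_power(3) [OF A(1) h] A(2,3) f mem start_form_coeff by blast
  then show "?y \<in> ideal_radical K"
    by (rule ideal_radical_adjoin [OF K]) (use xy in \<open>simp add: mult.commute\<close>)
qed

text \<open>Off the coordinate triangle the t-chain reaches a constant. Its three sides are the
  three lines already treated, and \<open>ideal_radical_adjoin\<close> glues the pieces.\<close>

lemma start_form_rad: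
  assumes K: "is_ideal K" and d: "d > 0"
    and mem: "deriv_form d 1 0 0 \<in> K" "deriv_form d 0 1 0 \<in> K" "deriv_form d 0 0 1 \<in> K"
  shows "var_t \<in> ideal_radical K" "var_x1 \<in> ideal_radical K" "var_x2 \<in> ideal_radical K"
proof -
  let ?t = var_t and ?x = var_x1 and ?y = var_x2
  let ?z = "?t * ?x * ?y"
  note A = ideal_adjoin [OF K]
  have memA: "deriv_form d 1 0 0 \<in> ideal_adjoin K v" "deriv_form d 0 1 0 \<in> ideal_adjoin K v"
    "deriv_form d 0 0 1 \<in> ideal_adjoin K v" for v
    using mem A(2) by auto
  have "deriv_form d (Suc (d - 1)) 0 0 \<in> saturation ?z K"
    by (rule saturation_chain [OF K, where F = "\<lambda>k. deriv_form d k 0 0" and Fx = "\<lambda>k. deriv_form d k 1 0"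
          and Fy = "\<lambda>k. deriv_form d k 0 1" and t = var_t and x = var_x1 and y = var_x2
          and c = "of_nat d" and e = "\<lambda>k. of_nat (d - k)"])
      (use mem deriv_form_rel_x1 deriv_form_rel_x2 deriv_form_euler [of d _ 0 0] in auto)
  then have "1 \<in> saturation ?z K"
    using one_in_idealI [OF saturation(1) [OF K]] d by simp
  then have z: "?z \<in> ideal_radical K" by (simp add: one_in_saturation)
  have tx: "?t * ?x \<in> ideal_radical K"
  proof (rule ideal_radical_adjoin [OF K _ z])
    show "?t * ?x \<in> ideal_radical (ideal_adjoin K ?y)"
      using start_form_rad_x2(1) [OF A(1) d memA(1,2) A(3)] by (rule ideal_radical_dvd [OF A(1)]) simp
  qed
  have ty: "?t * ?y \<in> ideal_radical K"
  proof (rule ideal_radical_adjoin [OF K])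
    show "?t * ?y \<in> ideal_radical (ideal_adjoin K ?x)"
      using start_form_rad_x1(1) [OF A(1) d memA(1,3) A(3)] by (rule ideal_radical_dvd [OF A(1)]) simp
    show "?t * ?y * ?x \<in> ideal_radical K" using z by (simp add: mult_ac)
  qed
  show "?t \<in> ideal_radical K"
    using ideal_radical_adjoin [OF K start_form_rad_x2(1) [OF A(1) d memA(1,2) A(3)]] ty .
  show "?x \<in> ideal_radical K"
    using ideal_radical_adjoin [OF K start_form_rad_t(1) [OF A(1) d memA A(3)]] tx by (simp add: mult.commute)
  show "?y \<in> ideal_radical K"
    using ideal_radical_adjoin [OF K start_form_rad_t(2) [OF A(1) d memA A(3)]] ty by (simp add: mult.commute)
qed

section \<open>Ideals that contain all monomials of one degree\<close>

definition fills :: "nat \<Rightarrow> poly3 set \<Rightarrow> bool" where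
  "fills N K \<longleftrightarrow> (\<forall>i j k. i + j + k = N \<longrightarrow> mono3 i j k \<in> K)"

text \<open>An exponent sum of at least \<open>a + b + c\<close> forces one exponent up to its
  bound. Every large \<open>N\<close> is provided so that several ideals can share one.\<close>

lemma fillsI:
  assumes K: "is_ideal K"
    and rad: "var_t \<in> ideal_radical K" "var_x1 \<in> ideal_radical K" "var_x2 \<in> ideal_radical K"
  obtains N0 where "\<And>N. N \<ge> N0 \<Longrightarrow> fills N K"
proof -
  obtain a b c where abc: "var_t ^ a \<in> K" "var_x1 ^ b \<in> K" "var_x2 ^ c \<in> K"
    using rad by (auto simp: ideal_radical_def)
  have "fills N K" if N: "N \<ge> a + b + c" for N
    unfolding fills_def
  proof (intro allI impI)
    fix i j k assume "i + j + k = N"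
    then consider "i \<ge> a" | "j \<ge> b" | "k \<ge> c" using N by linarith
    then show "mono3 i j k \<in> K"
    proof cases
      case 1
      then have "var_t ^ a dvd mono3 i j k" by (auto simp: mono3_def intro!: dvd_mult2 le_imp_power_dvd)
      then show ?thesis by (rule is_ideal_dvd [OF K abc(1)])
    next
      case 2
      then have "var_x1 ^ b dvd mono3 i j k" by (auto simp: mono3_def intro!: dvd_mult2 [OF dvd_mult] le_imp_power_dvd)
      then show ?thesis by (rule is_ideal_dvd [OF K abc(2)])
    next
      case 3
      then have "var_x2 ^ c dvd mono3 i j k" by (auto simp: mono3_def intro!: dvd_mult le_imp_power_dvd)
      then show ?thesis by (rule is_ideal_dvd [OF K abc(3)])
    qed
  qed
  then show ?thesis using that by blast
qed

section \<open>Forms along the N-path\<close>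

definition ideal_gen :: "nat \<Rightarrow> (nat \<Rightarrow> 'a::comm_ring_1) \<Rightarrow> 'a set" where
  "ideal_gen n g = {\<Sum>l<n. a l * g l | a. True}"

lemma is_ideal_gen: "is_ideal (ideal_gen n g)"
  unfolding is_ideal_def
proof (intro conjI ballI allI)
  show "0 \<in> ideal_gen n g"
    unfolding ideal_gen_def by (rule CollectI, rule exI [of _ "\<lambda>_. 0"]) simp
next
  fix a b assume "a \<in> ideal_gen n g" "b \<in> ideal_gen n g"
  then obtain u v where "a = (\<Sum>l<n. u l * g l)" "b = (\<Sum>l<n. v l * g l)"
    by (auto simp: ideal_gen_def)
  then have "a + b = (\<Sum>l<n. (u l + v l) * g l)"
    by (simp add: sum.distrib algebra_simps)
  then show "a + b \<in> ideal_gen n g" by (auto simp: ideal_gen_def)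
next
  fix a r assume "a \<in> ideal_gen n g"
  then obtain u where "a = (\<Sum>l<n. u l * g l)"
    by (auto simp: ideal_gen_def)
  then have "r * a = (\<Sum>l<n. (r * u l) * g l)"
    by (simp add: sum_distrib_left mult.assoc)
  then show "r * a \<in> ideal_gen n g" by (auto simp: ideal_gen_def)
qed

lemma ideal_gen_mem: "l < n \<Longrightarrow> g l \<in> ideal_gen n g"
proof -
  assume l: "l < n"
  have "g l = (\<Sum>m<n. (if m = l then g m else 0))" using l by (subst sum.delta) auto
  also have "\<dots> = (\<Sum>m<n. (if m = l then 1 else 0) * g m)" by (rule sum.cong) auto
  finally show ?thesis by (auto simp: ideal_gen_def)
qed

definition poly_fun :: "(complex \<Rightarrow> complex) \<Rightarrow> bool" where
  "poly_fun f \<longleftrightarrow> (\<exists>P. \<forall>s. f s = poly P s)"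

lemma poly_fun_intros:
  "poly_fun (\<lambda>s. c)" "poly_fun (\<lambda>s. s)"
  "poly_fun f \<Longrightarrow> poly_fun g \<Longrightarrow> poly_fun (\<lambda>s. f s + g s)"
  "poly_fun f \<Longrightarrow> poly_fun g \<Longrightarrow> poly_fun (\<lambda>s. f s - g s)"
  "poly_fun f \<Longrightarrow> poly_fun g \<Longrightarrow> poly_fun (\<lambda>s. f s * g s)"
  "poly_fun f \<Longrightarrow> poly_fun (\<lambda>s. f s ^ n)"
  unfolding poly_fun_def
       apply (metis poly_pCons mult_zero_right add.right_neutral poly_0)
      apply (rule exI [of _ "[:0, 1:]"], simp)
     apply (metis poly_add)
    apply (metis poly_diff)
   apply (metis poly_mult)
  apply (metis poly_power)
  done

lemma poly_fun_if: "poly_fun f \<Longrightarrow> poly_fun g \<Longrightarrow> poly_fun (\<lambda>s. if b then f s else g s)"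
  by (cases b) simp_all

lemma poly_fun_sum: "(\<And>a. a \<in> A \<Longrightarrow> poly_fun (f a)) \<Longrightarrow> poly_fun (\<lambda>s. \<Sum>a\<in>A. f a s)"
  by (induction A rule: infinite_finite_induct) (auto intro: poly_fun_intros)

definition poly_family :: "(complex \<Rightarrow> poly3) \<Rightarrow> bool" where
  "poly_family g \<longleftrightarrow> (\<forall>i j k. poly_fun (\<lambda>s. coeff3 (g s) i j k))"

text \<open>The coefficients of the combinations that represent the monomials at \<open>s = 0\<close> form a matrix which depends
  polynomially on \<open>s\<close> and is the identity at \<open>0\<close>; where its determinant is nonzero the monomials can be recovered.\<close>

lemma fills_open:
  fixes g :: "nat \<Rightarrow> complex \<Rightarrow> poly3"
  assumes hom: "\<And>l s. l < n \<Longrightarrow> homogeneous3 (e l) (g l s)" and e: "\<And>l. l < n \<Longrightarrow> e l \<le> N"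
    and dep: "\<And>l. l < n \<Longrightarrow> poly_family (g l)"
    and start: "fills N (ideal_gen n (\<lambda>l. g l 0))"
  shows "finite {s. \<not> fills N (ideal_gen n (\<lambda>l. g l s))}"
proof -
  define T where "T = {(i, j, k). i + j + k = N}"
  define mo where "mo = (\<lambda>(i, j, k). mono3 i j k)"
  define co where "co = (\<lambda>p (i, j, k). coeff3 p i j k)"
  have "\<forall>m\<in>T. \<exists>a. mo m = (\<Sum>l<n. a l * g l 0)"
    using start by (auto simp: fills_def T_def mo_def ideal_gen_def)
  then obtain a where a: "\<And>m. m \<in> T \<Longrightarrow> mo m = (\<Sum>l<n. a m l * g l 0)" by metis
  \<comment> \<open>The cofactors found at s = 0 are frozen and cut to degree
    \<open>N - e l\<close>. So \<open>h m s\<close> is a form of degree \<open>N\<close> in the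
    ideal for every \<open>s\<close>, polynomial in \<open>s\<close>, and equal to the monomial
    \<open>mo m\<close> at s = 0.\<close>
  define h where "h = (\<lambda>m s. \<Sum>l<n. hcomp (N - e l) (a m l) * g l s)"
  have hcomp_sum: "hcomp k (sum f A) = (\<Sum>a\<in>A. hcomp k (f a))" for k f and A :: "nat set"
    by (induction A rule: infinite_finite_induct) simp_all
  have h0: "h m 0 = mo m" if m: "m \<in> T" for m
  proof -
    have "homogeneous3 N (mo m)"
      using m homogeneous3_mono3 by (auto simp: T_def mo_def)
    then have "mo m = hcomp N (\<Sum>l<n. g l 0 * a m l)"
      using a [OF m] by (simp add: homogeneous3_iff_hcomp mult.commute)
    also have "\<dots> = (\<Sum>l<n. g l 0 * hcomp (N - e l) (a m l))"
      unfolding hcomp_sum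
    proof (rule sum.cong [OF refl])
      fix l assume "l \<in> {..<n}"
      then show "hcomp N (g l 0 * a m l) = g l 0 * hcomp (N - e l) (a m l)"
        using hcomp_mult [OF hom [of l 0], of "N - e l" "a m l"] e [of l] by simp
    qed
    finally show ?thesis by (simp add: h_def mult.commute)
  qed
  have h_hom: "homogeneous3 N (h m s)" for m s
    unfolding h_def
  proof (rule homogeneous3_sum)
    fix l assume "l \<in> {..<n}"
    then show "homogeneous3 N (hcomp (N - e l) (a m l) * g l s)"
      using homogeneous3_mult [OF homogeneous3_hcomp hom [of l s], of "N - e l" "a m l"] e [of l] by simp
  qed
  have h_mem: "h m s \<in> ideal_gen n (\<lambda>l. g l s)" for m s
    by (auto simp: h_def ideal_gen_def)
  have "\<exists>P. \<forall>s. co (h m s) m' = poly P s" for m m'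
  proof -
    obtain i j k where m': "m' = (i, j, k)" by (cases m') auto
    have "poly_fun (\<lambda>s. co (h m s) m')"
      unfolding m' co_def prod.case h_def coeff3_sum coeff3_mult
      using dep by (intro poly_fun_sum poly_fun_intros) (auto simp: poly_family_def)
    then show ?thesis by (simp add: poly_fun_def)
  qed
  then obtain P where P: "\<And>m m' s. co (h m s) m' = poly (P m m') s" by metis
  obtain ms where ms: "set ms = T" "distinct ms"
    using finite_distinct_list [of T] finite_triples [of N] by (auto simp: T_def)
  define r where "r = length ms"
  have ms_T: "ms ! u \<in> T" if "u < r" for u using that ms by (auto simp: r_def)
  define CP where "CP = Matrix.mat r r (\<lambda>(u, v). P (ms ! u) (ms ! v))"
  define C where "C = (\<lambda>s. Matrix.mat r r (\<lambda>(u, v). co (h (ms ! u) s) (ms ! v)))"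
  have C: "C s \<in> carrier_mat r r" for s by (simp add: C_def)
  have det_C: "det (C s) = poly (det CP) s" for s
  proof -
    interpret comm_ring_hom "\<lambda>p. poly p s" by unfold_locales auto
    have "C s = map_mat (\<lambda>p. poly p s) CP"
      by (rule eq_matI) (simp_all add: C_def CP_def P)
    then show ?thesis by simp
  qed
  have "C 0 = 1\<^sub>m r"
  proof (rule eq_matI)
    fix u v assume "u < dim_row (1\<^sub>m r :: complex mat)" "v < dim_col (1\<^sub>m r :: complex mat)"
    then have uv: "u < r" "v < r" by auto
    have "co (mo (ms ! u)) (ms ! v) = (if ms ! v = ms ! u then 1 else 0)"
      by (cases "ms ! u"; cases "ms ! v") (auto simp: co_def mo_def coeff3_mono3)
    then show "C 0 $$ (u, v) = 1\<^sub>m r $$ (u, v)"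
      using uv h0 [OF ms_T [OF uv(1)]] nth_eq_iff_index_eq [OF ms(2)] by (auto simp: C_def r_def)
  qed (simp_all add: C_def)
  then have "poly (det CP) 0 = 1" using det_C [of 0] by simp
  then have "det CP \<noteq> 0" by auto
  then have "finite {s. poly (det CP) s = 0}" by (rule poly_roots_finite)
  moreover have "fills N (ideal_gen n (\<lambda>l. g l s))" if s: "poly (det CP) s \<noteq> 0" for s
    unfolding fills_def
  proof (intro allI impI)
    let ?K = "ideal_gen n (\<lambda>l. g l s)"
    fix i j k assume "i + j + k = N"
    then have "(i, j, k) \<in> set ms" by (simp add: ms T_def)
    then obtain w where w: "w < r" "ms ! w = (i, j, k)" by (auto simp: in_set_conv_nth r_def)
    \<comment> \<open>Row \<open>w\<close> of the adjugate combines the forms \<open>h\<close> to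
      the wanted monomial times \<open>det (C s)\<close>, a nonzero constant.\<close>
    let ?B = "adj_mat (C s)"
    have B: "?B \<in> carrier_mat r r" "?B * C s = det (C s) \<cdot>\<^sub>m 1\<^sub>m r"
      using adj_mat [OF C] by auto
    have BC: "(\<Sum>u<r. ?B $$ (w, u) * co (h (ms ! u) s) (ms ! v)) = (if w = v then det (C s) else 0)"
      if v: "v < r" for v
    proof -
      have "(?B * C s) $$ (w, v) = (\<Sum>u<r. ?B $$ (w, u) * C s $$ (u, v))"
        using B(1) C [of s] w v by (auto simp: scalar_prod_def intro!: sum.cong)
      also have "\<dots> = (\<Sum>u<r. ?B $$ (w, u) * co (h (ms ! u) s) (ms ! v))"
        by (rule sum.cong) (use v in \<open>auto simp: C_def\<close>)
      finally show ?thesis using w v by (cases "w = v") (simp_all add: B(2))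
    qed
    have h_exp: "h m s = (\<Sum>v<r. const3 (co (h m s) (ms ! v)) * mo (ms ! v))" for m
    proof -
      have "h m s = (\<Sum>x\<in>T. const3 (co (h m s) x) * mo x)"
        by (subst homogeneous3_expand [OF h_hom]) (auto simp: T_def co_def mo_def intro!: sum.cong)
      also have "\<dots> = (\<Sum>v<r. const3 (co (h m s) (ms ! v)) * mo (ms ! v))"
        by (rule sum.reindex_bij_betw [symmetric]) (rule bij_betw_nth, use ms in \<open>auto simp: r_def\<close>)
      finally show ?thesis .
    qed
    have const3_sum: "const3 (sum f A) = (\<Sum>a\<in>A. const3 (f a))" for f and A :: "nat set"
      by (induction A rule: infinite_finite_induct) simp_all
    have "(\<Sum>u<r. const3 (?B $$ (w, u)) * h (ms ! u) s)
      = (\<Sum>u<r. \<Sum>v<r. const3 (?B $$ (w, u)) * (const3 (co (h (ms ! u) s) (ms ! v)) * mo (ms ! v)))"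
      by (subst h_exp) (simp add: sum_distrib_left)
    also have "\<dots> = (\<Sum>v<r. \<Sum>u<r. const3 (?B $$ (w, u)) * (const3 (co (h (ms ! u) s) (ms ! v)) * mo (ms ! v)))"
      by (rule sum.swap)
    also have "\<dots> = (\<Sum>v<r. const3 (\<Sum>u<r. ?B $$ (w, u) * co (h (ms ! u) s) (ms ! v)) * mo (ms ! v))"
      by (simp add: const3_sum sum_distrib_right mult.assoc)
    also have "\<dots> = (\<Sum>v<r. if v = w then const3 (det (C s)) * mo (ms ! v) else 0)"
      by (rule sum.cong) (auto simp: BC)
    also have "\<dots> = const3 (det (C s)) * mono3 i j k"
      using w by (subst sum.delta) (auto simp: mo_def)
    finally have "const3 (det (C s)) * mono3 i j k = (\<Sum>u<r. const3 (?B $$ (w, u)) * h (ms ! u) s)" ..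
    also have "\<dots> \<in> ?K"
      by (intro is_ideal_sum [OF is_ideal_gen] is_idealD(3) [OF is_ideal_gen] h_mem)
    finally show "mono3 i j k \<in> ?K"
      using is_ideal_const3D [OF is_ideal_gen] s by (simp add: det_C)
  qed
  ultimately show ?thesis
    using finite_subset [of "{s. \<not> fills N (ideal_gen n (\<lambda>l. g l s))}" "{s. poly (det CP) s = 0}"] by blast
qed

section \<open>The operators of the N-path on coefficients\<close>

lemma coeff3_T_op:
  "coeff3 (T_op var_x1 s p) i j k = coeff3 p i j k
     + s * (if j = 0 then 0 else of_nat (Suc i) * coeff3 p (Suc i) (j - 1) k)"
  "coeff3 (T_op var_x2 s p) i j k = coeff3 p i j k
     + s * (if k = 0 then 0 else of_nat (Suc i) * coeff3 p (Suc i) j (k - 1))"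
  by (simp_all add: T_op_def mult.assoc coeff3_var_mult coeff3_pd del: of_nat_Suc)

lemma coeff3_G_op: "coeff3 (G_op s p) i j k = s ^ (j + k) * coeff3 p i j k"
proof -
  have "[:s:] ^ j = [:s ^ j:]" for j by (induction j) (simp_all add: one_pCons)
  then show ?thesis
    by (simp add: coeff3_def G_op_def coeff_map_poly coeff_pcompose_linear power_add ac_simps)
qed

lemma homogeneous3_coeff_0: "homogeneous3 d p \<Longrightarrow> i + j + k \<noteq> d \<Longrightarrow> coeff3 p i j k = 0"
  by (auto simp: homogeneous3_def)

lemma T_op_homogeneous:
  assumes "homogeneous3 d p"
  shows "homogeneous3 d (T_op var_x1 s p)" "homogeneous3 d (T_op var_x2 s p)"
proof -
  have "coeff3 (T_op var_x1 s p) i j k = 0" "coeff3 (T_op var_x2 s p) i j k = 0" if "i + j + k \<noteq> d" for i j k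
    using that homogeneous3_coeff_0 [OF assms, of i j k] homogeneous3_coeff_0 [OF assms, of "Suc i" "j - 1" k]
      homogeneous3_coeff_0 [OF assms, of "Suc i" j "k - 1"]
    by (auto simp: coeff3_T_op)
  then show "homogeneous3 d (T_op var_x1 s p)" "homogeneous3 d (T_op var_x2 s p)"
    unfolding homogeneous3_def by blast+
qed

lemma G_op_homogeneous: "homogeneous3 d p \<Longrightarrow> homogeneous3 d (G_op s p)"
  by (auto simp: homogeneous3_def coeff3_G_op)

lemma T_op_pow_homogeneous:
  assumes "homogeneous3 d p"
  shows "homogeneous3 d ((T_op var_x1 s ^^ m) p)" "homogeneous3 d ((T_op var_x2 s ^^ m) p)"
  by (induction m) (simp_all add: assms T_op_homogeneous)

lemma N_op_homogeneous: "homogeneous3 d p \<Longrightarrow> homogeneous3 d (N_op e s p)"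
  by (simp add: N_op_def F_op_def T_op_pow_homogeneous G_op_homogeneous)

lemma T_op_family:
  assumes "poly_family g" "poly_fun c"
  shows "poly_family (\<lambda>s. T_op var_x1 (c s) (g s))" "poly_family (\<lambda>s. T_op var_x2 (c s) (g s))"
  unfolding poly_family_def coeff3_T_op
  using assms by (auto simp: poly_family_def intro!: poly_fun_intros poly_fun_if)

lemma N_op_family: "poly_family (\<lambda>s. N_op d s p)"
proof -
  have c: "poly_fun (\<lambda>s. 1 - s)" by (intro poly_fun_intros)
  have "poly_family (\<lambda>s. G_op s p)"
    unfolding poly_family_def coeff3_G_op by (intro allI poly_fun_intros)
  then have "poly_family (\<lambda>s. (T_op var_x2 (1 - s) ^^ m) (G_op s p))" for m
    by (induction m) (simp_all add: T_op_family c)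
  then have "poly_family (\<lambda>s. (T_op var_x1 (1 - s) ^^ n) ((T_op var_x2 (1 - s) ^^ m) (G_op s p)))" for m n
    by (induction n) (simp_all add: T_op_family c)
  then show ?thesis by (simp add: N_op_def F_op_def)
qed

lemma pd_family:
  assumes "poly_family g"
  shows "poly_family (\<lambda>s. pderiv (g s))" "poly_family (\<lambda>s. pd_x1 (g s))" "poly_family (\<lambda>s. pd_x2 (g s))"
  using assms by (auto simp: poly_family_def coeff3_pd intro!: poly_fun_intros)

text \<open>\<open>G_op 0\<close> leaves only t^d, whose coefficient is 1. The \<open>d\<close>-th
  powers of 1 + x1 d/dt and 1 + x2 d/dt then give t^a x1^b x2^c the coefficient (d! / a!) (d choose
  b) (d choose c).\<close>

lemma N_op_0:
  assumes "p \<in> forms d"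
  shows "N_op d 0 p = deriv_form d 0 0 0"
proof -
  have p: "homogeneous3 d p" "coeff3 p d 0 0 = 1" using assms by (auto simp: forms_iff)
  have G: "coeff3 (G_op 0 p) a b c = (if a = d \<and> b = 0 \<and> c = 0 then 1 else 0)" for a b c
    using p homogeneous3_coeff_0 [OF p(1), of a 0 0]
    by (cases "b = 0 \<and> c = 0") (auto simp: coeff3_G_op)
  have step1: "of_nat (Suc a) * (fact d * inv_fact (Suc a) * u) = fact d * inv_fact a * u" for a u
  proof -
    have "of_nat (Suc a) * (fact d * inv_fact (Suc a) * u) = fact d * (of_nat (Suc a) * inv_fact (Suc a)) * u"
      by (simp only: mult_ac)
    then show ?thesis by (simp only: inv_fact_Suc)
  qed
  have step: "of_nat (Suc a) * (fact d * inv_fact (Suc a) * u * v) = fact d * inv_fact a * u * v" for a u v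
    using step1 [of a "u * v"] by (simp only: mult.assoc)
  \<comment> \<open>The number \<open>n\<close> of applications is kept free of \<open>d\<close>, so
    that Pascal's rule is the induction step.\<close>
  have y: "coeff3 ((T_op var_x2 1 ^^ n) (G_op 0 p)) a b c =
     (if b = 0 \<and> a + c = d then fact d * inv_fact a * of_nat (n choose c) else 0)" for n a b c
  proof (induction n arbitrary: a b c)
    case 0
    then show ?case by (auto simp: G inv_fact_def)
  next
    case (Suc n)
    show ?case
    proof (cases c)
      case 0
      then show ?thesis by (auto simp: coeff3_T_op Suc.IH)
    next
      case (Suc c')
      then show ?thesis
        by (auto simp: coeff3_T_op Suc.IH step step1 ring_distribs simp del: of_nat_Suc)
    qed
  qed
  have x: "coeff3 ((T_op var_x1 1 ^^ m) ((T_op var_x2 1 ^^ n) (G_op 0 p))) a b c =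
     (if a + b + c = d then fact d * inv_fact a * of_nat (m choose b) * of_nat (n choose c) else 0)" for m n a b c
  proof (induction m arbitrary: a b c)
    case 0
    then show ?case by (auto simp: y)
  next
    case (Suc m)
    show ?case
    proof (cases b)
      case 0
      then show ?thesis by (auto simp: coeff3_T_op Suc.IH)
    next
      case (Suc b')
      then show ?thesis
        by (auto simp: coeff3_T_op Suc.IH step step1 ring_distribs simp del: of_nat_Suc)
    qed
  qed
  show ?thesis
  proof (rule poly3_eqI)
    fix a b c
    have ch: "of_nat (d choose b) = fact d * inv_fact b * inv_fact (d - b)" if "b \<le> d" for b
      using that by (simp add: binomial_fact inv_fact_def)
    have N: "coeff3 (N_op d 0 p) a b c = (if a + b + c = d
        then fact d * inv_fact a * of_nat (d choose b) * of_nat (d choose c) else 0)"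
      by (simp only: N_op_def F_op_def comp_apply diff_zero x)
    show "coeff3 (N_op d 0 p) a b c = coeff3 (deriv_form d 0 0 0) a b c"
    proof (cases "a + b + c = d")
      case True
      then have "b \<le> d" "c \<le> d" by simp_all
      then show ?thesis
        using True by (simp add: N ch coeff3_deriv_form deriv_form_coeff_def power3_eq_cube mult_ac)
    qed (simp add: N coeff3_deriv_form deriv_form_coeff_def)
  qed
qed

text \<open>\<open>fills N\<close> of the ideals generated by these families expresses, without mentioning points, that the curve
  \<open>q = 0\<close> is smooth and that it meets the line \<open>x2 = 0\<close> transversally.\<close>

definition smoothness_gens :: "poly3 \<Rightarrow> nat \<Rightarrow> poly3" where
  "smoothness_gens q l = (if l = 0 then pderiv q else if l = 1 then pd_x1 q else pd_x2 q)"

definition section_gens :: "poly3 \<Rightarrow> nat \<Rightarrow> poly3" where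
  "section_gens q l = (if l = 0 then pderiv q else if l = 1 then pd_x1 q else var_x2)"

lemma N_path_fills_cofinite:
  assumes d: "d \<ge> 1" and p: "p \<in> forms d"
  obtains N F where "N \<ge> d" "finite F" "0 \<notin> F"
    "\<And>s. s \<notin> F \<Longrightarrow> fills N (ideal_gen 3 (smoothness_gens (N_op d s p)))"
    "\<And>s. s \<notin> F \<Longrightarrow> fills N (ideal_gen 3 (section_gens (N_op d s p)))"
proof -
  let ?q = "\<lambda>s. N_op d s p"
  obtain d' where d': "d = Suc d'" using d by (cases d) auto
  have hom: "homogeneous3 d p" using p by (simp add: forms_iff)
  have q0: "?q 0 = deriv_form d 0 0 0" by (rule N_op_0 [OF p])
  have m1: "deriv_form d 1 0 0 \<in> ideal_gen 3 (smoothness_gens (?q 0))"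
    "deriv_form d 0 1 0 \<in> ideal_gen 3 (smoothness_gens (?q 0))"
    "deriv_form d 0 0 1 \<in> ideal_gen 3 (smoothness_gens (?q 0))"
    using ideal_gen_mem [of 0 3 "smoothness_gens (?q 0)"] ideal_gen_mem [of 1 3 "smoothness_gens (?q 0)"]
      ideal_gen_mem [of 2 3 "smoothness_gens (?q 0)"]
    by (simp_all add: smoothness_gens_def q0 pd_deriv_form)
  have m2: "deriv_form d 1 0 0 \<in> ideal_gen 3 (section_gens (?q 0))"
    "deriv_form d 0 1 0 \<in> ideal_gen 3 (section_gens (?q 0))"
    "var_x2 \<in> ideal_gen 3 (section_gens (?q 0))"
    using ideal_gen_mem [of 0 3 "section_gens (?q 0)"] ideal_gen_mem [of 1 3 "section_gens (?q 0)"]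
      ideal_gen_mem [of 2 3 "section_gens (?q 0)"]
    by (simp_all add: section_gens_def q0 pd_deriv_form)
  obtain N1 where N1: "\<And>N. N \<ge> N1 \<Longrightarrow> fills N (ideal_gen 3 (smoothness_gens (?q 0)))"
    using fillsI [OF is_ideal_gen start_form_rad [OF is_ideal_gen _ m1]] d by auto
  have "var_x2 \<in> ideal_radical (ideal_gen 3 (section_gens (?q 0)))"
    using m2(3) ideal_radical_powerD [of var_x2 1] by simp
  then obtain N2 where N2: "\<And>N. N \<ge> N2 \<Longrightarrow> fills N (ideal_gen 3 (section_gens (?q 0)))"
    using fillsI [OF is_ideal_gen start_form_rad_x2 [OF is_ideal_gen _ m2]] d by auto
  \<comment> \<open>One degree for both ideals, and at least \<open>d\<close>, as the later degree
    counts for matrices require.\<close>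
  define N where "N = N1 + N2 + d"
  define F where "F = {s. \<not> fills N (ideal_gen 3 (smoothness_gens (?q s)))}
    \<union> {s. \<not> fills N (ideal_gen 3 (section_gens (?q s)))}"
  have qhom: "homogeneous3 (Suc d') (?q s)" for s
    using N_op_homogeneous [OF hom] d' by simp
  have "finite {s. \<not> fills N (ideal_gen 3 (\<lambda>l. smoothness_gens (?q s) l))}"
  proof (rule fills_open [where e = "\<lambda>l. d'"])
    show "homogeneous3 d' (smoothness_gens (?q s) l)" for l s
      using homogeneous3_pd [OF qhom] by (simp add: smoothness_gens_def)
    show "poly_family (\<lambda>s. smoothness_gens (?q s) l)" for l
      using pd_family [OF N_op_family]
      by (cases "l = 0"; cases "l = 1") (simp_all add: smoothness_gens_def)
  qed (use N1 [of N] in \<open>simp_all add: N_def d'\<close>)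
  moreover have "finite {s. \<not> fills N (ideal_gen 3 (\<lambda>l. section_gens (?q s) l))}"
  proof (rule fills_open [where e = "\<lambda>l. if l < 2 then d' else 1"])
    show "homogeneous3 (if l < 2 then d' else 1) (section_gens (?q s) l)" for l s
      using homogeneous3_pd [OF qhom] by (simp add: section_gens_def)
    have "poly_family (\<lambda>s. var_x2)" by (simp add: poly_family_def poly_fun_intros)
    then show "poly_family (\<lambda>s. section_gens (?q s) l)" for l
      using pd_family [OF N_op_family]
      by (cases "l = 0"; cases "l = 1") (simp_all add: section_gens_def)
  qed (use N2 [of N] in \<open>simp_all add: N_def d'\<close>)
  ultimately have "finite F" by (simp add: F_def)
  moreover have "0 \<notin> F" using N1 [of N] N2 [of N] by (simp add: F_def N_def)
  ultimately show ?thesis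
    by (intro that [of N F]) (auto simp: N_def F_def)
qed

section \<open>Minors and derivatives of determinants\<close>

definition derivation :: "('a::comm_ring_1 \<Rightarrow> 'a) \<Rightarrow> bool" where
  "derivation \<delta> \<longleftrightarrow> (\<forall>a b. \<delta> (a + b) = \<delta> a + \<delta> b) \<and> (\<forall>a b. \<delta> (a * b) = a * \<delta> b + \<delta> a * b)"

lemma derivation_simps:
  assumes "derivation \<delta>"
  shows "\<delta> (a + b) = \<delta> a + \<delta> b" "\<delta> (a * b) = a * \<delta> b + \<delta> a * b" "\<delta> 0 = 0" "\<delta> 1 = 0" "\<delta> (- a) = - \<delta> a"
proof -
  show add: "\<delta> (a + b) = \<delta> a + \<delta> b" and mult: "\<delta> (a * b) = a * \<delta> b + \<delta> a * b" for a b
    using assms by (auto simp: derivation_def)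
  show 0: "\<delta> 0 = 0" using add [of 0 0] by simp
  show "\<delta> 1 = 0" using mult [of 1 1] by simp
  show "\<delta> (- a) = - \<delta> a" using add [of a "- a"] 0 by (simp add: eq_neg_iff_add_eq_0 add.commute)
qed

lemma derivation_sum: "derivation \<delta> \<Longrightarrow> \<delta> (sum f A) = (\<Sum>a\<in>A. \<delta> (f a))"
  by (induction A rule: infinite_finite_induct) (simp_all add: derivation_simps)

lemma derivation_prod:
  assumes "derivation \<delta>"
  shows "finite A \<Longrightarrow> \<delta> (prod f A) = (\<Sum>a\<in>A. \<delta> (f a) * prod f (A - {a}))"
proof (induction A rule: finite_induct)
  case (insert x A)
  have "(\<Sum>a\<in>A. \<delta> (f a) * prod f (insert x A - {a})) = (\<Sum>a\<in>A. f x * (\<delta> (f a) * prod f (A - {a})))"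
  proof (rule sum.cong [OF refl])
    fix a assume a: "a \<in> A"
    then have "insert x A - {a} = insert x (A - {a})" using insert.hyps by auto
    then show "\<delta> (f a) * prod f (insert x A - {a}) = f x * (\<delta> (f a) * prod f (A - {a}))"
      using insert.hyps by (simp add: mult_ac)
  qed
  then show ?case
    using insert by (simp add: derivation_simps [OF assms] sum_distrib_left)
qed (simp add: derivation_simps [OF assms])

text \<open>Jacobi's formula. An abstract derivation covers the three partial derivatives as well as
  the derivative along a line of pencils.\<close>

lemma derivation_det:
  assumes \<delta>: "derivation \<delta>" and A: "A \<in> carrier_mat n n"
  shows "\<delta> (det A) = (\<Sum>i<n. \<Sum>j<n. \<delta> (A $$ (i, j)) * adj_mat A $$ (j, i))"
proof -
  \<comment> \<open>Only row \<open>k\<close> is differentiated in \<open>B k\<close>, so Laplace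
    expansion along it meets the cofactors of \<open>A\<close> itself.\<close>
  define B where "B = (\<lambda>k. Matrix.mat n n (\<lambda>(i, j). if i = k then \<delta> (A $$ (i, j)) else A $$ (i, j)))"
  let ?P = "{p. p permutes {0..<n}}"
  have B: "B k \<in> carrier_mat n n" for k by (simp add: B_def)
  have \<delta>sign: "\<delta> (signof p * x) = signof p * \<delta> x" for p :: "nat \<Rightarrow> nat" and x
    by (cases p rule: sign_cases) (simp_all add: derivation_simps [OF \<delta>])
  have "\<delta> (det A) = (\<Sum>p\<in>?P. signof p * (\<Sum>k<n. \<delta> (A $$ (k, p k)) * (\<Prod>i\<in>{0..<n} - {k}. A $$ (i, p i))))"
    unfolding det_def' [OF A] derivation_sum [OF \<delta>] \<delta>sign derivation_prod [OF \<delta> finite_atLeastLessThan]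
    by (simp add: atLeast0LessThan)
  also have "\<dots> = (\<Sum>p\<in>?P. \<Sum>k<n. signof p * (\<Prod>i = 0..<n. B k $$ (i, p i)))"
    unfolding sum_distrib_left
  proof (intro sum.cong refl)
    fix p k assume p: "p \<in> ?P" and k: "k \<in> {..<n}"
    have pn: "p i < n" if "i < n" for i using p that by auto
    have "(\<Prod>i = 0..<n. B k $$ (i, p i)) = B k $$ (k, p k) * (\<Prod>i\<in>{0..<n} - {k}. B k $$ (i, p i))"
      using k by (intro prod.remove) auto
    also have "(\<Prod>i\<in>{0..<n} - {k}. B k $$ (i, p i)) = (\<Prod>i\<in>{0..<n} - {k}. A $$ (i, p i))"
      by (rule prod.cong) (auto simp: B_def pn)
    finally show "signof p * (\<delta> (A $$ (k, p k)) * (\<Prod>i\<in>{0..<n} - {k}. A $$ (i, p i)))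
      = signof p * (\<Prod>i = 0..<n. B k $$ (i, p i))"
      using k pn by (simp add: B_def)
  qed
  also have "\<dots> = (\<Sum>k<n. det (B k))"
    unfolding det_def' [OF B] by (rule sum.swap)
  also have "\<dots> = (\<Sum>k<n. \<Sum>j<n. \<delta> (A $$ (k, j)) * adj_mat A $$ (j, k))"
  proof (rule sum.cong [OF refl])
    fix k assume k: "k \<in> {..<n}"
    have "det (B k) = (\<Sum>j<n. B k $$ (k, j) * cofactor (B k) k j)"
      by (rule laplace_expansion_row [OF B]) (use k in simp)
    also have "\<dots> = (\<Sum>j<n. \<delta> (A $$ (k, j)) * adj_mat A $$ (j, k))"
    proof (rule sum.cong [OF refl])
      fix j assume j: "j \<in> {..<n}"
      have "mat_delete (B k) k j = mat_delete A k j"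
        using A by (intro eq_matI) (auto simp: mat_delete_def B_def)
      then show "B k $$ (k, j) * cofactor (B k) k j = \<delta> (A $$ (k, j)) * adj_mat A $$ (j, k)"
        using A k j by (simp add: adj_mat_def cofactor_def B_def)
    qed
    finally show "det (B k) = (\<Sum>j<n. \<delta> (A $$ (k, j)) * adj_mat A $$ (j, k))" .
  qed
  finally show ?thesis .
qed

section \<open>Column replacement and two-by-two minors of the adjugate\<close>

definition set_col :: "'a mat \<Rightarrow> nat \<Rightarrow> (nat \<Rightarrow> 'a) \<Rightarrow> 'a mat" where
  "set_col A c v = Matrix.mat (dim_row A) (dim_col A) (\<lambda>(i, j). if j = c then v i else A $$ (i, j))"

definition delta :: "nat \<Rightarrow> nat \<Rightarrow> 'a::comm_ring_1" where
  "delta r i = (if i = r then 1 else 0)"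

lemma set_col_carrier [simp]: "A \<in> carrier_mat n m \<Longrightarrow> set_col A c v \<in> carrier_mat n m"
  by (simp add: set_col_def)

lemma set_col_simps [simp]:
  "dim_row (set_col A c v) = dim_row A" "dim_col (set_col A c v) = dim_col A"
  "i < dim_row A \<Longrightarrow> j < dim_col A \<Longrightarrow> set_col A c v $$ (i, j) = (if j = c then v i else A $$ (i, j))"
  by (auto simp: set_col_def)

lemma det_set_col:
  assumes A: "A \<in> carrier_mat n n" and c: "c < n"
  shows "det (set_col A c v) = (\<Sum>r<n. v r * det (set_col A c (delta r)))"
proof -
  have cof: "cofactor (set_col A c u) r c = cofactor A r c" for u r
  proof -
    have "mat_delete (set_col A c u) r c = mat_delete A r c"
      using A by (intro eq_matI) (auto simp: mat_delete_def set_col_def)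
    then show ?thesis by (simp add: cofactor_def)
  qed
  have lap: "det (set_col A c u) = (\<Sum>r<n. u r * cofactor A r c)" for u
    using A c by (subst laplace_expansion_column [OF set_col_carrier [OF A] c]) (simp add: cof)
  have "det (set_col A c (delta r)) = cofactor A r c" if "r < n" for r
  proof -
    have "det (set_col A c (delta r)) = (\<Sum>s<n. if s = r then cofactor A s c else 0)"
      unfolding lap by (rule sum.cong) (auto simp: delta_def)
    then show ?thesis using that by simp
  qed
  then show ?thesis unfolding lap [of v] by simp
qed

lemma det_equal_cols:
  fixes A :: "'a::comm_ring_1 mat"
  assumes A: "A \<in> carrier_mat n n" and ij: "i < n" "j < n" "i \<noteq> j"
    and eq: "\<And>r. r < n \<Longrightarrow> A $$ (r, i) = A $$ (r, j)"
  shows "det A = 0"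
  by (rule det_identical_columns [OF A ij(3,1,2)]) (use A ij eq in \<open>auto intro!: eq_vecI\<close>)

text \<open>The determinant is bilinear in the two columns. A unit vector at a place other than
  \<open>i\<close> and \<open>j\<close> repeats a column of the identity, and equal unit vectors
  repeat each other, so only \<open>E i j\<close> and \<open>E j i\<close> survive.\<close>

lemma det_set_two_cols:
  fixes v w :: "nat \<Rightarrow> 'a::comm_ring_1"
  assumes ij: "i < n" "j < n" "i \<noteq> j"
  shows "det (set_col (set_col (1\<^sub>m n) i v) j w) = v i * w j - v j * w i"
proof -
  let ?I = "1\<^sub>m n :: 'a mat"
  have I: "?I \<in> carrier_mat n n" by simp
  have comm: "set_col (set_col ?I i v) j w = set_col (set_col ?I j w) i v" for v w
    using ij by (intro eq_matI) (auto simp: set_col_def)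
  define E where "E = (\<lambda>r s. det (set_col (set_col ?I i (delta r)) j (delta s)))"
  have expand: "det (set_col (set_col ?I i v) j w) = (\<Sum>s<n. \<Sum>r<n. w s * v r * E r s)" for v w
  proof -
    have "det (set_col (set_col ?I i v) j w) = (\<Sum>s<n. w s * det (set_col (set_col ?I i v) j (delta s)))"
      by (rule det_set_col) (use ij in simp_all)
    also have "\<dots> = (\<Sum>s<n. w s * det (set_col (set_col ?I j (delta s)) i v))"
      by (simp add: comm)
    also have "\<dots> = (\<Sum>s<n. w s * (\<Sum>r<n. v r * det (set_col (set_col ?I j (delta s)) i (delta r))))"
      by (subst det_set_col [where c = i]) (use ij in simp_all)
    also have "\<dots> = (\<Sum>s<n. \<Sum>r<n. w s * v r * E r s)"
      by (simp add: E_def comm sum_distrib_left mult.assoc)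
    finally show ?thesis .
  qed
  have E0: "E r s = 0" if rs: "r < n" "s < n" and ne: "(r, s) \<noteq> (i, j)" "(r, s) \<noteq> (j, i)" for r s
  proof -
    let ?A = "set_col (set_col ?I i (delta r)) j (delta s)"
    have A: "?A \<in> carrier_mat n n" by simp
    consider "r = s" | "r \<noteq> i" "r \<noteq> j" | "s \<noteq> i" "s \<noteq> j"
      using ne by auto
    then show ?thesis
    proof cases
      case 1
      show ?thesis unfolding E_def
        by (rule det_equal_cols [OF A ij]) (use 1 ij in auto)
    next
      case 2
      show ?thesis unfolding E_def
        by (rule det_equal_cols [OF A ij(1) rs(1)]) (use 2 ij rs in \<open>auto simp: delta_def\<close>)
    next
      case 3
      show ?thesis unfolding E_def
        by (rule det_equal_cols [OF A ij(2) rs(2)]) (use 3 ij rs in \<open>auto simp: delta_def\<close>)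
    qed
  qed
  have E1: "E r s = 0" if "r < n" "s < n" "s \<noteq> i" "s \<noteq> j" for r s
    using E0 that by auto
  have E2: "E r s = 0" if "r < n" "s < n" "r \<noteq> i" "r \<noteq> j" for r s
    using E0 that by auto
  have main: "det (set_col (set_col ?I i v) j w) = v i * w j * E i j + v j * w i * E j i" for v w
  proof -
    have "(\<Sum>s<n. \<Sum>r<n. w s * v r * E r s) = (\<Sum>s\<in>{i, j}. \<Sum>r<n. w s * v r * E r s)"
      using ij by (intro sum.mono_neutral_right) (auto simp: E1)
    also have "\<dots> = (\<Sum>s\<in>{i, j}. \<Sum>r\<in>{i, j}. w s * v r * E r s)"
    proof (rule sum.cong [OF refl])
      fix s assume s: "s \<in> {i, j}"
      show "(\<Sum>r<n. w s * v r * E r s) = (\<Sum>r\<in>{i, j}. w s * v r * E r s)"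
        using ij s by (intro sum.mono_neutral_right ballI) (auto simp: E2)
    qed
    also have "\<dots> = v i * w j * E i j + v j * w i * E j i"
      using ij E0 [of i i] E0 [of j j] by (simp add: algebra_simps)
    finally show ?thesis by (simp add: expand)
  qed
  have "set_col (set_col ?I i (delta i)) j (delta j) = ?I"
    using ij by (intro eq_matI) (auto simp: set_col_def delta_def)
  then have Eij: "E i j = 1" by (simp add: E_def)
  \<comment> \<open>Equal columns of ones give \<open>E i j + E j i = 0\<close>, which fixes the
    second constant.\<close>
  have "det (set_col (set_col ?I i (\<lambda>_. 1)) j (\<lambda>_. 1)) = 0"
    by (rule det_equal_cols [OF _ ij]) (use ij in auto)
  then have "E j i = - 1" using main [of "\<lambda>_. 1" "\<lambda>_. 1"] Eij
    by (simp add: eq_neg_iff_add_eq_0 add.commute)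
  then show ?thesis by (simp add: main Eij)
qed

text \<open>Replacing two columns of the identity by columns of \<open>adj M\<close> gives a matrix \<open>Y\<close> whose determinant is a minor
  of \<open>adj M\<close>, while two columns of \<open>M * Y\<close> are divisible by \<open>det M\<close>.\<close>

lemma adj_minor_dvd:
  fixes M :: "'a::idom mat"
  assumes M: "M \<in> carrier_mat n n" and q: "det M \<noteq> 0"
    and ij: "i < n" "j < n" and kl: "k < n" "l < n"
  defines "A \<equiv> adj_mat M"
  shows "det M dvd A $$ (i, k) * A $$ (j, l) - A $$ (i, l) * A $$ (j, k)"
proof (cases "i = j")
  case False
  let ?q = "det M"
  have A: "A \<in> carrier_mat n n" and MA: "M * A = ?q \<cdot>\<^sub>m 1\<^sub>m n"
    unfolding A_def using adj_mat [OF M] by auto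
  let ?Y = "set_col (set_col (1\<^sub>m n) i (\<lambda>r. A $$ (r, k))) j (\<lambda>r. A $$ (r, l))"
  let ?Z = "set_col (set_col M i (delta k)) j (delta l)"
  let ?D = "Matrix.mat n n (\<lambda>(r, c). if r = c then (if c = i \<or> c = j then ?q else 1) else 0)"
  have Y: "?Y \<in> carrier_mat n n" and Z: "?Z \<in> carrier_mat n n" and D: "?D \<in> carrier_mat n n"
    using M by simp_all
  have Md [simp]: "dim_row M = n" "dim_col M = n" using M by auto
  have "M * ?Y = ?Z * ?D"
  proof (rule eq_matI)
    fix r c assume "r < dim_row (?Z * ?D)" "c < dim_col (?Z * ?D)"
    then have rc: "r < n" "c < n" using Z D by auto
    have MAe: "(\<Sum>m<n. M $$ (r, m) * A $$ (m, e)) = ?q * delta e r" if "e < n" for e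
    proof -
      have "(M * A) $$ (r, e) = (\<Sum>m<n. M $$ (r, m) * A $$ (m, e))"
        using M A rc that by (auto simp: scalar_prod_def atLeast0LessThan intro!: sum.cong)
      then show ?thesis using rc that by (simp add: MA delta_def)
    qed
    have "(M * ?Y) $$ (r, c) = (\<Sum>m<n. M $$ (r, m) * ?Y $$ (m, c))"
      using rc by (simp add: scalar_prod_def atLeast0LessThan)
    also have "\<dots> = (if c = j then ?q * delta l r else if c = i then ?q * delta k r else M $$ (r, c))"
    proof -
      have "(\<Sum>m<n. M $$ (r, m) * (if m = c then 1 else 0)) = (\<Sum>m<n. if m = c then M $$ (r, m) else 0)"
        by (rule sum.cong) auto
      also have "\<dots> = M $$ (r, c)" using rc by simp
      finally show ?thesis
        using rc MAe [OF kl(1)] MAe [OF kl(2)] False by simp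
    qed
    also have "\<dots> = (\<Sum>m<n. ?Z $$ (r, m) * ?D $$ (m, c))"
    proof -
      have "(\<Sum>m<n. ?Z $$ (r, m) * ?D $$ (m, c)) = (\<Sum>m<n. if m = c then ?Z $$ (r, c) * (if c = i \<or> c = j then ?q else 1) else 0)"
        by (rule sum.cong) (use rc in auto)
      also have "\<dots> = ?Z $$ (r, c) * (if c = i \<or> c = j then ?q else 1)" using rc by simp
      finally show ?thesis using rc False by (simp add: mult.commute)
    qed
    also have "\<dots> = (?Z * ?D) $$ (r, c)"
      using rc by (simp add: scalar_prod_def atLeast0LessThan)
    finally show "(M * ?Y) $$ (r, c) = (?Z * ?D) $$ (r, c)" .
  qed simp_all
  \<comment> \<open>\<open>det ?D\<close> contributes \<open>det M\<close> squared against one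
    factor on the left; cancelling leaves the minor as a multiple of \<open>det M\<close>.\<close>
  then have "?q * det ?Y = det ?Z * det ?D"
    using det_mult [OF M Y] det_mult [OF Z D] by simp
  moreover have "det ?D = ?q * ?q"
  proof -
    have "upper_triangular ?D" by auto
    then have "det ?D = prod_list (diag_mat ?D)" by (rule det_upper_triangular [OF _ D])
    also have "\<dots> = (\<Prod>c = 0..<n. if c = i \<or> c = j then ?q else 1)"
      by (simp add: prod_list_diag_prod)
    also have "\<dots> = (\<Prod>c\<in>{i, j}. if c = i \<or> c = j then ?q else 1)"
      using ij by (intro prod.mono_neutral_right) auto
    also have "\<dots> = ?q * ?q" using False by simp
    finally show ?thesis .
  qed
  moreover have "det ?Y = A $$ (i, k) * A $$ (j, l) - A $$ (j, k) * A $$ (i, l)"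
    by (rule det_set_two_cols [OF ij False])
  ultimately have "?q * (A $$ (i, k) * A $$ (j, l) - A $$ (j, k) * A $$ (i, l)) = ?q * (?q * det ?Z)"
    by (simp add: mult_ac)
  then have "A $$ (i, k) * A $$ (j, l) - A $$ (j, k) * A $$ (i, l) = ?q * det ?Z"
    using q by (simp only: mult_cancel_left) simp
  then show ?thesis by (simp add: mult.commute)
qed simp

section \<open>Deformations of symmetric pencils\<close>

lemma smult_mat_cancel:
  fixes q :: "'a::idom"
  assumes "q \<noteq> 0" "X \<in> carrier_mat n m" "Y \<in> carrier_mat n m" "q \<cdot>\<^sub>m X = q \<cdot>\<^sub>m Y"
  shows "X = Y"
proof (rule eq_matI)
  fix i j assume "i < dim_row Y" "j < dim_col Y"
  then have "q * X $$ (i, j) = q * Y $$ (i, j)"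
    using assms(2,3) arg_cong [OF assms(4), of "\<lambda>Z. Z $$ (i, j)"] by simp
  then show "X $$ (i, j) = Y $$ (i, j)" using assms(1) by simp
qed (use assms in auto)

lemma mat_index_mult3:
  assumes "X \<in> carrier_mat d d" "Y \<in> carrier_mat d d" "Z \<in> carrier_mat d d" "i < d" "l < d"
  shows "(X * Y * Z) $$ (i, l) = (\<Sum>j<d. \<Sum>k<d. X $$ (i, j) * Y $$ (j, k) * Z $$ (k, l))"
proof -
  have "(X * Y * Z) $$ (i, l) = (\<Sum>k<d. (\<Sum>j<d. X $$ (i, j) * Y $$ (j, k)) * Z $$ (k, l))"
    using assms by (simp add: scalar_prod_def atLeast0LessThan del: assoc_mult_mat)
  also have "\<dots> = (\<Sum>k<d. \<Sum>j<d. X $$ (i, j) * Y $$ (j, k) * Z $$ (k, l))"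
    by (simp add: sum_distrib_right)
  also have "\<dots> = (\<Sum>j<d. \<Sum>k<d. X $$ (i, j) * Y $$ (j, k) * Z $$ (k, l))"
    by (rule sum.swap)
  finally show ?thesis .
qed

lemma mat_index_mult2:
  assumes "X \<in> carrier_mat d d" "Y \<in> carrier_mat d d" "i < d" "l < d"
  shows "(X * Y) $$ (i, l) = (\<Sum>j<d. X $$ (i, j) * Y $$ (j, l))"
  using assms by (simp add: scalar_prod_def atLeast0LessThan)

lemma dvd_mat:
  assumes X: "X \<in> carrier_mat n m" and dvd: "\<And>i j. i < n \<Longrightarrow> j < m \<Longrightarrow> q dvd X $$ (i, j)"
  obtains Z where "Z \<in> carrier_mat n m" "X = q \<cdot>\<^sub>m Z"
proof -
  have "\<forall>i j. \<exists>z. i < n \<longrightarrow> j < m \<longrightarrow> X $$ (i, j) = q * z" using dvd by (auto simp: dvd_def)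
  then obtain z where z: "\<And>i j. i < n \<Longrightarrow> j < m \<Longrightarrow> X $$ (i, j) = q * z i j" by metis
  show ?thesis
    by (rule that [of "Matrix.mat n m (\<lambda>(i, j). z i j)"]) (use X z in \<open>auto intro!: eq_matI\<close>)
qed

text \<open>The trace of \<open>U * A\<close>. When \<open>A\<close> is the adjugate of
  \<open>M\<close>, Jacobi's formula makes it the derivative of the determinant at \<open>M\<close>
  in direction \<open>U\<close>.\<close>

definition pairing :: "nat \<Rightarrow> 'a::comm_ring_1 mat \<Rightarrow> 'a mat \<Rightarrow> 'a" where
  "pairing d U A = (\<Sum>j<d. \<Sum>k<d. U $$ (j, k) * A $$ (k, j))"

text \<open>A matrix \<open>A\<close> of rank one satisfies \<open>A U A = tr (U A) A\<close>, and
  the adjugate has rank at most one modulo \<open>det M\<close>: entrywise the defect is a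
  combination of its two-by-two minors.\<close>

lemma adj_sandwich:
  fixes M :: "'a::idom mat"
  assumes M: "M \<in> carrier_mat d d" and q: "det M \<noteq> 0" and U: "U \<in> carrier_mat d d"
  obtains E where "E \<in> carrier_mat d d"
    "adj_mat M * U * adj_mat M - pairing d U (adj_mat M) \<cdot>\<^sub>m adj_mat M = det M \<cdot>\<^sub>m E"
proof (rule dvd_mat)
  let ?A = "adj_mat M"
  have A: "?A \<in> carrier_mat d d" using adj_mat [OF M] by simp
  show "?A * U * ?A - pairing d U ?A \<cdot>\<^sub>m ?A \<in> carrier_mat d d"
    using A by (simp add: minus_carrier_mat)
  fix i l assume il: "i < d" "l < d"
  have "(?A * U * ?A - pairing d U ?A \<cdot>\<^sub>m ?A) $$ (i, l) = (?A * U * ?A) $$ (i, l) - pairing d U ?A * ?A $$ (i, l)"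
    using A il by simp
  also have "\<dots> = (\<Sum>j<d. \<Sum>k<d. U $$ (j, k) * (?A $$ (i, j) * ?A $$ (k, l) - ?A $$ (i, l) * ?A $$ (k, j)))"
    unfolding mat_index_mult3 [OF A U A il] pairing_def
    by (simp add: sum_distrib_left sum_distrib_right sum_subtractf right_diff_distrib mult_ac)
  also have "det M dvd \<dots>"
    using il by (intro dvd_sum dvd_mult adj_minor_dvd [OF M q]) auto
  finally show "det M dvd (?A * U * ?A - pairing d U ?A \<cdot>\<^sub>m ?A) $$ (i, l)" .
qed (use that in blast)

lemma adj_symmetric:
  fixes M :: "'a::idom mat"
  assumes M: "M \<in> carrier_mat d d" "M\<^sup>T = M" and q: "det M \<noteq> 0"
  shows "(adj_mat M)\<^sup>T = adj_mat M"
proof -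
  let ?A = "adj_mat M"
  have A: "?A \<in> carrier_mat d d" "M * ?A = det M \<cdot>\<^sub>m 1\<^sub>m d" "?A * M = det M \<cdot>\<^sub>m 1\<^sub>m d"
    using adj_mat [OF M(1)] by auto
  have T: "?A\<^sup>T \<in> carrier_mat d d" using A by simp
  have "(M * ?A)\<^sup>T = ?A\<^sup>T * M" using transpose_mult [OF M(1) A(1)] M(2) by simp
  moreover have "(det M \<cdot>\<^sub>m 1\<^sub>m d)\<^sup>T = det M \<cdot>\<^sub>m 1\<^sub>m d" by (rule eq_matI) auto
  ultimately have TM: "?A\<^sup>T * M = det M \<cdot>\<^sub>m 1\<^sub>m d" using A(2) by simp
  have "det M \<cdot>\<^sub>m ?A = (?A\<^sup>T * M) * ?A"
    unfolding TM using A(1) by (simp add: mult_smult_assoc_mat [of _ d d _ d])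
  also have "\<dots> = ?A\<^sup>T * (M * ?A)" using T M A by (intro assoc_mult_mat)
  also have "\<dots> = det M \<cdot>\<^sub>m ?A\<^sup>T"
    unfolding A(2) using T by (simp add: mult_smult_distrib [of _ d d _ d])
  finally show ?thesis using smult_mat_cancel [OF q A(1) T] by simp
qed

lemma adj_cancel_right:
  fixes M :: "'a::idom mat"
  assumes M: "M \<in> carrier_mat d d" and q: "det M \<noteq> 0"
    and X: "X \<in> carrier_mat d d" "Y \<in> carrier_mat d d" and eq: "X * adj_mat M = Y * adj_mat M"
  shows "X = Y"
proof -
  let ?A = "adj_mat M"
  have A: "?A \<in> carrier_mat d d" "?A * M = det M \<cdot>\<^sub>m 1\<^sub>m d"
    using adj_mat [OF M] by auto
  have *: "(Z * ?A) * M = det M \<cdot>\<^sub>m Z" if Z: "Z \<in> carrier_mat d d" for Z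
  proof -
    have "(Z * ?A) * M = Z * (?A * M)" using Z A M by (intro assoc_mult_mat)
    then show ?thesis unfolding A(2) using Z by (simp add: mult_smult_distrib [of _ d d _ d])
  qed
  have "det M \<cdot>\<^sub>m X = det M \<cdot>\<^sub>m Y" using * [OF X(1)] * [OF X(2)] eq by simp
  then show ?thesis using smult_mat_cancel [OF q X] by simp
qed

text \<open>Here \<open>S\<close> is a first-order deformation of the symmetric pencil \<open>M\<close> that leaves \<open>det M\<close> unchanged.
  The matrix \<open>C\<close> trivialises it up to the factor \<open>pairing d U A\<close>, a partial derivative combination.\<close>

lemma deformation_trivialisation:
  fixes M :: "'a::idom mat"
  assumes M: "M \<in> carrier_mat d d" "M\<^sup>T = M" and q: "det M \<noteq> 0"
    and S: "S \<in> carrier_mat d d" "S\<^sup>T = S" and U: "U \<in> carrier_mat d d" "U\<^sup>T = U"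
    and B: "B \<in> carrier_mat d d" and ASA: "adj_mat M * S * adj_mat M = det M \<cdot>\<^sub>m B"
    and E: "E \<in> carrier_mat d d"
    and AUA: "adj_mat M * U * adj_mat M - pairing d U (adj_mat M) \<cdot>\<^sub>m adj_mat M = det M \<cdot>\<^sub>m E"
    and ij: "i < d" "j < d"
  shows "((B * U - E * S) * adj_mat M) $$ (i, j) + ((B * U - E * S) * adj_mat M) $$ (j, i)
    = 2 * pairing d U (adj_mat M) * B $$ (i, j)"
proof -
  let ?A = "adj_mat M" and ?q = "det M" and ?X = "pairing d U (adj_mat M)"
  have A: "?A \<in> carrier_mat d d" using adj_mat [OF M(1)] by simp
  note c = A S(1) U(1) B E mult_carrier_mat [of _ d d _ d] minus_carrier_mat [of _ d d]
  note assoc = assoc_mult_mat [of _ d d _ d _ d]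
  have AT: "?A\<^sup>T = ?A" by (rule adj_symmetric [OF M q])
  have "(?A * S * ?A)\<^sup>T = ?A * S * ?A"
    using c by (simp add: transpose_mult [of _ d d _ d] AT S(2) assoc)
  moreover have "(?q \<cdot>\<^sub>m B)\<^sup>T = ?q \<cdot>\<^sub>m B\<^sup>T" by (rule eq_matI) (use B in auto)
  ultimately have "?q \<cdot>\<^sub>m B\<^sup>T = ?q \<cdot>\<^sub>m B"
    unfolding ASA by simp
  then have BT: "B\<^sup>T = B" using smult_mat_cancel [OF q _ B] B by simp
  have "?q \<cdot>\<^sub>m (E * S * ?A) = (?A * U * ?A - ?X \<cdot>\<^sub>m ?A) * S * ?A"
    unfolding AUA using c by (simp add: mult_smult_assoc_mat [of _ d d _ d])
  also have "\<dots> = (?A * U) * (?A * S * ?A) - ?X \<cdot>\<^sub>m (?A * S * ?A)"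
    using c by (simp add: minus_mult_distrib_mat [of _ d d _ _ d] mult_smult_assoc_mat [of _ d d _ d] assoc)
  also have "\<dots> = ?q \<cdot>\<^sub>m (?A * U * B - ?X \<cdot>\<^sub>m B)"
  proof -
    have P: "?A * U * B \<in> carrier_mat d d" using c by simp
    have "(?A * U) * (?q \<cdot>\<^sub>m B) = ?q \<cdot>\<^sub>m (?A * U * B)"
      using c by (intro mult_smult_distrib) auto
    moreover have "?q \<cdot>\<^sub>m Y - ?X \<cdot>\<^sub>m (?q \<cdot>\<^sub>m B) = ?q \<cdot>\<^sub>m (Y - ?X \<cdot>\<^sub>m B)" if "Y \<in> carrier_mat d d" for Y
      by (rule eq_matI) (use that B in \<open>auto simp: right_diff_distrib mult.left_commute\<close>)
    ultimately show ?thesis unfolding ASA using P by simp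
  qed
  finally have eq: "?q \<cdot>\<^sub>m (E * S * ?A) = ?q \<cdot>\<^sub>m (?A * U * B - ?X \<cdot>\<^sub>m B)" .
  have ESA: "E * S * ?A = ?A * U * B - ?X \<cdot>\<^sub>m B"
    by (rule smult_mat_cancel [OF q, of _ d d, OF _ _ eq]) (intro c smult_carrier_mat)+
  \<comment> \<open>\<open>B * U * A\<close> and \<open>A * U * B\<close> are transposes of each
    other and cancel in the symmetrised sum, which leaves twice the term \<open>X B\<close>. With
    \<open>C = B U - E S\<close>, multiplication by \<open>M\<close> on both sides reads this as
    \<open>M C + C^T M = 2 X S\<close>: up to a factor, \<open>S\<close> is an infinitesimal
    congruence of \<open>M\<close>.\<close>
  have CA: "(B * U - E * S) * ?A = B * U * ?A - (?A * U * B - ?X \<cdot>\<^sub>m B)"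
    using c by (simp add: minus_mult_distrib_mat [of _ d d _ _ d] ESA)
  have sym: "(B * U * ?A)\<^sup>T = ?A * U * B"
    using c by (simp add: transpose_mult [of _ d d _ d] AT BT U(2) assoc)
  have "(?A * U * B) $$ (k, l) = (B * U * ?A) $$ (l, k)" if "k < d" "l < d" for k l
    using that c unfolding sym [symmetric] by simp
  moreover have "B $$ (j, i) = B $$ (i, j)"
    using BT B ij by (metis carrier_matD index_transpose_mat(1))
  ultimately show ?thesis unfolding CA using ij c by simp
qed

text \<open>Modulo \<open>det M\<close> the adjugate has rank one, so the rows of \<open>W * adj M\<close> are proportional to one vector;
  an antisymmetric matrix with this property vanishes.\<close>

lemma antisymmetric_multiple_of_adj:
  fixes M :: "'a::idom mat"
  assumes M: "M \<in> carrier_mat d d" and q: "det M \<noteq> 0"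
    and W: "W \<in> carrier_mat d d" and U: "U \<in> carrier_mat d d"
    and anti: "\<And>i j. i < d \<Longrightarrow> j < d \<Longrightarrow> (W * adj_mat M) $$ (i, j) + (W * adj_mat M) $$ (j, i) = 0"
  obtains Z where "Z \<in> carrier_mat d d" "(2 * pairing d U (adj_mat M)) \<cdot>\<^sub>m W = Z * M"
proof -
  let ?A = "adj_mat M" and ?q = "det M"
  let ?X = "pairing d U ?A"
  let ?V = "\<lambda>i j. (W * ?A) $$ (i, j)"
  have A: "?A \<in> carrier_mat d d" "M * ?A = ?q \<cdot>\<^sub>m 1\<^sub>m d" using adj_mat [OF M] by auto
  have minor: "?q dvd ?V i k * ?A $$ (j, l) - ?V i l * ?A $$ (j, k)"
    if "i < d" "j < d" "k < d" "l < d" for i j k l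
  proof -
    have "?V i k * ?A $$ (j, l) - ?V i l * ?A $$ (j, k)
      = (\<Sum>m<d. W $$ (i, m) * (?A $$ (m, k) * ?A $$ (j, l) - ?A $$ (m, l) * ?A $$ (j, k)))"
      using that by (simp add: mat_index_mult2 [OF W A(1)] sum_distrib_left sum_distrib_right sum_subtractf right_diff_distrib mult_ac)
    also have "?q dvd \<dots>"
      using that by (intro dvd_sum dvd_mult adj_minor_dvd [OF M q]) auto
    finally show ?thesis .
  qed
  have two: "?q dvd 2 * ?V i k * ?A $$ (j, l)" if "i < d" "j < d" "k < d" "l < d" for i j k l
  proof -
    have e: "?V k i = - ?V i k" "?V k l = - ?V l k" "?V l i = - ?V i l"
      using anti that by (simp_all add: eq_neg_iff_add_eq_0)
    \<comment> \<open>By antisymmetry the mixed terms of three minor relations cancel in pairs,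
      while \<open>V i k * A (j, l)\<close> occurs twice; hence the factor 2.\<close>
    have "2 * ?V i k * ?A $$ (j, l) = - (?V k i * ?A $$ (j, l) - ?V k l * ?A $$ (j, i))
        + (?V l k * ?A $$ (j, i) - ?V l i * ?A $$ (j, k)) - (?V i l * ?A $$ (j, k) - ?V i k * ?A $$ (j, l))"
      unfolding e by (simp add: algebra_simps)
    also have "?q dvd \<dots>"
      using that by (intro dvd_diff [OF dvd_add [OF dvd_minus_iff [THEN iffD2]]] minor)
    finally show ?thesis .
  qed
  have "?q dvd ((2 * ?X) \<cdot>\<^sub>m (W * ?A)) $$ (i, k)" if ik: "i < d" "k < d" for i k
  proof -
    have "((2 * ?X) \<cdot>\<^sub>m (W * ?A)) $$ (i, k) = 2 * ?X * ?V i k"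
      using ik W A by simp
    also have "\<dots> = (\<Sum>j<d. \<Sum>l<d. U $$ (j, l) * (2 * ?V i k * ?A $$ (l, j)))"
      unfolding pairing_def by (simp add: sum_distrib_left sum_distrib_right mult_ac)
    also have "?q dvd \<dots>"
      using ik by (intro dvd_sum dvd_mult two) auto
    finally show ?thesis .
  qed
  moreover have "(2 * ?X) \<cdot>\<^sub>m (W * ?A) \<in> carrier_mat d d" using W A by simp
  ultimately obtain Z where Z: "Z \<in> carrier_mat d d" "(2 * ?X) \<cdot>\<^sub>m (W * ?A) = ?q \<cdot>\<^sub>m Z"
    using dvd_mat by blast
  have "((2 * ?X) \<cdot>\<^sub>m W) * ?A = ?q \<cdot>\<^sub>m Z"
    using W A Z(2) by (simp add: mult_smult_assoc_mat [of _ d d _ d])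
  \<comment> \<open>The scalar \<open>det M\<close> is written as \<open>M * A\<close> so that the
    adjugate can be cancelled on the right.\<close>
  also have "\<dots> = Z * (M * ?A)"
    unfolding A(2) using Z by (simp add: mult_smult_distrib [of _ d d _ d])
  also have "\<dots> = Z * M * ?A" using Z(1) M A(1) by (intro assoc_mult_mat [symmetric])
  finally have eq: "((2 * ?X) \<cdot>\<^sub>m W) * ?A = Z * M * ?A" .
  have "(2 * ?X) \<cdot>\<^sub>m W = Z * M"
    by (rule adj_cancel_right [OF M q _ _ eq]) (use W Z(1) M in \<open>auto intro: mult_carrier_mat\<close>)
  then show ?thesis using that Z by blast
qed

section \<open>Homogeneous matrices and division by a pencil\<close>

definition hom_mat :: "nat \<Rightarrow> nat \<Rightarrow> poly3 mat \<Rightarrow> bool" where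
  "hom_mat d m X \<longleftrightarrow> X \<in> carrier_mat d d \<and> (\<forall>i<d. \<forall>j<d. homogeneous3 m (X $$ (i, j)))"

text \<open>\<open>degree\<close> refers to the outermost variable \<open>t\<close>. These matrices
  are the remainders of division by \<open>t I + M0\<close>.\<close>

definition t_free_mat :: "nat \<Rightarrow> poly3 mat \<Rightarrow> bool" where
  "t_free_mat d X \<longleftrightarrow> X \<in> carrier_mat d d \<and> (\<forall>i<d. \<forall>j<d. degree (X $$ (i, j)) = 0)"

lemma hom_matD:
  "hom_mat d m X \<Longrightarrow> X \<in> carrier_mat d d"
  "hom_mat d m X \<Longrightarrow> i < d \<Longrightarrow> j < d \<Longrightarrow> homogeneous3 m (X $$ (i, j))"
  by (auto simp: hom_mat_def)

lemma t_free_matD: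
  "t_free_mat d X \<Longrightarrow> X \<in> carrier_mat d d"
  "t_free_mat d X \<Longrightarrow> i < d \<Longrightarrow> j < d \<Longrightarrow> degree (X $$ (i, j)) = 0"
  by (auto simp: t_free_mat_def)

lemma hom_mat_mult: "hom_mat d m X \<Longrightarrow> hom_mat d n Y \<Longrightarrow> k = m + n \<Longrightarrow> hom_mat d k (X * Y)"
  unfolding hom_mat_def
  by (auto simp: mat_index_mult2 [of _ d] intro!: homogeneous3_sum homogeneous3_mult)

lemma hom_mat_smult: "homogeneous3 m p \<Longrightarrow> hom_mat d n X \<Longrightarrow> k = m + n \<Longrightarrow> hom_mat d k (p \<cdot>\<^sub>m X)"
  unfolding hom_mat_def by (auto intro!: homogeneous3_mult)

lemma hom_mat_add: "hom_mat d n X \<Longrightarrow> hom_mat d n Y \<Longrightarrow> hom_mat d n (X + Y)"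
  unfolding hom_mat_def by (auto intro!: homogeneous3_add)

lemma hom_mat_minus: "hom_mat d n X \<Longrightarrow> hom_mat d n Y \<Longrightarrow> hom_mat d n (X - Y)"
  unfolding hom_mat_def by (auto simp: minus_carrier_mat intro!: homogeneous3_diff)

lemma degree_0_closed:
  fixes p q :: poly3
  shows "degree p = 0 \<Longrightarrow> degree q = 0 \<Longrightarrow> degree (p * q) = 0"
    "degree p = 0 \<Longrightarrow> degree q = 0 \<Longrightarrow> degree (p - q) = 0"
    "degree p = 0 \<Longrightarrow> degree (p ^ n) = 0"
    "(\<And>a. a \<in> A \<Longrightarrow> degree (f a) = 0) \<Longrightarrow> degree (sum f A :: poly3) = 0"
proof -
  show "degree p = 0 \<Longrightarrow> degree q = 0 \<Longrightarrow> degree (p * q) = 0" for p q :: poly3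
    using degree_mult_le [of p q] by simp
  show "degree p = 0 \<Longrightarrow> degree q = 0 \<Longrightarrow> degree (p - q) = 0"
    using degree_diff_le_max [of p q] by simp
  show "degree p = 0 \<Longrightarrow> degree (p ^ n) = 0"
    using degree_power_le [of p n] by simp
  show "(\<And>a. a \<in> A \<Longrightarrow> degree (f a) = 0) \<Longrightarrow> degree (sum f A :: poly3) = 0"
    using degree_sum_le [of A f 0] by (cases "finite A") auto
qed

lemma t_free_mat_mult: "t_free_mat d X \<Longrightarrow> t_free_mat d Y \<Longrightarrow> t_free_mat d (X * Y)"
  unfolding t_free_mat_def
  by (auto simp: mat_index_mult2 [of _ d] intro!: degree_0_closed)

lemma t_free_mat_smult: "degree p = 0 \<Longrightarrow> t_free_mat d X \<Longrightarrow> t_free_mat d (p \<cdot>\<^sub>m X)"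
  unfolding t_free_mat_def by (auto intro!: degree_0_closed)

lemma t_free_mat_minus: "t_free_mat d X \<Longrightarrow> t_free_mat d Y \<Longrightarrow> t_free_mat d (X - Y)"
  unfolding t_free_mat_def by (auto simp: minus_carrier_mat intro!: degree_0_closed)

lemma split_t:
  assumes "homogeneous3 m p"
  obtains p0 p1 where "p = p0 + var_t * p1" "degree p0 = 0" "homogeneous3 m p0" "homogeneous3 (m - 1) p1"
    "m = 0 \<Longrightarrow> p1 = 0"
proof -
  obtain a r where p: "p = pCons a r" by (cases p)
  have r: "coeff3 r i j k = coeff3 p (Suc i) j k" for i j k by (simp add: p coeff3_def)
  have a: "coeff3 [:a:] i j k = (if i = 0 then coeff3 p 0 j k else 0)" for i j k
    by (cases i) (simp_all add: p coeff3_def)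
  show ?thesis
  proof (rule that [of "[:a:]" r])
    show "p = [:a:] + var_t * r" by (simp add: p var_t_def)
    show "homogeneous3 m [:a:]" using assms unfolding homogeneous3_def a by metis
    show "homogeneous3 (m - 1) r" using assms by (fastforce simp: homogeneous3_def r)
    show "r = 0" if "m = 0" using assms that by (intro poly3_eqI) (auto simp: r intro: homogeneous3_coeff_0)
  qed simp
qed

text \<open>Right division by \<open>t I + M0\<close>, which is monic in \<open>t\<close>: a term
  \<open>t K\<close> is replaced by \<open>K (t I + M0) - K M0\<close>. As \<open>M0\<close> is
  linear, \<open>K M0\<close> has the degree of \<open>t K\<close>, so the remainder stays
  homogeneous.\<close>

lemma t_elimination:
  assumes M0: "t_free_mat d M0" "hom_mat d 1 M0"
    and C: "hom_mat d m C"
  shows "\<exists>z K. z \<in> carrier_mat d d \<and> C = z * (var_t \<cdot>\<^sub>m 1\<^sub>m d + M0) + K \<and> t_free_mat d K \<and> hom_mat d m K"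
  using C
proof (induction m arbitrary: C)
  case 0
  have "degree (C $$ (i, j)) = 0" if "i < d" "j < d" for i j
    using homogeneous3_degree_le [OF hom_matD(2) [OF 0 that]] by simp
  then have "t_free_mat d C" using 0 by (simp add: t_free_mat_def hom_mat_def)
  moreover have "C = 0\<^sub>m d d * (var_t \<cdot>\<^sub>m 1\<^sub>m d + M0) + C"
    using hom_matD(1) [OF 0] hom_matD(1) [OF M0(2)] by simp
  ultimately show ?case using 0 by (intro exI [of _ "0\<^sub>m d d"] exI [of _ C]) simp
next
  case (Suc m)
  let ?M = "var_t \<cdot>\<^sub>m 1\<^sub>m d + M0"
  have M0c: "M0 \<in> carrier_mat d d" using M0 by (simp add: hom_mat_def)
  have "\<forall>i j. \<exists>p0 p1. i < d \<longrightarrow> j < d \<longrightarrow> C $$ (i, j) = p0 + var_t * p1 \<and> degree p0 = 0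
      \<and> homogeneous3 (Suc m) p0 \<and> homogeneous3 m p1"
    using split_t [OF hom_matD(2) [OF Suc.prems]] by (metis diff_Suc_1)
  then obtain p0 p1 where p: "\<And>i j. i < d \<Longrightarrow> j < d \<Longrightarrow> C $$ (i, j) = p0 i j + var_t * p1 i j \<and> degree (p0 i j) = 0
      \<and> homogeneous3 (Suc m) (p0 i j) \<and> homogeneous3 m (p1 i j)" by metis
  define C0 where "C0 = Matrix.mat d d (\<lambda>(i, j). p0 i j)"
  define C1 where "C1 = Matrix.mat d d (\<lambda>(i, j). p1 i j)"
  have C0: "t_free_mat d C0" "hom_mat d (Suc m) C0" and C1: "hom_mat d m C1"
    using p by (auto simp: C0_def C1_def t_free_mat_def hom_mat_def)
  have C: "C = C0 + var_t \<cdot>\<^sub>m C1"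
    using hom_matD(1) [OF Suc.prems] p by (intro eq_matI) (auto simp: C0_def C1_def)
  obtain z K where IH: "z \<in> carrier_mat d d" "C1 = z * ?M + K" "t_free_mat d K" "hom_mat d m K"
    using Suc.IH [OF C1] by blast
  have c: "z \<in> carrier_mat d d" "K \<in> carrier_mat d d" "C0 \<in> carrier_mat d d" "?M \<in> carrier_mat d d"
    using IH(1) hom_matD(1) [OF IH(4)] hom_matD(1) [OF C0(2)] M0c by auto
  have KM: "K * ?M = var_t \<cdot>\<^sub>m K + K * M0"
    using c M0c by (simp add: mult_add_distrib_mat [of _ d d _ d] mult_smult_distrib [of _ d d _ d])
  have "(var_t \<cdot>\<^sub>m z + K) * ?M = var_t \<cdot>\<^sub>m (z * ?M) + (var_t \<cdot>\<^sub>m K + K * M0)"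
    using c by (simp add: add_mult_distrib_mat [of _ d d _ _ d] mult_smult_assoc_mat [of _ d d _ d] KM)
  moreover have zM: "z * ?M \<in> carrier_mat d d" and KM0: "K * M0 \<in> carrier_mat d d"
    using c M0c by (auto intro: mult_carrier_mat)
  ultimately have "C = (var_t \<cdot>\<^sub>m z + K) * ?M + (C0 - K * M0)"
    unfolding C IH(2) by (intro eq_matI) (use c in \<open>auto simp: algebra_simps\<close>)
  moreover have "t_free_mat d (C0 - K * M0)" "hom_mat d (Suc m) (C0 - K * M0)"
    using C0 IH M0 by (auto intro!: t_free_mat_minus t_free_mat_mult hom_mat_minus hom_mat_mult [of d m _ 1])
  ultimately show ?case using c by (intro exI [of _ "var_t \<cdot>\<^sub>m z + K"] exI [of _ "C0 - K * M0"]) auto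
qed

text \<open>The top t-coefficient of a nonzero \<open>Z\<close> survives in
  \<open>Z (t I + M0)\<close> one degree higher. This is the uniqueness of the remainder in right
  division.\<close>

lemma t_free_multiple_eq_0:
  assumes M0: "t_free_mat d M0" and Z: "Z \<in> carrier_mat d d"
    and ZM: "t_free_mat d (Z * (var_t \<cdot>\<^sub>m 1\<^sub>m d + M0))"
  shows "Z = 0\<^sub>m d d"
proof -
  let ?M = "var_t \<cdot>\<^sub>m 1\<^sub>m d + M0"
  have M0c: "M0 \<in> carrier_mat d d" using M0 by (simp add: t_free_mat_def)
  have eq: "Z * ?M = var_t \<cdot>\<^sub>m Z + Z * M0"
    using Z M0c by (simp add: mult_add_distrib_mat [of _ d d _ d] mult_smult_distrib [of _ d d _ d])
  have step: "coeff (Z $$ (i, j)) k = 0"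
    if IH: "\<And>i j. i < d \<Longrightarrow> j < d \<Longrightarrow> coeff (Z $$ (i, j)) (Suc k) = 0" and ij: "i < d" "j < d" for i j k
  proof -
    have "0 = coeff ((Z * ?M) $$ (i, j)) (Suc k)"
      using t_free_matD(2) [OF ZM ij] by (simp add: coeff_eq_0)
    also have "(Z * ?M) $$ (i, j) = var_t * Z $$ (i, j) + (\<Sum>l<d. Z $$ (i, l) * M0 $$ (l, j))"
      unfolding eq using Z M0c ij by (simp add: scalar_prod_def atLeast0LessThan)
    also have "coeff \<dots> (Suc k) = coeff (Z $$ (i, j)) k + (\<Sum>l<d. coeff (Z $$ (i, l) * M0 $$ (l, j)) (Suc k))"
      by (simp add: coeff_sum var_t_def)
    also have "(\<Sum>l<d. coeff (Z $$ (i, l) * M0 $$ (l, j)) (Suc k)) = 0"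
    proof (rule sum.neutral, rule ballI)
      fix l assume l: "l \<in> {..<d}"
      obtain c where "M0 $$ (l, j) = [:c:]"
        using t_free_matD(2) [OF M0, of l j] l ij by (auto elim: degree_eq_zeroE)
      then show "coeff (Z $$ (i, l) * M0 $$ (l, j)) (Suc k) = 0"
        using IH [of i l] l ij by (simp add: mult.commute [of _ "[:c:]"])
    qed
    finally show ?thesis by simp
  qed
  \<comment> \<open>Any bound above all entry degrees starts the descent, in which the coefficients
    at \<open>Suc k\<close> clear those at \<open>k\<close>.\<close>
  define n where "n = Suc (\<Sum>i<d. \<Sum>j<d. degree (Z $$ (i, j)))"
  have n: "degree (Z $$ (i, j)) < n" if "i < d" "j < d" for i j
  proof -
    have "degree (Z $$ (i, j)) \<le> (\<Sum>j<d. degree (Z $$ (i, j)))"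
      by (rule member_le_sum) (use that in auto)
    also have "\<dots> \<le> (\<Sum>i<d. \<Sum>j<d. degree (Z $$ (i, j)))"
      by (rule member_le_sum [where f = "\<lambda>i. \<Sum>j<d. degree (Z $$ (i, j))"]) (use that in auto)
    finally show ?thesis by (simp add: n_def)
  qed
  have desc: "\<forall>i<d. \<forall>j<d. coeff (Z $$ (i, j)) (n - k) = 0" if "k \<le> n" for k
    using that
  proof (induction k)
    case 0
    then show ?case using n by (simp add: coeff_eq_0)
  next
    case (Suc k)
    then have "Suc (n - Suc k) = n - k" by simp
    then show ?case using step [of "n - Suc k"] Suc by simp
  qed
  have "coeff (Z $$ (i, j)) k = 0" if "i < d" "j < d" for i j k
  proof (cases "k \<le> n")
    case True
    then show ?thesis using desc [of "n - k"] that by simp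
  next
    case False
    then show ?thesis using n [OF that] by (intro coeff_eq_0) simp
  qed
  then show ?thesis
    using Z by (intro eq_matI) (auto intro: poly_eqI)
qed

lemma homogeneous3_det:
  assumes A: "A \<in> carrier_mat n n" and hom: "\<And>i j. i < n \<Longrightarrow> j < n \<Longrightarrow> homogeneous3 1 (A $$ (i, j))"
  shows "homogeneous3 n (det A)"
  unfolding det_def' [OF A]
proof (rule homogeneous3_sum)
  fix p assume "p \<in> {p. p permutes {0..<n}}"
  then have pn: "p i < n" if "i < n" for i using that by auto
  have "homogeneous3 (\<Sum>i = 0..<n. 1) (\<Prod>i = 0..<n. A $$ (i, p i))"
    by (rule homogeneous3_prod) (use pn hom in auto)
  then show "homogeneous3 n (signof p * (\<Prod>i = 0..<n. A $$ (i, p i)))"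
    by (cases p rule: sign_cases) auto
qed

lemma hom_mat_adj:
  assumes M: "hom_mat d 1 M"
  shows "hom_mat d (d - 1) (adj_mat M)"
proof -
  have Mc: "M \<in> carrier_mat d d" using M by (simp add: hom_mat_def)
  have "homogeneous3 (d - 1) (adj_mat M $$ (i, j))" if ij: "i < d" "j < d" for i j
  proof -
    have "homogeneous3 (d - 1) (det (mat_delete M j i))"
    proof (rule homogeneous3_det)
      show "mat_delete M j i \<in> carrier_mat (d - 1) (d - 1)" using Mc by (auto simp: mat_delete_def)
      show "homogeneous3 1 (mat_delete M j i $$ (k, l))" if "k < d - 1" "l < d - 1" for k l
        using that Mc by (auto simp: mat_delete_def intro!: hom_matD(2) [OF M, unfolded One_nat_def])
    qed
    moreover have "adj_mat M $$ (i, j) = (- 1) ^ (j + i) * det (mat_delete M j i)"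
      using Mc ij by (simp add: adj_mat_def cofactor_def)
    ultimately show ?thesis
      using homogeneous3_uminus by (cases "even (j + i)") auto
  qed
  then show ?thesis using adj_mat(1) [OF Mc] by (simp add: hom_mat_def)
qed

text \<open>Multiplication by x2^N does not change exponents of x1, so every monomial of
  \<open>c\<close> would contain x1^N, which degree \<open>m < N\<close> does not allow.\<close>

lemma coprime_x1_x2_powers:
  assumes "homogeneous3 m c" "m < N" "var_x2 ^ N * c = var_x1 ^ N * c'"
  shows "c = 0"
proof (rule poly3_eqI)
  fix i j k
  have x2: "coeff3 (var_x2 ^ n * p) i j (k + n) = coeff3 p i j k" for n p
    by (induction n) (simp_all add: coeff3_var_mult mult.assoc)
  have x1: "coeff3 (var_x1 ^ n * p) i j k = 0" if "j < n" for n p j k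
    using that by (induction n arbitrary: j) (auto simp: coeff3_var_mult mult.assoc)
  show "coeff3 c i j k = coeff3 0 i j k"
  proof (cases "j < N")
    case True
    then show ?thesis using x2 [of N c] x1 [of j N c' "k + N"] assms(3) by simp
  next
    case False
    then show ?thesis using assms(1,2) homogeneous3_coeff_0 [of m c i j k] by simp
  qed
qed

lemma degree_var_power: "degree (var_x1 ^ n) = 0" "degree (var_x2 ^ n) = 0"
  using degree_power_le [of var_x1 n] degree_power_le [of var_x2 n] by (simp_all add: var_x1_def var_x2_def)

text \<open>\<open>B U\<close> has degree (d - 2) + (N - d + 1) and \<open>E S\<close> has degree (N
  + d - 1) - d, both \<open>N - 1\<close>. The count is made after multiplication by
  \<open>det M\<close>, which avoids the negative degree d - 2 at d = 1.\<close>

lemma trivialisation_homogeneous: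
  assumes d: "1 \<le> d" "d \<le> N" and M: "hom_mat d 1 M" and q: "det M \<noteq> 0"
    and S: "hom_mat d 0 S" and U: "hom_mat d (N - (d - 1)) U"
    and B: "B \<in> carrier_mat d d" and ASA: "adj_mat M * S * adj_mat M = det M \<cdot>\<^sub>m B"
    and E: "E \<in> carrier_mat d d"
    and AUA: "adj_mat M * U * adj_mat M - pairing d U (adj_mat M) \<cdot>\<^sub>m adj_mat M = det M \<cdot>\<^sub>m E"
  shows "hom_mat d (N - 1) (B * U - E * S)"
proof -
  let ?A = "adj_mat M" and ?q = "det M"
  have A: "hom_mat d (d - 1) ?A" by (rule hom_mat_adj [OF M])
  have X: "homogeneous3 N (pairing d U ?A)"
    unfolding pairing_def
    by (intro homogeneous3_sum homogeneous3_mult_eq [of "N - (d - 1)" _ "d - 1"])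
      (use hom_matD(2) [OF U] hom_matD(2) [OF A] d in auto)
  have qB: "hom_mat d (2 * (d - 1)) (?q \<cdot>\<^sub>m B)"
    unfolding ASA [symmetric] by (intro hom_mat_mult [OF hom_mat_mult [OF A S] A]) simp_all
  have qE: "hom_mat d (N + (d - 1)) (?q \<cdot>\<^sub>m E)"
    unfolding AUA [symmetric]
    by (intro hom_mat_minus hom_mat_smult [OF X A] hom_mat_mult [OF hom_mat_mult [OF A U] A]) (use d in simp_all)
  have c: "U \<in> carrier_mat d d" "S \<in> carrier_mat d d" using U S by (simp_all add: hom_mat_def)
  have "?q \<cdot>\<^sub>m (B * U - E * S) = (?q \<cdot>\<^sub>m B) * U - (?q \<cdot>\<^sub>m E) * S"
  proof -
    have "?q \<cdot>\<^sub>m (Y - Z) = ?q \<cdot>\<^sub>m Y - ?q \<cdot>\<^sub>m Z" if "Y \<in> carrier_mat d d" "Z \<in> carrier_mat d d" for Y Z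
      by (rule eq_matI) (use that in \<open>auto simp: right_diff_distrib\<close>)
    moreover have "B * U \<in> carrier_mat d d" "E * S \<in> carrier_mat d d" using B E c by (auto intro: mult_carrier_mat)
    ultimately show ?thesis
      using B E c by (simp add: mult_smult_assoc_mat [of _ d d _ d])
  qed
  also have "hom_mat d (d + (N - 1)) \<dots>"
    by (intro hom_mat_minus hom_mat_mult [OF qB U] hom_mat_mult [OF qE S]) (use d in simp_all)
  finally have qC: "hom_mat d (d + (N - 1)) (?q \<cdot>\<^sub>m (B * U - E * S))" .
  have Cc: "B * U - E * S \<in> carrier_mat d d" using c E by (auto intro!: minus_carrier_mat mult_carrier_mat)
  have qh: "homogeneous3 d ?q" by (rule homogeneous3_det) (use M in \<open>auto simp: hom_mat_def\<close>)
  have "homogeneous3 (N - 1) ((B * U - E * S) $$ (i, j))" if ij: "i < d" "j < d" for i j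
  proof (rule homogeneous3_cancel [OF qh q])
    have "(?q \<cdot>\<^sub>m (B * U - E * S)) $$ (i, j) = ?q * (B * U - E * S) $$ (i, j)"
      by (rule index_smult_mat) (use Cc ij in \<open>simp_all only: carrier_matD\<close>)
    then show "homogeneous3 (d + (N - 1)) (?q * (B * U - E * S) $$ (i, j))"
      using hom_matD(2) [OF qC ij] by simp
  qed
  then show ?thesis using Cc by (simp add: hom_mat_def)
qed

lemma smult_minus_index:
  "P \<in> carrier_mat n m \<Longrightarrow> Q \<in> carrier_mat n m \<Longrightarrow> i < n \<Longrightarrow> j < m \<Longrightarrow>
    (a \<cdot>\<^sub>m P - b \<cdot>\<^sub>m Q) $$ (i, j) = a * P $$ (i, j) - b * Q $$ (i, j)"
  by simp

lemma smult_minus_cancel: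
  fixes a :: "'a::comm_ring_1"
  assumes "P \<in> carrier_mat n m" "Q \<in> carrier_mat n m" "K \<in> carrier_mat n m" "L \<in> carrier_mat n m"
  shows "a \<cdot>\<^sub>m (b \<cdot>\<^sub>m (P + K) - c \<cdot>\<^sub>m (Q + L)) - a \<cdot>\<^sub>m (b \<cdot>\<^sub>m P - c \<cdot>\<^sub>m Q)
    = a \<cdot>\<^sub>m (b \<cdot>\<^sub>m K - c \<cdot>\<^sub>m L)"
  by (rule eq_matI) (use assms in \<open>auto simp: algebra_simps\<close>)

text \<open>With two trivialisations, for \<open>x1^N\<close> and for \<open>x2^N\<close>, the quotients agree after reduction modulo
  the pencil; for degree reasons this forces both reductions to vanish.\<close>

lemma adjugate_entries_independent:
  assumes d: "1 \<le> d" "d \<le> N"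
    and M0: "t_free_mat d M0" "hom_mat d 1 M0" "M0\<^sup>T = M0"
    and M: "M = var_t \<cdot>\<^sub>m 1\<^sub>m d + M0" and monic: "coeff3 (det M) d 0 0 = 1"
    and U1: "hom_mat d (N - (d - 1)) U1" "U1\<^sup>T = U1" "pairing d U1 (adj_mat M) = var_x1 ^ N"
    and U2: "hom_mat d (N - (d - 1)) U2" "U2\<^sup>T = U2" "pairing d U2 (adj_mat M) = var_x2 ^ N"
    and S: "hom_mat d 0 S" "S\<^sup>T = S" and SA: "pairing d S (adj_mat M) = 0"
  shows "S = 0\<^sub>m d d"
proof -
  let ?A = "adj_mat M" and ?q = "det M" and ?X1 = "var_x1 ^ N" and ?X2 = "var_x2 ^ N"
  have M0c: "M0 \<in> carrier_mat d d" and Uc: "U1 \<in> carrier_mat d d" "U2 \<in> carrier_mat d d"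
    and Sc: "S \<in> carrier_mat d d" using M0 U1 U2 S by (simp_all add: hom_mat_def)
  have Mc: "M \<in> carrier_mat d d" using M0c by (simp add: M)
  have MT: "M\<^sup>T = M"
    unfolding M by (subst transpose_add [of _ d d]) (use M0 M0c in \<open>auto intro!: eq_matI arg_cong2 [of _ _ _ _ "(+)"]\<close>)
  have q: "?q \<noteq> 0" using monic by auto
  have Mh: "hom_mat d 1 M"
    unfolding M by (rule hom_mat_add [OF _ M0(2)]) (auto simp: hom_mat_def)
  have Ah: "hom_mat d (d - 1) ?A" by (rule hom_mat_adj [OF Mh])
  have A: "?A \<in> carrier_mat d d" "M * ?A = ?q \<cdot>\<^sub>m 1\<^sub>m d" using adj_mat [OF Mc] by auto
  obtain B where B: "B \<in> carrier_mat d d" "?A * S * ?A - pairing d S ?A \<cdot>\<^sub>m ?A = ?q \<cdot>\<^sub>m B"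
    using adj_sandwich [OF Mc q Sc] .
  have "?A * S * ?A - 0 \<cdot>\<^sub>m ?A = ?A * S * ?A"
    by (rule eq_matI) (use A Sc in \<open>auto simp del: assoc_mult_mat\<close>)
  then have ASA: "?A * S * ?A = ?q \<cdot>\<^sub>m B" using B(2) SA by simp
  obtain E1 where E1: "E1 \<in> carrier_mat d d" "?A * U1 * ?A - pairing d U1 ?A \<cdot>\<^sub>m ?A = ?q \<cdot>\<^sub>m E1"
    using adj_sandwich [OF Mc q Uc(1)] .
  obtain E2 where E2: "E2 \<in> carrier_mat d d" "?A * U2 * ?A - pairing d U2 ?A \<cdot>\<^sub>m ?A = ?q \<cdot>\<^sub>m E2"
    using adj_sandwich [OF Mc q Uc(2)] .
  define C1 where "C1 = B * U1 - E1 * S"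
  define C2 where "C2 = B * U2 - E2 * S"
  have C1: "hom_mat d (N - 1) C1" and C2: "hom_mat d (N - 1) C2"
    unfolding C1_def C2_def
    using trivialisation_homogeneous [OF d Mh q S(1) U1(1) B(1) ASA E1]
      trivialisation_homogeneous [OF d Mh q S(1) U2(1) B(1) ASA E2] by auto
  have C1A: "(C1 * ?A) $$ (i, j) + (C1 * ?A) $$ (j, i) = 2 * ?X1 * B $$ (i, j)" if "i < d" "j < d" for i j
    using deformation_trivialisation [OF Mc MT q Sc S(2) Uc(1) U1(2) B(1) ASA E1 that]
    by (simp add: U1(3) C1_def)
  have C2A: "(C2 * ?A) $$ (i, j) + (C2 * ?A) $$ (j, i) = 2 * ?X2 * B $$ (i, j)" if "i < d" "j < d" for i j
    using deformation_trivialisation [OF Mc MT q Sc S(2) Uc(2) U2(2) B(1) ASA E2 that]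
    by (simp add: U2(3) C2_def)
  obtain z1 K1 where K1: "z1 \<in> carrier_mat d d" "C1 = z1 * M + K1" "t_free_mat d K1" "hom_mat d (N - 1) K1"
    using t_elimination [OF M0(1,2) C1] by (auto simp: M)
  obtain z2 K2 where K2: "z2 \<in> carrier_mat d d" "C2 = z2 * M + K2" "t_free_mat d K2" "hom_mat d (N - 1) K2"
    using t_elimination [OF M0(1,2) C2] by (auto simp: M)
  have Kc: "K1 \<in> carrier_mat d d" "K2 \<in> carrier_mat d d" using K1(4) K2(4) by (simp_all add: hom_mat_def)
  have Cc: "C1 \<in> carrier_mat d d" "C2 \<in> carrier_mat d d" using C1 C2 by (simp_all add: hom_mat_def)
  \<comment> \<open>Crosswise multiplication makes both symmetrised products 2 x1^N x2^N
    \<open>B\<close>, so \<open>W * A\<close> is antisymmetric.\<close>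
  define W where "W = ?X2 \<cdot>\<^sub>m C1 - ?X1 \<cdot>\<^sub>m C2"
  have W: "W \<in> carrier_mat d d" using Cc by (simp add: W_def minus_carrier_mat)
  have CAc: "C1 * ?A \<in> carrier_mat d d" "C2 * ?A \<in> carrier_mat d d" using Cc A by (auto intro: mult_carrier_mat)
  have "W * ?A = ?X2 \<cdot>\<^sub>m (C1 * ?A) - ?X1 \<cdot>\<^sub>m (C2 * ?A)"
    unfolding W_def using Cc A
    by (simp add: minus_mult_distrib_mat [of _ d d _ _ d] mult_smult_assoc_mat [of _ d d _ d])
  then have WA: "(W * ?A) $$ (i, j) = ?X2 * (C1 * ?A) $$ (i, j) - ?X1 * (C2 * ?A) $$ (i, j)" if "i < d" "j < d" for i j
    unfolding smult_minus_index [OF CAc that, symmetric] by simp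
  have "(W * ?A) $$ (i, j) + (W * ?A) $$ (j, i) = 0" if ij: "i < d" "j < d" for i j
  proof -
    have "(W * ?A) $$ (i, j) + (W * ?A) $$ (j, i) = ?X2 * ((C1 * ?A) $$ (i, j) + (C1 * ?A) $$ (j, i))
        - ?X1 * ((C2 * ?A) $$ (i, j) + (C2 * ?A) $$ (j, i))"
      by (simp only: WA [OF ij] WA [OF ij(2,1)]) (simp only: algebra_simps)
    then show ?thesis by (simp only: C1A [OF ij] C2A [OF ij]) (simp add: mult_ac)
  qed
  then obtain Z where Z: "Z \<in> carrier_mat d d" "(2 * ?X1) \<cdot>\<^sub>m W = Z * M"
    using antisymmetric_multiple_of_adj [OF Mc q W Uc(1)] U1(3) by metis
  \<comment> \<open>All quotients by \<open>M\<close> are collected in \<open>Y\<close>; what is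
    left of \<open>Y * M\<close> is free of \<open>t\<close>, so \<open>Y\<close> vanishes.\<close>
  define Y where "Y = Z - (2 * ?X1) \<cdot>\<^sub>m (?X2 \<cdot>\<^sub>m z1 - ?X1 \<cdot>\<^sub>m z2)"
  have Y: "Y \<in> carrier_mat d d" using K1(1) K2(1) by (simp add: Y_def minus_carrier_mat)
  let ?K = "(2 * ?X1) \<cdot>\<^sub>m (?X2 \<cdot>\<^sub>m K1 - ?X1 \<cdot>\<^sub>m K2)"
  have Kfree: "t_free_mat d ?K"
    by (intro t_free_mat_smult t_free_mat_minus K1 K2 degree_0_closed degree_var_power) simp
  have "Y * M = ?K"
  proof -
    have zM: "z1 * M \<in> carrier_mat d d" "z2 * M \<in> carrier_mat d d"
      using K1 K2 Mc by (auto intro: mult_carrier_mat)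
    have "Y * M = Z * M - (2 * ?X1) \<cdot>\<^sub>m (?X2 \<cdot>\<^sub>m (z1 * M) - ?X1 \<cdot>\<^sub>m (z2 * M))"
      unfolding Y_def using Z K1 K2 Mc
      by (simp add: minus_mult_distrib_mat [of _ d d _ _ d] mult_smult_assoc_mat [of _ d d _ d] minus_carrier_mat)
    also have "\<dots> = ?K"
      unfolding Z(2) [symmetric] W_def K1(2) K2(2)
      by (rule smult_minus_cancel [OF zM Kc])
    finally show ?thesis .
  qed
  then have "Y = 0\<^sub>m d d"
    using t_free_multiple_eq_0 [OF M0(1) Y] Kfree by (simp add: M)
  then have K0: "?K = 0\<^sub>m d d" using \<open>Y * M = ?K\<close> Mc by simp
  have "K1 $$ (i, j) = 0" if ij: "i < d" "j < d" for i j
  proof -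
    have "?K $$ (i, j) = 0" using K0 ij by simp
    then have "2 * ?X1 * (?X2 * K1 $$ (i, j) - ?X1 * K2 $$ (i, j)) = 0"
      using Kc ij by simp
    moreover have "var_x1 \<noteq> 0" by (simp add: var_x1_def)
    \<comment> \<open>Here the exact degree counts: \<open>K1\<close> has degree
      \<open>N - 1\<close>, one too small for divisibility by x1^N.\<close>
    ultimately have "?X2 * K1 $$ (i, j) = ?X1 * K2 $$ (i, j)" by simp
    then show ?thesis
      by (rule coprime_x1_x2_powers [OF hom_matD(2) [OF K1(4) ij], rotated]) (use d in simp)
  qed
  then have "K1 = 0\<^sub>m d d" using Kc by (intro eq_matI) auto
  then have C1z: "C1 = z1 * M" using K1 Mc by simp
  have "C1 * ?A = z1 * (M * ?A)" unfolding C1z using K1(1) Mc A(1) by (intro assoc_mult_mat)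
  then have C1Aq: "C1 * ?A = ?q \<cdot>\<^sub>m z1"
    unfolding A(2) using K1(1) by (simp add: mult_smult_distrib [of _ d d _ d])
  \<comment> \<open>From here the degree in \<open>t\<close> decides: \<open>det M\<close> reaches
    degree \<open>d\<close> and divides 2 x1^N \<open>B\<close>, whereas
    \<open>A S A = det M * B\<close> leaves \<open>B\<close> a degree below
    \<open>d\<close>.\<close>
  have qdeg: "degree ?q \<ge> d"
    using monic by (intro le_degree) (auto simp: coeff3_def)
  have "B $$ (i, j) = 0" if ij: "i < d" "j < d" for i j
  proof (rule ccontr)
    assume nz: "B $$ (i, j) \<noteq> 0"
    have "(?A * S * ?A) $$ (i, j) = ?q * B $$ (i, j)" unfolding ASA using B(1) ij by simp
    moreover have "hom_mat d (2 * (d - 1)) (?A * S * ?A)"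
      by (intro hom_mat_mult [OF hom_mat_mult [OF Ah S(1)] Ah]) simp_all
    ultimately have "degree (?q * B $$ (i, j)) \<le> 2 * (d - 1)"
      using homogeneous3_degree_le hom_matD(2) ij by metis
    then have degB: "degree (B $$ (i, j)) < d"
      using degree_mult_eq [OF q nz] qdeg d by simp
    have eq: "2 * ?X1 * B $$ (i, j) = ?q * (z1 $$ (i, j) + z1 $$ (j, i))"
      using C1A [OF ij] K1(1) ij by (simp add: C1Aq distrib_left)
    have "2 * ?X1 * B $$ (i, j) \<noteq> 0" using nz by (simp add: var_x1_def)
    then have "degree ?q \<le> degree (2 * ?X1 * B $$ (i, j))"
      unfolding eq by (intro degree_mult_right_le) auto
    also have "degree (2 * ?X1 * B $$ (i, j)) \<le> degree (B $$ (i, j))"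
      using degree_mult_le [of "2 * ?X1" "B $$ (i, j)"] degree_0_closed(1) [of 2 ?X1] degree_var_power by simp
    finally show False using degB qdeg by simp
  qed
  then have "B = 0\<^sub>m d d" using B(1) by (intro eq_matI) auto
  \<comment> \<open>Now \<open>A S A = 0\<close>; one adjugate is cancelled on the right, the other
    after multiplication by \<open>M\<close> on the left.\<close>
  then have ASA0: "(?A * S) * ?A = 0\<^sub>m d d * ?A" unfolding ASA using A(1) by simp
  have "?A * S = 0\<^sub>m d d"
    by (rule adj_cancel_right [OF Mc q _ _ ASA0]) (use A(1) Sc in \<open>auto intro: mult_carrier_mat\<close>)
  then have "M * (?A * S) = 0\<^sub>m d d" using Mc by simp
  moreover have "M * (?A * S) = (M * ?A) * S" using Mc A(1) Sc by (intro assoc_mult_mat [symmetric])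
  ultimately have "?q \<cdot>\<^sub>m S = 0\<^sub>m d d"
    unfolding A(2) using Sc by (simp add: mult_smult_assoc_mat [of _ d d _ d])
  also have "\<dots> = ?q \<cdot>\<^sub>m 0\<^sub>m d d" by (rule eq_matI) auto
  finally show ?thesis by (rule smult_mat_cancel [OF q Sc, rotated]) simp
qed

section \<open>The differential of the determinant map\<close>

lemma derivation_pderiv: "derivation (pderiv :: 'a::idom poly \<Rightarrow> 'a poly)"
  by (simp add: derivation_def pderiv_add pderiv_mult mult.commute)

lemma derivation_map_poly:
  assumes "derivation \<delta>"
  shows "derivation (map_poly \<delta>)"
  unfolding derivation_def
proof (intro conjI allI)
  note \<delta> = derivation_simps [OF assms]
  fix p q
  show "map_poly \<delta> (p + q) = map_poly \<delta> p + map_poly \<delta> q"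
    by (rule poly_eqI) (simp add: coeff_map_poly \<delta>)
  show "map_poly \<delta> (p * q) = p * map_poly \<delta> q + map_poly \<delta> p * q"
    by (rule poly_eqI) (simp add: coeff_map_poly \<delta> coeff_mult derivation_sum [OF assms] sum.distrib)
qed

lemma derivation_pd: "derivation pd_x1" "derivation pd_x2"
  unfolding pd_x1_def pd_x2_def
  by (intro derivation_map_poly derivation_pderiv)+

text \<open>The bracketing exhibits the shape \<open>t I + M0\<close> needed for division;
  \<open>M0\<close> is \<open>direction d D R\<close>.\<close>

definition pencil :: "nat \<Rightarrow> complex mat \<Rightarrow> complex mat \<Rightarrow> poly3 mat" where
  "pencil d D R = var_t \<cdot>\<^sub>m 1\<^sub>m d + (var_x1 \<cdot>\<^sub>m map_mat const3 D + var_x2 \<cdot>\<^sub>m map_mat const3 R)"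

definition direction :: "nat \<Rightarrow> complex mat \<Rightarrow> complex mat \<Rightarrow> poly3 mat" where
  "direction d E S = var_x1 \<cdot>\<^sub>m map_mat const3 E + var_x2 \<cdot>\<^sub>m map_mat const3 S"

lemma pencil_index:
  "D \<in> carrier_mat d d \<Longrightarrow> R \<in> carrier_mat d d \<Longrightarrow> i < d \<Longrightarrow> j < d \<Longrightarrow>
   pencil d D R $$ (i, j) = (if i = j then var_t else 0) + (var_x1 * const3 (D $$ (i, j)) + var_x2 * const3 (R $$ (i, j)))"
  by (simp add: pencil_def)

lemma direction_index:
  "E \<in> carrier_mat d d \<Longrightarrow> S \<in> carrier_mat d d \<Longrightarrow> i < d \<Longrightarrow> j < d \<Longrightarrow>
   direction d E S $$ (i, j) = var_x1 * const3 (E $$ (i, j)) + var_x2 * const3 (S $$ (i, j))"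
  by (simp add: direction_def)

lemma pencil_carrier:
  "D \<in> carrier_mat d d \<Longrightarrow> R \<in> carrier_mat d d \<Longrightarrow> pencil d D R \<in> carrier_mat d d"
  "D \<in> carrier_mat d d \<Longrightarrow> R \<in> carrier_mat d d \<Longrightarrow> direction d D R \<in> carrier_mat d d"
  by (simp_all add: pencil_def direction_def)

lemma Phi_pencil:
  assumes "D \<in> carrier_mat d d" "R \<in> carrier_mat d d"
  shows "Phi d (D, R) = det (pencil d D R)"
proof -
  have "var_t \<cdot>\<^sub>m 1\<^sub>m d + var_x1 \<cdot>\<^sub>m map_mat const3 D + var_x2 \<cdot>\<^sub>m map_mat const3 R = pencil d D R"
    using assms by (intro eq_matI) (auto simp: pencil_def)
  then show ?thesis by (simp add: Phi_def)
qed

lemma (in comm_ring_hom) hom_adj_mat: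
  assumes A: "A \<in> carrier_mat n n"
  shows "adj_mat (map_mat hom A) = map_mat hom (adj_mat A)"
proof (rule eq_matI)
  fix i j assume "i < dim_row (map_mat hom (adj_mat A))" "j < dim_col (map_mat hom (adj_mat A))"
  then have ij: "i < n" "j < n" using A by (auto simp: adj_mat_def)
  have "mat_delete (map_mat hom A) j i = map_mat hom (mat_delete A j i)"
    using A ij by (intro eq_matI) (auto simp: mat_delete_def)
  then show "adj_mat (map_mat hom A) $$ (i, j) = map_mat hom (adj_mat A) $$ (i, j)"
    using A ij by (simp add: adj_mat_def cofactor_def hom_distribs)
qed (use A in \<open>auto simp: adj_mat_def\<close>)

text \<open>Each coefficient of \<open>poly P (const3 e)\<close> is a polynomial in the number
  \<open>e\<close>, so its analytic derivative at 0 is read off from the linear coefficient of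
  \<open>P\<close>.\<close>

lemma coeff3_poly_deriv:
  "deriv (\<lambda>e. coeff3 (poly P (const3 e)) i j k) 0 = coeff3 (coeff P 1) i j k"
proof -
  define Q where "Q = map_poly (\<lambda>p. coeff3 p i j k) P"
  have const3_pow: "const3 e ^ m = const3 (e ^ m)" for e m
    by (induction m) simp_all
  have "coeff3 (poly P (const3 e)) i j k = poly Q e" for e
  proof -
    have "coeff3 (poly P (const3 e)) i j k = (\<Sum>m\<le>degree P. coeff3 (coeff P m) i j k * e ^ m)"
      unfolding poly_altdef coeff3_sum const3_pow by simp
    also have "\<dots> = (\<Sum>m\<le>degree P. coeff Q m * e ^ m)"
      by (simp add: Q_def coeff_map_poly)
    also have "\<dots> = poly Q e"
    proof -
      have "degree Q \<le> degree P"
        by (rule degree_le) (simp add: Q_def coeff_map_poly coeff_eq_0)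
      then show ?thesis
        unfolding poly_altdef by (intro sum.mono_neutral_right) (auto simp: coeff_eq_0)
    qed
    finally show ?thesis .
  qed
  then have "deriv (\<lambda>e. coeff3 (poly P (const3 e)) i j k) 0 = deriv (poly Q) 0"
    by presburger
  also have "\<dots> = poly (pderiv Q) 0"
    by (rule DERIV_imp_deriv) (rule poly_DERIV)
  also have "\<dots> = coeff Q 1"
    by (simp add: poly_0_coeff_0 coeff_pderiv)
  also have "\<dots> = coeff3 (coeff P 1) i j k"
    by (simp add: Q_def coeff_map_poly)
  finally show ?thesis .
qed

lemma homogeneous3_box_expand:
  assumes "homogeneous3 d g"
  shows "(\<Sum>i\<le>d. \<Sum>j\<le>d. \<Sum>k\<le>d. const3 (coeff3 g i j k) * var_t ^ i * var_x1 ^ j * var_x2 ^ k) = g"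
proof (rule poly3_eqI)
  fix a b c
  have "coeff3 (\<Sum>i\<le>d. \<Sum>j\<le>d. \<Sum>k\<le>d. const3 (coeff3 g i j k) * var_t ^ i * var_x1 ^ j * var_x2 ^ k) a b c
    = (\<Sum>i\<le>d. \<Sum>j\<le>d. \<Sum>k\<le>d. coeff3 (const3 (coeff3 g i j k) * mono3 i j k) a b c)"
    by (simp only: coeff3_sum mono3_def mult.assoc)
  also have "\<dots> = (\<Sum>i\<le>d. \<Sum>j\<le>d. \<Sum>k\<le>d. if k = c then (if i = a \<and> j = b then coeff3 g a b c else 0) else 0)"
    by (intro sum.cong refl) (auto simp: coeff3_mono3)
  also have "\<dots> = (\<Sum>i\<le>d. \<Sum>j\<le>d. if j = b then (if i = a \<and> c \<le> d then coeff3 g a b c else 0) else 0)"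
    by (intro sum.cong refl) (auto simp: sum.delta)
  also have "\<dots> = (\<Sum>i\<le>d. if i = a then (if b \<le> d \<and> c \<le> d then coeff3 g a b c else 0) else 0)"
    by (intro sum.cong refl) (auto simp: sum.delta)
  also have "\<dots> = (if a \<le> d \<and> b \<le> d \<and> c \<le> d then coeff3 g a b c else 0)"
    by (auto simp: sum.delta)
  also have "\<dots> = coeff3 g a b c"
    using homogeneous3_coeff_0 [OF assms, of a b c] by auto
  finally show "coeff3 (\<Sum>i\<le>d. \<Sum>j\<le>d. \<Sum>k\<le>d. const3 (coeff3 g i j k) * var_t ^ i * var_x1 ^ j * var_x2 ^ k) a b c
    = coeff3 g a b c" .
qed

lemma hom_mat_pencil:
  assumes "D \<in> carrier_mat d d" "R \<in> carrier_mat d d"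
  shows "hom_mat d 1 (pencil d D R)" "hom_mat d 1 (direction d D R)"
proof -
  have v: "homogeneous3 (Suc 0) (var_x1 * const3 c)" "homogeneous3 (Suc 0) (var_x2 * const3 c)" for c
    by (simp_all add: homogeneous3_const3_mult mult.commute [of _ "const3 c"])
  show "hom_mat d 1 (pencil d D R)" "hom_mat d 1 (direction d D R)"
    using assms pencil_carrier [OF assms] v
    by (auto simp: hom_mat_def pencil_index direction_index intro!: homogeneous3_add)
qed

lemma pairing_homogeneous:
  assumes "hom_mat d m U" "hom_mat d n A" "k = m + n"
  shows "homogeneous3 k (pairing d U A)"
  unfolding pairing_def
  by (intro homogeneous3_sum homogeneous3_mult_eq [of m _ n]) (use assms in \<open>auto intro: hom_matD(2)\<close>)

lemma dPhi_pairing: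
  assumes d: "d \<ge> 1" and DR: "D \<in> carrier_mat d d" "R \<in> carrier_mat d d"
    and ES: "E \<in> carrier_mat d d" "S \<in> carrier_mat d d"
  shows "dPhi d (D, R) (E, S) = pairing d (direction d E S) (adj_mat (pencil d D R))"
proof -
  let ?M = "pencil d D R" and ?W = "direction d E S"
  have M: "?M \<in> carrier_mat d d" and W: "?W \<in> carrier_mat d d"
    using pencil_carrier DR ES by auto
  \<comment> \<open>The line of pencils as one matrix over polynomials in a new parameter.
    Evaluation at \<open>const3 e\<close> gives its points, and Jacobi's formula at 0 gives the
    linear coefficient of its determinant.\<close>
  define MP where "MP = Matrix.mat d d (\<lambda>(i, j). [:?M $$ (i, j), ?W $$ (i, j):])"
  have MP: "MP \<in> carrier_mat d d" by (simp add: MP_def)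
  let ?P = "det MP"
  have ev: "Phi d (D + e \<cdot>\<^sub>m E, R + e \<cdot>\<^sub>m S) = poly ?P (const3 e)" for e
  proof -
    interpret comm_ring_hom "\<lambda>p. poly p (const3 e)" by unfold_locales auto
    have "pencil d (D + e \<cdot>\<^sub>m E) (R + e \<cdot>\<^sub>m S) = map_mat (\<lambda>p. poly p (const3 e)) MP"
      using DR ES M W pencil_carrier(1) [of "D + e \<cdot>\<^sub>m E" d "R + e \<cdot>\<^sub>m S"]
      by (intro eq_matI) (auto simp: MP_def pencil_index direction_index algebra_simps)
    moreover have "Phi d (D + e \<cdot>\<^sub>m E, R + e \<cdot>\<^sub>m S) = det (pencil d (D + e \<cdot>\<^sub>m E) (R + e \<cdot>\<^sub>m S))"
      using DR ES by (intro Phi_pencil) auto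
    ultimately show ?thesis by simp
  qed
  have P1: "coeff ?P 1 = pairing d ?W (adj_mat ?M)"
  proof -
    interpret comm_ring_hom "\<lambda>p. poly p (0 :: poly3)" by unfold_locales auto
    have M0: "map_mat (\<lambda>p. poly p 0) MP = ?M"
      using M by (intro eq_matI) (auto simp: MP_def)
    have "coeff ?P 1 = poly (pderiv ?P) 0"
      by (simp add: poly_0_coeff_0 coeff_pderiv)
    also have "pderiv ?P = (\<Sum>i<d. \<Sum>j<d. pderiv (MP $$ (i, j)) * adj_mat MP $$ (j, i))"
      by (rule derivation_det [OF derivation_pderiv MP])
    also have "poly \<dots> 0 = (\<Sum>i<d. \<Sum>j<d. ?W $$ (i, j) * adj_mat ?M $$ (j, i))"
      unfolding poly_sum
    proof (intro sum.cong refl)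
      fix i j assume ij: "i \<in> {..<d}" "j \<in> {..<d}"
      have "adj_mat ?M $$ (j, i) = map_mat (\<lambda>p. poly p 0) (adj_mat MP) $$ (j, i)"
        using hom_adj_mat [OF MP] M0 by simp
      also have "\<dots> = poly (adj_mat MP $$ (j, i)) 0"
        using ij adj_mat(1) [OF MP] by simp
      finally show "poly (pderiv (MP $$ (i, j)) * adj_mat MP $$ (j, i)) 0 = ?W $$ (i, j) * adj_mat ?M $$ (j, i)"
        using ij by (simp add: MP_def pderiv_pCons)
    qed
    finally show ?thesis by (simp add: pairing_def)
  qed
  have h: "homogeneous3 d (pairing d ?W (adj_mat ?M))"
    by (rule pairing_homogeneous [OF hom_mat_pencil(2) [OF ES] hom_mat_adj [OF hom_mat_pencil(1) [OF DR]]])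
      (use d in simp)
  show ?thesis
    unfolding dPhi_def prod.case ev coeff3_poly_deriv P1 by (rule homogeneous3_box_expand [OF h])
qed

text \<open>Jacobi's formula, the entrywise derivatives of the pencil being \<open>I\<close>,
  \<open>D\<close> and \<open>R\<close>. These are symmetric for members of
  \<open>matrix_pairs\<close>, which later makes the trivialising matrices symmetric.\<close>

lemma pd_det_pencil:
  assumes "D \<in> carrier_mat d d" "R \<in> carrier_mat d d"
  defines "A \<equiv> adj_mat (pencil d D R)"
  shows "pderiv (det (pencil d D R)) = pairing d (1\<^sub>m d) A"
    "pd_x1 (det (pencil d D R)) = pairing d (map_mat const3 D) A"
    "pd_x2 (det (pencil d D R)) = pairing d (map_mat const3 R) A"
proof -
  have M: "pencil d D R \<in> carrier_mat d d" by (rule pencil_carrier [OF assms(1,2)])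
  have v: "coeff3 (const3 z) i j k = (if i = 0 \<and> j = 0 \<and> k = 0 then z else 0)"
    "coeff3 var_t i j k = (if i = 1 \<and> j = 0 \<and> k = 0 then 1 else 0)"
    "coeff3 var_x1 i j k = (if i = 0 \<and> j = 1 \<and> k = 0 then 1 else 0)"
    "coeff3 var_x2 i j k = (if i = 0 \<and> j = 0 \<and> k = 1 then 1 else 0)" for z i j k
    using coeff3_const3_mult [of z 1 i j k] coeff3_mono3 [of 1 0 0 i j k] coeff3_mono3 [of 0 1 0 i j k]
      coeff3_mono3 [of 0 0 1 i j k] by (auto simp: coeff3_1 mono3_def)
  have vars: "pderiv var_t = 1" "pderiv var_x1 = 0" "pderiv var_x2 = 0" "pderiv (const3 z) = 0"
    "pd_x1 var_t = 0" "pd_x1 var_x1 = 1" "pd_x1 var_x2 = 0" "pd_x1 (const3 z) = 0"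
    "pd_x2 var_t = 0" "pd_x2 var_x1 = 0" "pd_x2 var_x2 = 1" "pd_x2 (const3 z) = 0" for z
    by (auto simp: coeff3_pd v coeff3_1 intro!: poly3_eqI)
  have e: "pderiv (pencil d D R $$ (i, j)) = 1\<^sub>m d $$ (i, j)"
    "pd_x1 (pencil d D R $$ (i, j)) = map_mat const3 D $$ (i, j)"
    "pd_x2 (pencil d D R $$ (i, j)) = map_mat const3 R $$ (i, j)" if "i < d" "j < d" for i j
    using that assms(1,2)
    by (auto simp: pencil_index vars derivation_simps [OF derivation_pderiv] derivation_simps [OF derivation_pd(1)]
        derivation_simps [OF derivation_pd(2)])
  show "pderiv (det (pencil d D R)) = pairing d (1\<^sub>m d) A"
    "pd_x1 (det (pencil d D R)) = pairing d (map_mat const3 D) A"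
    "pd_x2 (det (pencil d D R)) = pairing d (map_mat const3 R) A"
    unfolding derivation_det [OF derivation_pderiv M] derivation_det [OF derivation_pd(1) M]
      derivation_det [OF derivation_pd(2) M] pairing_def A_def
    by (intro sum.cong refl; simp only: e lessThan_iff)+
qed

section \<open>The kernel of the differential\<close>

lemma matrix_pairsD:
  assumes "(E, S) \<in> matrix_pairs d"
  shows "E \<in> carrier_mat d d" "S \<in> carrier_mat d d" "S\<^sup>T = S"
    "i < d \<Longrightarrow> j < d \<Longrightarrow> i \<noteq> j \<Longrightarrow> E $$ (i, j) = 0"
  using assms by (auto simp: matrix_pairs_def diagonal_mat_def)

lemma matrix_pairs_symmetric:
  assumes "(E, S) \<in> matrix_pairs d" "i < d" "j < d"
  shows "E $$ (j, i) = E $$ (i, j)" "S $$ (j, i) = S $$ (i, j)"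
proof -
  note m = matrix_pairsD [OF assms(1)]
  show "E $$ (j, i) = E $$ (i, j)"
    using m(4) assms(2,3) by (cases "i = j") auto
  have "S\<^sup>T $$ (i, j) = S $$ (j, i)" using m(2) assms(2,3) by simp
  then show "S $$ (j, i) = S $$ (i, j)" by (simp add: m(3))
qed

lemma pairing_linear:
  assumes "U \<in> carrier_mat d d"
  shows "V \<in> carrier_mat d d \<Longrightarrow> pairing d (U + V) A = pairing d U A + pairing d V A"
    "V \<in> carrier_mat d d \<Longrightarrow> pairing d (U - V) A = pairing d U A - pairing d V A"
    "pairing d (c \<cdot>\<^sub>m U) A = c * pairing d U A"
  using assms
  by (auto simp: pairing_def sum.distrib sum_subtractf sum_distrib_left algebra_simps)

lemma det_zero_row_or_col:
  assumes "A \<in> carrier_mat n n" "i < n"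
  shows "(\<And>j. j < n \<Longrightarrow> A $$ (i, j) = 0) \<Longrightarrow> det A = 0"
    "(\<And>j. j < n \<Longrightarrow> A $$ (j, i) = 0) \<Longrightarrow> det A = 0"
  using laplace_expansion_row [OF assms] laplace_expansion_column [OF assms] by simp_all

text \<open>A minor that does not omit both row and column \<open>i\<close> still contains a zero
  row or a zero column.\<close>

lemma adj_mat_zero_row_col:
  assumes N: "N \<in> carrier_mat d d" and i: "i < d"
    and zero: "\<And>j. j < d \<Longrightarrow> N $$ (i, j) = 0" "\<And>j. j < d \<Longrightarrow> N $$ (j, i) = 0"
    and kl: "k < d" "l < d" "(k, l) \<noteq> (i, i)"
  shows "adj_mat N $$ (k, l) = 0"
proof -
  have D: "mat_delete N l k \<in> carrier_mat (d - 1) (d - 1)" using N by (auto simp: mat_delete_def)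
  have "det (mat_delete N l k) = 0"
  proof (cases "l = i")
    case False
    \<comment> \<open>The position of row \<open>i\<close> once row \<open>l\<close> is
      deleted.\<close>
    define i' where "i' = (if i < l then i else i - 1)"
    have i': "i' < d - 1" using False i kl by (auto simp: i'_def)
    show ?thesis
      by (rule det_zero_row_or_col(1) [OF D i'])
        (use N False i kl i' zero in \<open>auto simp: mat_delete_def i'_def split: if_splits\<close>)
  next
    case True
    then have ki: "k \<noteq> i" using kl by auto
    define i' where "i' = (if i < k then i else i - 1)"
    have i': "i' < d - 1" using ki i kl by (auto simp: i'_def)
    show ?thesis
      by (rule det_zero_row_or_col(2) [OF D i'])
        (use N ki i kl i' zero in \<open>auto simp: mat_delete_def i'_def split: if_splits\<close>)
  qed
  then show ?thesis using N kl by (simp add: adj_mat_def cofactor_def)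
qed

text \<open>At the point \<open>(- D_ii, 1, 0)\<close> only the \<open>i\<close>-th diagonal entry of the adjugate can survive, and it does
  because the curve meets the line \<open>x2 = 0\<close> transversally.\<close>

lemma dPhi_kernel_diagonal:
  assumes DR: "(D, R) \<in> matrix_pairs d" and ES: "(E, S) \<in> matrix_pairs d"
    and sec: "fills N (ideal_gen 3 (section_gens (det (pencil d D R))))"
    and ker: "pairing d (direction d E S) (adj_mat (pencil d D R)) = 0"
  shows "E = 0\<^sub>m d d"
proof -
  note D = matrix_pairsD [OF DR] and E = matrix_pairsD [OF ES]
  let ?M = "pencil d D R"
  have M: "?M \<in> carrier_mat d d" by (rule pencil_carrier [OF D(1,2)])
  have "E $$ (i, i) = 0" if i: "i < d" for i
  proof -
    \<comment> \<open>At this point the pencil becomes the diagonal matrix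
      \<open>D - D_ii I\<close>, whose row and column \<open>i\<close> vanish.\<close>
    let ?ev = "\<lambda>p. eval3 p (- D $$ (i, i)) 1 0"
    interpret comm_ring_hom ?ev
      by unfold_locales (simp_all add: eval3_simps)
    let ?A = "adj_mat (map_mat ?ev ?M)"
    have A: "?ev (adj_mat ?M $$ (k, l)) = ?A $$ (k, l)" if "k < d" "l < d" for k l
      unfolding hom_adj_mat [OF M] using that adj_mat(1) [OF M] by simp
    have A0: "?A $$ (k, l) = 0" if "k < d" "l < d" "(k, l) \<noteq> (i, i)" for k l
    proof (rule adj_mat_zero_row_col [OF _ i _ _ that])
      show "map_mat ?ev ?M \<in> carrier_mat d d" using M by simp
      show "map_mat ?ev ?M $$ (i, j) = 0" "map_mat ?ev ?M $$ (j, i) = 0" if "j < d" for j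
        using M i that D by (auto simp: pencil_index eval3_simps)
    qed
    have pair: "?ev (pairing d U (adj_mat ?M)) = ?ev (U $$ (i, i)) * ?A $$ (i, i)" for U
    proof -
      have "?ev (pairing d U (adj_mat ?M)) = (\<Sum>j<d. \<Sum>k<d. ?ev (U $$ (j, k)) * ?A $$ (k, j))"
        unfolding pairing_def eval3_simps by (intro sum.cong refl) (simp add: A)
      also have "\<dots> = (\<Sum>j<d. \<Sum>k<d. if k = i then (if j = i then ?ev (U $$ (i, i)) * ?A $$ (i, i) else 0) else 0)"
        by (intro sum.cong refl) (use A0 in auto)
      also have "\<dots> = (\<Sum>j<d. if j = i then ?ev (U $$ (i, i)) * ?A $$ (i, i) else 0)"
        by (intro sum.cong refl) (use i in simp)
      also have "\<dots> = ?ev (U $$ (i, i)) * ?A $$ (i, i)"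
        using i by simp
      finally show ?thesis .
    qed
    have "mono3 0 N 0 \<in> ideal_gen 3 (section_gens (det ?M))" using sec by (simp add: fills_def)
    then obtain a where "mono3 0 N 0 = (\<Sum>l<3. a l * section_gens (det ?M) l)"
      by (auto simp: ideal_gen_def)
    then have "var_x1 ^ N = a 0 * pairing d (1\<^sub>m d) (adj_mat ?M) + a 1 * pairing d (map_mat const3 D) (adj_mat ?M)
        + a 2 * var_x2"
      by (simp add: mono3_def section_gens_def eval_nat_numeral pd_det_pencil [OF D(1,2)])
    then have "?ev (var_x1 ^ N) = ?ev (a 0 * pairing d (1\<^sub>m d) (adj_mat ?M)
        + a 1 * pairing d (map_mat const3 D) (adj_mat ?M) + a 2 * var_x2)" by simp
    \<comment> \<open>At the point x1^N is 1 and x2 is 0, and both remaining generators are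
      multiples of the \<open>i\<close>-th diagonal entry of the adjugate, so that entry is
      nonzero.\<close>
    then have "1 = ?ev (a 0) * ?ev (pairing d (1\<^sub>m d) (adj_mat ?M))
        + ?ev (a 1) * ?ev (pairing d (map_mat const3 D) (adj_mat ?M))"
      by (simp add: eval3_simps eval3_power)
    then have "?A $$ (i, i) \<noteq> 0" by (auto simp: pair)
    moreover have "?ev (pairing d (direction d E S) (adj_mat ?M)) = E $$ (i, i) * ?A $$ (i, i)"
      unfolding pair using i E by (simp add: direction_index eval3_simps)
    ultimately show ?thesis using ker by (simp add: eval3_simps)
  qed
  then have "E $$ (i, j) = 0" if "i < d" "j < d" for i j
    using that E(4) by (cases "i = j") auto
  then show ?thesis using E(1) by (intro eq_matI) auto
qed

text \<open>The generators are pairings with \<open>I\<close>, \<open>D\<close>, \<open>R\<close>,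
  so the cofactors of the monomial assemble into the symmetric matrix
  \<open>U = a0 I + a1 D + a2 R\<close>. Cutting them to degree \<open>N - (d - 1)\<close> makes
  \<open>U\<close> homogeneous.\<close>

lemma power_as_pairing:
  assumes d: "d \<ge> 1" "N \<ge> d" and DR: "(D, R) \<in> matrix_pairs d"
    and smooth: "fills N (ideal_gen 3 (smoothness_gens (det (pencil d D R))))"
    and m: "m = mono3 i j k" "i + j + k = N"
  obtains U where "hom_mat d (N - (d - 1)) U" "U\<^sup>T = U" "pairing d U (adj_mat (pencil d D R)) = m"
proof -
  note D = matrix_pairsD [OF DR]
  have DT: "D $$ (j, i) = D $$ (i, j)" "R $$ (j, i) = R $$ (i, j)" if "i < d" "j < d" for i j
    by (rule matrix_pairs_symmetric [OF DR that])+
  let ?M = "pencil d D R" and ?n = "N - (d - 1)"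
  let ?A = "adj_mat ?M"
  let ?D = "map_mat const3 D" and ?R = "map_mat const3 R"
  have c: "1\<^sub>m d \<in> carrier_mat d d" "?D \<in> carrier_mat d d" "?R \<in> carrier_mat d d" using D by auto
  have Ah: "hom_mat d (d - 1) ?A" by (rule hom_mat_adj [OF hom_mat_pencil(1) [OF D(1,2)]])
  have h0: "hom_mat d 0 (1\<^sub>m d)" "hom_mat d 0 ?D" "hom_mat d 0 ?R"
    using D by (auto simp: hom_mat_def)
  have ph: "homogeneous3 (d - 1) (pairing d V ?A)" if "hom_mat d 0 V" for V
    by (rule pairing_homogeneous [OF that Ah]) simp
  have "m \<in> ideal_gen 3 (smoothness_gens (det ?M))" using smooth m by (auto simp: fills_def)
  then obtain a where "m = (\<Sum>l<3. a l * smoothness_gens (det ?M) l)" by (auto simp: ideal_gen_def)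
  then have "m = pairing d (1\<^sub>m d) ?A * a 0 + pairing d ?D ?A * a 1 + pairing d ?R ?A * a 2"
    by (simp add: smoothness_gens_def eval_nat_numeral pd_det_pencil [OF D(1,2)] mult.commute)
  then have "hcomp ((d - 1) + ?n) m = pairing d (1\<^sub>m d) ?A * hcomp ?n (a 0)
      + pairing d ?D ?A * hcomp ?n (a 1) + pairing d ?R ?A * hcomp ?n (a 2)"
    by (simp only: hcomp_linear hcomp_mult [OF ph [OF h0(1)]] hcomp_mult [OF ph [OF h0(2)]] hcomp_mult [OF ph [OF h0(3)]])
  moreover have "hcomp ((d - 1) + ?n) m = m"
    using homogeneous3_mono3 [of i j k] m d by (simp add: homogeneous3_iff_hcomp)
  ultimately have meq: "m = pairing d (1\<^sub>m d) ?A * hcomp ?n (a 0)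
      + pairing d ?D ?A * hcomp ?n (a 1) + pairing d ?R ?A * hcomp ?n (a 2)" by simp
  define U where "U = hcomp ?n (a 0) \<cdot>\<^sub>m 1\<^sub>m d + (hcomp ?n (a 1) \<cdot>\<^sub>m ?D + hcomp ?n (a 2) \<cdot>\<^sub>m ?R)"
  show ?thesis
  proof (rule that [of U])
    show "hom_mat d ?n U"
      unfolding U_def
      by (intro hom_mat_add hom_mat_smult [OF homogeneous3_hcomp h0(1)] hom_mat_smult [OF homogeneous3_hcomp h0(2)]
          hom_mat_smult [OF homogeneous3_hcomp h0(3)]) simp_all
    show "U\<^sup>T = U"
      unfolding U_def using D DT by (intro eq_matI) auto
    show "pairing d U ?A = m"
      unfolding U_def using c
      by (simp add: pairing_linear meq mult.commute)
  qed
qed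

lemma dPhi_kernel:
  assumes d: "d \<ge> 1" "N \<ge> d" and DR: "(D, R) \<in> matrix_pairs d" and ES: "(E, S) \<in> matrix_pairs d"
    and q: "det (pencil d D R) \<in> forms d"
    and smooth: "fills N (ideal_gen 3 (smoothness_gens (det (pencil d D R))))"
    and sec: "fills N (ideal_gen 3 (section_gens (det (pencil d D R))))"
    and ker: "pairing d (direction d E S) (adj_mat (pencil d D R)) = 0"
  shows "E = 0\<^sub>m d d \<and> S = 0\<^sub>m d d"
proof
  note D = matrix_pairsD [OF DR] and S = matrix_pairsD [OF ES]
  let ?A = "adj_mat (pencil d D R)"
  let ?M0 = "direction d D R"
  show E: "E = 0\<^sub>m d d" by (rule dPhi_kernel_diagonal [OF DR ES sec ker])
  \<comment> \<open>Once \<open>E = 0\<close> the direction is x2 times a constant matrix; x2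
    cancels and \<open>S\<close> itself pairs to zero with the adjugate.\<close>
  have "direction d E S = var_x2 \<cdot>\<^sub>m map_mat const3 S"
    using S by (intro eq_matI) (auto simp: direction_def E)
  then have "var_x2 * pairing d (map_mat const3 S) ?A = 0"
    using ker S pairing_linear(3) [of "map_mat const3 S" d] by simp
  then have SA: "pairing d (map_mat const3 S) ?A = 0" by (simp add: var_x2_def)
  obtain U1 where U1: "hom_mat d (N - (d - 1)) U1" "U1\<^sup>T = U1" "pairing d U1 ?A = var_x1 ^ N"
    by (rule power_as_pairing [OF d DR smooth, of "var_x1 ^ N" 0 N 0]) (simp_all add: mono3_def)
  obtain U2 where U2: "hom_mat d (N - (d - 1)) U2" "U2\<^sup>T = U2" "pairing d U2 ?A = var_x2 ^ N"
    by (rule power_as_pairing [OF d DR smooth, of "var_x2 ^ N" 0 0 N]) (simp_all add: mono3_def)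
  have deg: "degree (var_x1 * const3 z) = 0" "degree (var_x2 * const3 z) = 0" for z
    by (simp_all add: var_x1_def var_x2_def const3_def)
  have DT: "D $$ (j, i) = D $$ (i, j)" "R $$ (j, i) = R $$ (i, j)" if "i < d" "j < d" for i j
    by (rule matrix_pairs_symmetric [OF DR that])+
  have "map_mat const3 S = 0\<^sub>m d d"
  proof (rule adjugate_entries_independent [OF d, of ?M0 "pencil d D R", OF _ _ _ _ _ U1 U2 _ _ SA])
    have "degree (p + q) = 0" if "degree p = 0" "degree q = 0" for p q :: poly3
      using degree_add_le_max [of p q] that by simp
    then show "t_free_mat d ?M0"
      using D pencil_carrier(2) deg by (simp add: t_free_mat_def direction_index)
    show "hom_mat d 1 ?M0" by (rule hom_mat_pencil(2) [OF D(1,2)])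
    show "?M0\<^sup>T = ?M0"
      using D DT by (intro eq_matI) (auto simp: direction_def)
    show "pencil d D R = var_t \<cdot>\<^sub>m 1\<^sub>m d + ?M0" by (simp add: pencil_def direction_def)
    show "coeff3 (det (pencil d D R)) d 0 0 = 1" using q by (simp add: forms_iff)
    show "hom_mat d 0 (map_mat const3 S)" using S by (auto simp: hom_mat_def)
    show "(map_mat const3 S)\<^sup>T = map_mat const3 S"
      using S by (metis map_mat_transpose)
  qed
  then have "map_mat const3 S $$ (i, j) = 0" if "i < d" "j < d" for i j using that by simp
  then show "S = 0\<^sub>m d d" using S by (intro eq_matI) auto
qed

section \<open>Bijectivity of the differential\<close>

lemma dPhi_inj_on:
  assumes d: "d \<ge> 1" and DR: "(D, R) \<in> matrix_pairs d"
    and ker: "\<And>E S. (E, S) \<in> matrix_pairs d \<Longrightarrow> pairing d (direction d E S) (adj_mat (pencil d D R)) = 0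
      \<Longrightarrow> E = 0\<^sub>m d d \<and> S = 0\<^sub>m d d"
  shows "inj_on (dPhi d (D, R)) (matrix_pairs d)"
proof (rule inj_onI, clarify)
  fix E S E' S'
  assume ES: "(E, S) \<in> matrix_pairs d" and ES': "(E', S') \<in> matrix_pairs d"
    and eq: "dPhi d (D, R) (E, S) = dPhi d (D, R) (E', S')"
  note D = matrix_pairsD [OF DR] and S = matrix_pairsD [OF ES] and S' = matrix_pairsD [OF ES']
  have sym: "S $$ (j, i) = S $$ (i, j)" "S' $$ (j, i) = S' $$ (i, j)" if "i < d" "j < d" for i j
    by (rule matrix_pairs_symmetric(2) [OF ES that] matrix_pairs_symmetric(2) [OF ES' that])+
  have m: "(E - E', S - S') \<in> matrix_pairs d"
    using S S' sym by (auto simp: matrix_pairs_def diagonal_mat_def minus_carrier_mat intro!: eq_matI)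
  have "direction d (E - E') (S - S') = direction d E S - direction d E' S'"
    using S S' by (intro eq_matI) (auto simp: direction_def algebra_simps)
  then have "pairing d (direction d (E - E') (S - S')) (adj_mat (pencil d D R)) = 0"
    using eq S S' by (simp add: dPhi_pairing [OF d D(1,2)] pairing_linear [of _ d] pencil_carrier)
  then have z: "E - E' = 0\<^sub>m d d" "S - S' = 0\<^sub>m d d" using ker [OF m] by auto
  have "X = Y" if "X - Y = 0\<^sub>m d d" "X \<in> carrier_mat d d" "Y \<in> carrier_mat d d" for X Y :: "complex mat"
  proof (rule eq_matI)
    fix i j assume ij: "i < dim_row Y" "j < dim_col Y"
    then have "(X - Y) $$ (i, j) = 0" using that by simp
    then show "X $$ (i, j) = Y $$ (i, j)" using ij that(2,3) by simp
  qed (use that in auto)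
  then show "E = E' \<and> S = S'" using z S S' by blast
qed

text \<open>Pairs \<open>(i, j)\<close> with \<open>i < d\<close>, \<open>i \<le> j \<le> d\<close> index the coordinates on both sides: \<open>(i, d)\<close> stands for the
  diagonal entry \<open>E_ii\<close>, \<open>(i, j)\<close> with \<open>j < d\<close> for the entry \<open>S_ij\<close>, and \<open>(i, j)\<close> for the coefficient of
  \<open>t^i * x1^(d-j) * x2^(j-i)\<close> in a tangent form.\<close>

definition coord_set :: "nat \<Rightarrow> (nat \<times> nat) set" where
  "coord_set d = {(i, j). i < d \<and> i \<le> j \<and> j \<le> d}"

definition pair_of :: "nat \<Rightarrow> (nat \<times> nat \<Rightarrow> complex) \<Rightarrow> complex mat \<times> complex mat" where
  "pair_of d x = (Matrix.mat d d (\<lambda>(k, l). if k = l then x (k, d) else 0),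
    Matrix.mat d d (\<lambda>(k, l). x (min k l, max k l)))"

definition form_coord :: "nat \<Rightarrow> poly3 \<Rightarrow> nat \<times> nat \<Rightarrow> complex" where
  "form_coord d p = (\<lambda>(i, j). coeff3 p i (d - j) (j - i))"

lemma pair_of_matrix_pairs: "pair_of d x \<in> matrix_pairs d"
  by (auto simp: pair_of_def matrix_pairs_def diagonal_mat_def min.commute max.commute intro!: eq_matI)

lemma finite_coord_set: "finite (coord_set d)"
  by (rule finite_subset [of _ "{..d} \<times> {..d}"]) (auto simp: coord_set_def)

lemma forms_tangent_eqI:
  assumes "g \<in> forms_tangent d" "h \<in> forms_tangent d" "\<And>u. u \<in> coord_set d \<Longrightarrow> form_coord d g u = form_coord d h u"
  shows "g = h"
proof (rule poly3_eqI)
  fix a b c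
  have hom: "homogeneous3 d g" "homogeneous3 d h" and top: "coeff3 g d 0 0 = 0" "coeff3 h d 0 0 = 0"
    using assms by (auto simp: forms_tangent_iff)
  consider "a + b + c \<noteq> d" | "a = d" "b = 0" "c = 0" | "a + b + c = d" "a < d" by linarith
  then show "coeff3 g a b c = coeff3 h a b c"
  proof cases
    case 1
    then show ?thesis using homogeneous3_coeff_0 hom by simp
  next
    case 2
    then show ?thesis using top by simp
  next
    case 3
    then have "(a, d - b) \<in> coord_set d" "d - (d - b) = b" "d - b - a = c" by (auto simp: coord_set_def)
    then show ?thesis using assms(3) [of "(a, d - b)"] by (simp add: form_coord_def)
  qed
qed

text \<open>Source and target share the coordinates \<open>coord_set d\<close>, d (d + 3) / 2 in
  number. The differential is thus a square matrix \<open>G\<close>, and a trivial kernel makes it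
  invertible.\<close>

lemma dPhi_surj:
  assumes d: "d \<ge> 1" and DR: "(D, R) \<in> matrix_pairs d"
    and ker: "\<And>E S. (E, S) \<in> matrix_pairs d \<Longrightarrow> pairing d (direction d E S) (adj_mat (pencil d D R)) = 0
      \<Longrightarrow> E = 0\<^sub>m d d \<and> S = 0\<^sub>m d d"
    and g: "g \<in> forms_tangent d"
  shows "g \<in> dPhi d (D, R) ` matrix_pairs d"
proof -
  note DRc = matrix_pairsD [OF DR]
  let ?A = "adj_mat (pencil d D R)" and ?J = "coord_set d"
  define L where "L = (\<lambda>x. pairing d (direction d (fst (pair_of d x)) (snd (pair_of d x))) ?A)"
  define unit where "unit = (\<lambda>(u :: nat \<times> nat) p. if p = u then 1 else 0 :: complex)"
  have L: "L x = (\<Sum>k<d. \<Sum>l<d. (var_x1 * const3 (if k = l then x (k, d) else 0)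
      + var_x2 * const3 (x (min k l, max k l))) * ?A $$ (l, k))" for x
    unfolding L_def pairing_def by (intro sum.cong refl) (simp add: pair_of_def direction_def)
  have L_add: "L (\<lambda>p. f p + h p) = L f + L h" for f h
    unfolding L sum.distrib [symmetric] by (intro sum.cong refl) (auto simp: algebra_simps)
  have L_mult: "L (\<lambda>p. c * f p) = const3 c * L f" for c f
    unfolding L sum_distrib_left by (intro sum.cong refl) (auto simp: algebra_simps)
  \<comment> \<open>Only values on \<open>coord_set d\<close> are read, as \<open>(k, d)\<close> and
    \<open>(min k l, max k l)\<close> lie in it. So the arbitrary values of \<open>inv_into\<close>
    elsewhere do no harm below.\<close>
  have L_cong: "L f = L h" if "\<And>p. p \<in> ?J \<Longrightarrow> f p = h p" for f h
  proof -
    have "f (k, d) = h (k, d)" "f (min k l, max k l) = h (min k l, max k l)" if "k < d" "l < d" for k l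
      using that \<open>\<And>p. p \<in> ?J \<Longrightarrow> f p = h p\<close> by (auto simp: coord_set_def min_def max_def)
    then show ?thesis unfolding L by (intro sum.cong refl) simp
  qed
  have L_sum: "L (\<lambda>p. \<Sum>u\<in>K. x u * unit u p) = (\<Sum>u\<in>K. const3 (x u) * L (unit u))" if "finite K" for K x
    using that
  proof (induction K rule: finite_induct)
    case empty
    then show ?case using L_mult [of 0 "\<lambda>_. 0"] by simp
  next
    case (insert u K)
    then show ?case using L_add [of "\<lambda>p. x u * unit u p"] L_mult [of "x u" "unit u"] by simp
  qed
  have L_exp: "L x = (\<Sum>u\<in>?J. const3 (x u) * L (unit u))" for x
  proof -
    have "L x = L (\<lambda>p. \<Sum>u\<in>?J. x u * unit u p)"
    proof (rule L_cong)
      fix p assume p: "p \<in> ?J"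
      have "(\<Sum>u\<in>?J. x u * unit u p) = (\<Sum>u\<in>?J. if u = p then x p else 0)"
        by (rule sum.cong) (auto simp: unit_def)
      then show "x p = (\<Sum>u\<in>?J. x u * unit u p)" using p finite_coord_set by simp
    qed
    then show ?thesis using L_sum [OF finite_coord_set] by simp
  qed
  have L_tangent: "L x \<in> forms_tangent d" for x
  proof -
    have "homogeneous3 d (L x)"
      unfolding L_def
      by (rule pairing_homogeneous [OF hom_mat_pencil(2) hom_mat_adj [OF hom_mat_pencil(1) [OF DRc(1,2)]]])
        (use d in \<open>auto simp: pair_of_def\<close>)
    moreover have "coeff3 (L x) d 0 0 = 0"
      unfolding L coeff3_sum by (intro sum.neutral ballI) (simp add: distrib_right mult.assoc coeff3_var_mult)
    ultimately show ?thesis by (simp add: forms_tangent_iff)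
  qed
  have L_inj: "x p = 0" if Lx: "L x = 0" and pJ: "p \<in> ?J" for x p
  proof -
    have z: "fst (pair_of d x) = 0\<^sub>m d d" "snd (pair_of d x) = 0\<^sub>m d d"
      using ker [of "fst (pair_of d x)" "snd (pair_of d x)"] pair_of_matrix_pairs [of d x] Lx by (auto simp: L_def)
    obtain i j where p: "p = (i, j)" "i < d" "i \<le> j" "j \<le> d" using pJ by (auto simp: coord_set_def)
    show ?thesis
    proof (cases "j = d")
      case True
      have "fst (pair_of d x) $$ (i, i) = x (i, d)" using p by (simp add: pair_of_def)
      then show ?thesis using z(1) p True by simp
    next
      case False
      then have "snd (pair_of d x) $$ (i, j) = x (i, j)" using p by (simp add: pair_of_def)
      then show ?thesis using z(2) p False by simp
    qed
  qed
  obtain js where js: "set js = ?J" "distinct js"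
    using finite_distinct_list [OF finite_coord_set] by blast
  define n where "n = length js"
  have bij: "bij_betw ((!) js) {..<n} ?J"
    by (rule bij_betw_nth) (use js in \<open>auto simp: n_def\<close>)
  define x_of where "x_of = (\<lambda>(w :: complex Matrix.vec) p. vec_index w (inv_into {..<n} ((!) js) p))"
  have x_of: "x_of w (js ! u) = vec_index w u" if "u < n" for w u
    using that bij by (simp add: x_of_def bij_betw_def inv_into_f_f)
  define G where "G = Matrix.mat n n (\<lambda>(v, u). form_coord d (L (unit (js ! u))) (js ! v))"
  have G: "G \<in> carrier_mat n n" by (simp add: G_def)
  have fc_sum: "form_coord d (sum f K) p = (\<Sum>u\<in>K. form_coord d (f u) p)"
    "form_coord d (const3 c * q) p = c * form_coord d q p" for f and K :: "nat set" and p c q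
    by (cases p, simp add: form_coord_def coeff3_sum)+
  have Gw: "vec_index (G *\<^sub>v w) v = form_coord d (L (x_of w)) (js ! v)" if w: "w \<in> carrier_vec n" and v: "v < n" for w v
  proof -
    have "L (x_of w) = (\<Sum>u<n. const3 (x_of w (js ! u)) * L (unit (js ! u)))"
      unfolding L_exp [of "x_of w"] by (rule sum.reindex_bij_betw [OF bij, symmetric])
    then have "form_coord d (L (x_of w)) (js ! v) = (\<Sum>u<n. vec_index w u * form_coord d (L (unit (js ! u))) (js ! v))"
      by (simp add: fc_sum x_of)
    also have "\<dots> = vec_index (G *\<^sub>v w) v"
      using w v by (simp add: G_def scalar_prod_def atLeast0LessThan mult.commute)
    finally show ?thesis ..
  qed
  have zero: "0 \<in> forms_tangent d" by (simp add: forms_tangent_iff)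
  have "det G \<noteq> 0"
  proof
    assume "det G = 0"
    then obtain w where w: "w \<in> carrier_vec n" "w \<noteq> 0\<^sub>v n" "G *\<^sub>v w = 0\<^sub>v n"
      using det_0_iff_vec_prod_zero_field [OF G] by auto
    have "L (x_of w) = 0"
    proof (rule forms_tangent_eqI [OF L_tangent zero])
      fix p assume "p \<in> ?J"
      then obtain v where "v < n" "p = js ! v" using js(1) by (metis in_set_conv_nth n_def)
      then show "form_coord d (L (x_of w)) p = form_coord d 0 p"
        using Gw [OF w(1)] w(3) by (simp add: form_coord_def split: prod.split)
    qed
    then have "vec_index w u = 0" if "u < n" for u
      using L_inj [of "x_of w" "js ! u"] x_of [OF that] that js by (metis n_def nth_mem)
    then have "w = 0\<^sub>v n" using w(1) by (intro eq_vecI) auto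
    then show False using w(2) by simp
  qed
  define y where "y = Matrix.vec n (\<lambda>v. form_coord d g (js ! v))"
  define w where "w = (1 / det G) \<cdot>\<^sub>v (adj_mat G *\<^sub>v y)"
  have y: "y \<in> carrier_vec n" by (simp add: y_def)
  have adj: "adj_mat G \<in> carrier_mat n n" "G * adj_mat G = det G \<cdot>\<^sub>m 1\<^sub>m n" using adj_mat [OF G] by auto
  have ay: "adj_mat G *\<^sub>v y \<in> carrier_vec n" using adj(1) y by (rule mult_mat_vec_carrier)
  have w: "w \<in> carrier_vec n" using ay by (simp add: w_def)
  have "G *\<^sub>v w = (1 / det G) \<cdot>\<^sub>v (G *\<^sub>v (adj_mat G *\<^sub>v y))"
    unfolding w_def by (rule mult_mat_vec [OF G ay])
  also have "G *\<^sub>v (adj_mat G *\<^sub>v y) = (G * adj_mat G) *\<^sub>v y"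
    by (rule assoc_mult_mat_vec [OF G adj(1) y, symmetric])
  also have "\<dots> = det G \<cdot>\<^sub>v y"
  proof (rule eq_vecI)
    fix i assume "i < dim_vec (det G \<cdot>\<^sub>v y)"
    then have i: "i < n" using y by simp
    have "(\<Sum>k<n. det G * (if k = i then 1 else 0) * vec_index y k) = (\<Sum>k<n. if k = i then det G * vec_index y i else 0)"
      by (rule sum.cong) auto
    then show "vec_index ((G * adj_mat G) *\<^sub>v y) i = vec_index (det G \<cdot>\<^sub>v y) i"
      unfolding adj(2) using y i by (simp add: scalar_prod_def atLeast0LessThan)
  qed (use G y in auto)
  finally have Gwy: "G *\<^sub>v w = y" using \<open>det G \<noteq> 0\<close> by (simp add: smult_smult_assoc)
  have "L (x_of w) = g"
  proof (rule forms_tangent_eqI [OF L_tangent g])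
    fix p assume "p \<in> ?J"
    then obtain v where "v < n" "p = js ! v" using js(1) by (metis in_set_conv_nth n_def)
    then show "form_coord d (L (x_of w)) p = form_coord d g p"
      using Gw [OF w, of v] Gwy by (simp add: y_def)
  qed
  moreover have "dPhi d (D, R) (pair_of d (x_of w)) = L (x_of w)"
    unfolding L_def using dPhi_pairing [OF d DRc(1,2), of "fst (pair_of d (x_of w))" "snd (pair_of d (x_of w))"]
    by (simp add: pair_of_def)
  ultimately show ?thesis using pair_of_matrix_pairs by (metis image_eqI)
qed

lemma not_ramified:
  assumes d: "d \<ge> 1" "N \<ge> d"
    and smooth: "fills N (ideal_gen 3 (smoothness_gens q))"
    and sec: "fills N (ideal_gen 3 (section_gens q))"
  shows "q \<notin> ramification_locus d"
proof
  assume "q \<in> ramification_locus d"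
  then obtain D R where q: "q \<in> forms d" and DR: "(D, R) \<in> matrix_pairs d" and Phi: "Phi d (D, R) = q"
    and nb: "\<not> bij_betw (dPhi d (D, R)) (matrix_pairs d) (forms_tangent d)"
    by (auto simp: ramification_locus_def)
  note DRc = matrix_pairsD [OF DR]
  have det: "det (pencil d D R) = q" using Phi_pencil [OF DRc(1,2)] Phi by simp
  have ker: "E = 0\<^sub>m d d \<and> S = 0\<^sub>m d d"
    if "(E, S) \<in> matrix_pairs d" "pairing d (direction d E S) (adj_mat (pencil d D R)) = 0" for E S
    by (rule dPhi_kernel [OF d DR that(1) _ _ _ that(2)]) (simp_all add: det q smooth sec)
  have "dPhi d (D, R) ` matrix_pairs d \<subseteq> forms_tangent d"
  proof clarify
    fix E S assume ES: "(E, S) \<in> matrix_pairs d"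
    note ESc = matrix_pairsD [OF ES]
    have eq: "dPhi d (D, R) (E, S) = pairing d (direction d E S) (adj_mat (pencil d D R))"
      by (rule dPhi_pairing [OF d(1) DRc(1,2) ESc(1,2)])
    have "homogeneous3 d (dPhi d (D, R) (E, S))"
      unfolding eq by (rule pairing_homogeneous [OF hom_mat_pencil(2) [OF ESc(1,2)]
            hom_mat_adj [OF hom_mat_pencil(1) [OF DRc(1,2)]]]) (use d in simp)
    \<comment> \<open>Every entry of a direction is a combination of x1 and x2, so t^d cannot
      occur.\<close>
    moreover have "coeff3 (dPhi d (D, R) (E, S)) d 0 0 = 0"
      unfolding eq pairing_def coeff3_sum
      by (intro sum.neutral ballI)
        (use ESc in \<open>simp add: direction_index distrib_right mult.assoc coeff3_var_mult\<close>)
    ultimately show "dPhi d (D, R) (E, S) \<in> forms_tangent d" by (simp add: forms_tangent_iff)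
  qed
  then have "bij_betw (dPhi d (D, R)) (matrix_pairs d) (forms_tangent d)"
    unfolding bij_betw_def using dPhi_inj_on [OF d(1) DR ker] dPhi_surj [OF d(1) DR ker] by blast
  then show False using nb by simp
qed

section \<open>Avoiding finitely many parameters\<close>

lemma avoiding_real_curve:
  fixes F :: "complex set"
  assumes F: "finite F" "0 \<notin> F"
  obtains Z where "real_algebraic_set Z" "Z \<noteq> UNIV"
    "\<And>c s. c \<notin> Z \<Longrightarrow> s \<in> closed_segment 0 c \<union> (closed_segment c 1 - {1}) \<Longrightarrow> s \<notin> F"
proof -
  \<comment> \<open>\<open>f0 b\<close> and \<open>f1 b\<close> are the real determinants of
    \<open>c\<close> with \<open>b\<close> and of \<open>c - 1\<close> with \<open>b - 1\<close>:
    they vanish when \<open>c\<close> is on the real line joining \<open>b\<close> to 0,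
    respectively to 1. For \<open>b = 1\<close> the second is the zero polynomial, so 1 is left out
    of the product.\<close>
  define f0 where "f0 = (\<lambda>b :: complex. [:[:0, - Re b:], [:Im b:]:])"
  define f1 where "f1 = (\<lambda>b :: complex. [:[:- Im b, 1 - Re b:], [:Im b:]:])"
  \<comment> \<open>The factor for the line \<open>Im c = 0\<close> keeps the first segment away from \<open>1\<close>, which may lie in \<open>F\<close>.\<close>
  define f :: "real poly poly" where "f = [:[:0, 1:]:] * (\<Prod>b\<in>F - {1}. f0 b * f1 b)"
  let ?v = "\<lambda>g (c :: complex). poly (poly g [:Re c:]) (Im c)"
  define Z where "Z = {c. ?v f c = 0}"
  have v0: "?v (f0 b) c = Re c * Im b - Im c * Re b" and v1: "?v (f1 b) c = (Re c - 1) * Im b - Im c * (Re b - 1)" for b c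
    by (simp_all add: f0_def f1_def algebra_simps)
  have vf: "?v f c = Im c * (\<Prod>b\<in>F - {1}. ?v (f0 b) c * ?v (f1 b) c)" for c
    by (simp add: f_def poly_prod)
  have "f0 b \<noteq> 0 \<and> f1 b \<noteq> 0" if "b \<in> F - {1}" for b
  proof -
    have "b \<noteq> 0" "b \<noteq> 1" using that F(2) by auto
    then show ?thesis by (auto simp: f0_def f1_def complex_eq_iff)
  qed
  then have f: "f \<noteq> 0" using F(1) by (auto simp: f_def)
  have "Z \<noteq> UNIV"
  proof
    assume U: "Z = UNIV"
    have "poly f [:u:] = 0" for u
    proof -
      have "poly (poly f [:u:]) v = 0" for v
      proof -
        have "Complex u v \<in> Z" using U by simp
        then show ?thesis by (simp add: Z_def)
      qed
      then show ?thesis using poly_all_0_iff_0 by blast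
    qed
    \<comment> \<open>A nonzero polynomial over a domain has finitely many roots, but all constants
      \<open>[:u:]\<close> would be roots of \<open>f\<close>.\<close>
    then have "range (\<lambda>u :: real. [:u:]) \<subseteq> {z. poly f z = 0}" by auto
    then have "finite (range (\<lambda>u :: real. [:u:]))" using poly_roots_finite [OF f] finite_subset by blast
    moreover have "inj (\<lambda>u :: real. [:u:])" by (auto intro: injI)
    ultimately show False using finite_imageD infinite_UNIV_char_0 by blast
  qed
  moreover have "real_algebraic_set Z"
    unfolding real_algebraic_set_def Z_def by (intro exI [of _ "{f}"]) simp
  moreover have "s \<notin> F" if c: "c \<notin> Z" and s: "s \<in> closed_segment 0 c \<union> (closed_segment c 1 - {1})" for c s
  proof
    assume sF: "s \<in> F"
    have Imc: "Im c \<noteq> 0" and nz: "\<And>b. b \<in> F - {1} \<Longrightarrow> ?v (f0 b) c \<noteq> 0 \<and> ?v (f1 b) c \<noteq> 0"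
      using c F(1) by (auto simp: Z_def vf)
    from s consider "s \<in> closed_segment 0 c" | "s \<in> closed_segment c 1" "s \<noteq> 1" by auto
    then show False
    proof cases
      case 1
      then obtain u :: real where u: "s = u *\<^sub>R c" by (auto simp: closed_segment_def)
      have "s \<noteq> 1" using u Imc sF F(2) by (auto simp: complex_eq_iff)
      then have "?v (f0 s) c \<noteq> 0" using nz sF by blast
      then show False by (simp add: v0 u)
    next
      case 2
      then obtain u :: real where u: "s = (1 - u) *\<^sub>R c + u *\<^sub>R 1" by (auto simp: closed_segment_def)
      have "?v (f1 s) c \<noteq> 0" using nz sF 2 by blast
      then show False by (simp add: v1 u algebra_simps)
    qed
  qed
  ultimately show ?thesis using that by blast
qed

theorem proposition2p5:
  fixes d :: nat and p :: poly3
  assumes "d \<ge> 1" and "p \<in> real_forms d"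
  shows "\<exists>Z :: complex set. real_algebraic_set Z \<and> Z \<noteq> UNIV \<and>
    (\<forall>c. c \<notin> Z \<longrightarrow>
      (\<forall>s \<in> closed_segment 0 c \<union> (closed_segment c 1 - {1}).
        N_op d s p \<notin> ramification_locus d))"
proof -
  have p: "p \<in> forms d" using assms(2) by (simp add: real_forms_def)
  obtain N F where N: "N \<ge> d" and F: "finite F" "0 \<notin> F"
    and good: "\<And>s. s \<notin> F \<Longrightarrow> fills N (ideal_gen 3 (smoothness_gens (N_op d s p)))"
      "\<And>s. s \<notin> F \<Longrightarrow> fills N (ideal_gen 3 (section_gens (N_op d s p)))"
    using N_path_fills_cofinite [OF assms(1) p] by blast
  obtain Z where Z: "real_algebraic_set Z" "Z \<noteq> UNIV"
    "\<And>c s. c \<notin> Z \<Longrightarrow> s \<in> closed_segment 0 c \<union> (closed_segment c 1 - {1}) \<Longrightarrow> s \<notin> F"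
    using avoiding_real_curve [OF F] by blast
  have "N_op d s p \<notin> ramification_locus d"
    if "c \<notin> Z" "s \<in> closed_segment 0 c \<union> (closed_segment c 1 - {1})" for c s
    by (rule not_ramified [OF assms(1) N good(1) good(2)]) (rule Z(3) [OF that])+
  then show ?thesis using Z(1,2) by blast
qed

end
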